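(* Let $n=2$ and $B=\operatorname{diag}(b_1^{-1},b_2^{-1})$ with $b_1,b_2\in\mathbb{C}\setminus\{0\}$ and $a:=b_1b_2^{-1}\notin\mathbb{R}$. Then the boundary conditions $$a_{j1}y_1(0)+a_{j2}y_2(0)+a_{j3}y_1(1)+a_{j4}y_2(1)=0,\quad j\in\{1,2\},$$ are weakly $B$-regular if and only if both operators $L_{C,D}(0)$ and $L_{C,D}(0)^*$ are complete in $L^2([0,1];\mathbb{C}^2)$.
   Context: The $a_{jk}$ are complex numbers and the $2\times4$ matrix $(a_{jk})$ has rank $2$. Put $C=\begin{pmatrix}a_{11}&a_{12}\\ a_{21}&a_{22}\end{pmatrix}$, $D=\begin{pmatrix}a_{13}&a_{14}\\ a_{23}&a_{24}\end{pmatrix}$, so the boundary conditions read $Cy(0)+Dy(1)=0$. $L_{C,D}(0)$ is the operator in $L^2([0,1];\mathbb{C}^2)$ acting by $Ly=-iBy'$ on $\{y\in W^1_2([0,1];\mathbb{C}^2): Cy(0)+Dy(1)=0\}$, and $L_{C,D}(0)^*$ is its adjoint. An operator $T$ is called complete if its system of root functions (eigenfunctions and associated functions, i.e. all elements of the root subspaces $\operatorname{span}\{\ker(T-\lambda)^k:k\in\mathbb{N}\}$ over all eigenvalues $\lambda$) has closed linear span equal to the whole space. The matrix $T_A(C,D)$. For a diagonal matrix $A=\operatorname{diag}(a_1,a_2)$ with $\operatorname{Re}a_k\neq0$, $T_A(C,D)$ is the $2\times2$ matrix whose $k$th column is the $k$th column of $C$ if $\operatorname{Re}a_k>0$ and the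 $k$th column of $D$ if $\operatorname{Re}a_k<0$. Weak regularity. The boundary conditions are weakly $B$-regular if there exist complex numbers $z_1,z_2,z_3$ (with $\operatorname{Re}(z_jB)$ nonsingular) such that the origin is an interior point of the triangle with vertices $z_1,z_2,z_3$ and $\det T_{z_jB}(C,D)\neq0$ for $j\in\{1,2,3\}$. *)

theory Defs
  imports "HOL-Analysis.Analysis"
begin

section \<open>The Hilbert space of square-integrable vector functions on [0,1]\<close>

text \<open>
  Elements of the Hilbert space are represented by functions on the real line, of which only the
  restriction to [0,1] matters; two functions represent the same element iff they agree
  almost everywhere on [0,1].
\<close>

type_synonym 'n vfun = "real \<Rightarrow> complex ^ 'n"

abbreviation unit_lebesgue :: "real measure" where
  "unit_lebesgue \<equiv> lebesgue_on {0..1}"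

definition L2 :: "'n::finite vfun set" where
  "L2 = {f \<in> borel_measurable unit_lebesgue. integrable unit_lebesgue (\<lambda>x. (norm (f x))\<^sup>2)}"

definition L2_norm :: "'n::finite vfun \<Rightarrow> real" where
  "L2_norm f = sqrt (LINT x|unit_lebesgue. (norm (f x))\<^sup>2)"

definition L2_inner :: "'n::finite vfun \<Rightarrow> 'n vfun \<Rightarrow> complex" where
  "L2_inner f g = (LINT x|unit_lebesgue. (\<Sum>j\<in>UNIV. f x $ j * cnj (g x $ j)))"

definition ae_eq :: "'n::finite vfun \<Rightarrow> 'n vfun \<Rightarrow> bool" where
  "ae_eq f g \<longleftrightarrow> (AE x in unit_lebesgue. f x = g x)"

definition lin_span :: "'n::finite vfun set \<Rightarrow> 'n vfun set" where
  "lin_span S =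
     {(\<lambda>x. \<Sum>k<m. c k *s f k x) | (m::nat) (c::nat \<Rightarrow> complex) f. \<forall>k<m. f k \<in> S}"

definition L2_closure :: "'n::finite vfun set \<Rightarrow> 'n vfun set" where
  "L2_closure S = {h \<in> L2. \<forall>\<epsilon>>0. \<exists>u\<in>S. L2_norm (\<lambda>x. h x - u x) < \<epsilon>}"


section \<open>Unbounded operators, root functions, completeness\<close>

text \<open>
  An operator is given by its graph: a set of pairs of square-integrable functions that is closed
  under changing either component on a null set. The kernel consists of all representatives of
  its elements.
\<close>

type_synonym 'n operator = "('n vfun \<times> 'n vfun) set"

definition op_kernel :: "'n::finite operator \<Rightarrow> 'n vfun set" where
  "op_kernel T = {f. \<exists>g. (f, g) \<in> T \<and> ae_eq g (\<lambda>x. 0)}"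

definition op_shift :: "'n::finite operator \<Rightarrow> complex \<Rightarrow> 'n operator" where
  "op_shift T \<mu> = {(f, \<lambda>x. g x - \<mu> *s f x) | f g. (f, g) \<in> T}"

definition op_eigenvalue :: "'n::finite operator \<Rightarrow> complex \<Rightarrow> bool" where
  "op_eigenvalue T \<mu> \<longleftrightarrow> (\<exists>f \<in> op_kernel (op_shift T \<mu>). \<not> ae_eq f (\<lambda>x. 0))"

text \<open>
  The relational power is the power of an unbounded operator on its natural domain.
  It starts at exponent 1, as exponent 0 contributes only the zero element.
\<close>

definition root_subspace :: "'n::finite operator \<Rightarrow> complex \<Rightarrow> 'n vfun set" where
  "root_subspace T \<mu> = lin_span (\<Union>k\<in>{1..}. op_kernel (op_shift T \<mu> ^^ k))"

definition root_functions :: "'n::finite operator \<Rightarrow> 'n vfun set" where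
  "root_functions T = (\<Union>\<mu>\<in>{\<mu>. op_eigenvalue T \<mu>}. root_subspace T \<mu>)"

definition complete_operator :: "'n::finite operator \<Rightarrow> bool" where
  "complete_operator T \<longleftrightarrow> L2_closure (lin_span (root_functions T)) = L2"

text \<open>For a densely defined operator, the following is the graph of its adjoint.\<close>

definition op_adjoint :: "'n::finite operator \<Rightarrow> 'n operator" where
  "op_adjoint T =
     {(g, h). g \<in> L2 \<and> h \<in> L2 \<and> (\<forall>(f, Tf) \<in> T. L2_inner Tf g = L2_inner f h)}"


section \<open>The first-order boundary value problem\<close>

text \<open>
  \<open>W12_deriv y g\<close>: the function \<open>y\<close> is absolutely continuous on [0,1] with square-integrable
  derivative \<open>g\<close>, i.e. it is the continuous representative of an element of the Sobolev space
  of order 1 and exponent 2; hence the boundary values \<open>y 0\<close> and \<open>y 1\<close> are the traces.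
\<close>

definition W12_deriv :: "'n::finite vfun \<Rightarrow> 'n vfun \<Rightarrow> bool" where
  "W12_deriv y g \<longleftrightarrow> g \<in> L2 \<and> (\<forall>x\<in>{0..1}. y x = y 0 + (LINT t:{0..x}|lebesgue. g t))"

definition L_op :: "complex^'n^'n::finite \<Rightarrow> complex^'n^'n \<Rightarrow> complex^'n^'n \<Rightarrow> 'n operator" where
  "L_op B C D =
     {(f, h). f \<in> L2 \<and> h \<in> L2 \<and>
        (\<exists>y y'. W12_deriv y y' \<and> C *v y 0 + D *v y 1 = 0 \<and>
                ae_eq f y \<and> ae_eq h (\<lambda>x. (- \<i>) *s (B *v y' x)))}"


section \<open>Weakly regular boundary conditions\<close>

definition diag2 :: "complex \<Rightarrow> complex \<Rightarrow> complex^2^2" where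
  "diag2 p q = vector [vector [p, 0], vector [0, q]]"

definition left_block :: "complex^4^2 \<Rightarrow> complex^2^2" where
  "left_block a = vector [vector [a$1$1, a$1$2], vector [a$2$1, a$2$2]]"

definition right_block :: "complex^4^2 \<Rightarrow> complex^2^2" where
  "right_block a = vector [vector [a$1$3, a$1$4], vector [a$2$3, a$2$4]]"

text \<open>Only used for diagonal \<open>A\<close> whose diagonal entries have nonzero real part.\<close>

definition T_mat :: "complex^2^2 \<Rightarrow> complex^2^2 \<Rightarrow> complex^2^2 \<Rightarrow> complex^2^2" where
  "T_mat A C D = (\<chi> i k. if Re (A$k$k) > 0 then C$i$k else D$i$k)"

text \<open>Note that a degenerate triangle has empty interior.\<close>

definition weakly_regular :: "complex^2^2 \<Rightarrow> complex^2^2 \<Rightarrow> complex^2^2 \<Rightarrow> bool" where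
  "weakly_regular B C D \<longleftrightarrow>
     (\<exists>z1 z2 z3. 0 \<in> interior (convex hull {z1, z2, z3}) \<and>
        (\<forall>z\<in>{z1, z2, z3}.
            invertible (map_matrix (\<lambda>b. Re (z * b)) B) \<and>
            det (T_mat (map_matrix (\<lambda>b. z * b) B) C D) \<noteq> 0))"

end

theory Submission
  imports Defs "HOL-Complex_Analysis.Complex_Analysis" "HOL-Real_Asymp.Real_Asymp"
begin

text \<open>
  Write \<open>J\<^sub>k\<^sub>l\<close> for the minor of the coefficient matrix on the columns \<open>k, l\<close>. Since \<open>b1 / b2\<close> is
  not real, \<open>z \<mapsto> (Re (z / b1), Re (z / b2))\<close> is a real-linear isomorphism onto the plane, whose four
  open quadrants belong to the minors \<open>J\<^sub>1\<^sub>2, J\<^sub>1\<^sub>4, J\<^sub>3\<^sub>2, J\<^sub>3\<^sub>4\<close>. Hence weak regularity means that the minors of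
  two opposite quadrants are nonzero, a condition that is inherited by the adjoint boundary
  conditions.

  If it holds, a functional that vanishes on all root functions yields entire functions \<open>F\<close>
  divisible by the characteristic determinant \<open>\<Delta>\<close>. The quotient \<open>F / \<Delta>\<close> has exponential type and is bounded
  on three rays that span the plane, so it is constant by the Phragmen-Lindelof principle and Liouville's
  theorem; it tends to 0 along a ray. Thus \<open>F = 0\<close>, and the functional vanishes on all
  \<open>exp (b\<^sub>k w x) e\<^sub>k\<close>, hence on all polynomials.

  If it fails, the nonzero minors belong to two adjacent quadrants. Then either the boundary conditions
  force one boundary value to vanish, or one boundary value does not occur in them and the corresponding
  boundary value at the same endpoint vanishes for the adjoint operator. So all root functions of one of the
  two operators have a component that solves a homogeneous first-order initial value problem and is therefore zero.
\<close>

text \<open>The growth of the quotient has order 1, for which the Phragmen-Lindelof principle needs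
  sectors of opening less than pi. Two opposite rays only leave half planes; hence a second ray in
  one of the two quadrants, such that a positive combination of the three directions vanishes. The
  obstacle is the exponential type of the quotient near the zeros of the determinant. Around every
  point there is a circle of radius at most 1/2 on which an exponential sum is at least
  exponentially small, because one of its first Taylor coefficients at the point is not too small;
  the maximum principle carries the bound for the quotient to the centre. The limit 0 along a ray
  comes from the solutions: divided by the dominating exponential they tend to 0 at every inner
  point of the interval, while the determinant tends to a nonzero minor. The domain of the adjoint
  is never computed. For completeness it suffices that the adjoint contains a boundary value
  operator, since enlarging an operator only adds root functions; for incompleteness a single
  component of the adjoint relation is tested.\<close>

no_notation fps_nth (infixl "$" 75)

section \<open>Square-integrable vector functions\<close>

lemma finite_measure_unit_lebesgue: "finite_measure unit_lebesgue"
  by (rule finite_measure_lebesgue_on) simp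

lemma measure_unit_lebesgue_UNIV: "measure unit_lebesgue {0..1} = 1"
  by (simp add: measure_restrict_space)

lemma measurable_vec_nth:
  fixes f :: "'a \<Rightarrow> complex ^ 'n::finite"
  assumes "f \<in> borel_measurable M"
  shows "(\<lambda>x. f x $ j) \<in> borel_measurable M"
  by (rule borel_measurable_continuous_on[OF _ assms, of "\<lambda>v. v $ j"]) (intro continuous_intros)

lemma L2_measurable: "f \<in> L2 \<Longrightarrow> f \<in> borel_measurable unit_lebesgue"
  by (simp add: L2_def)

lemma L2_integrable: "f \<in> L2 \<Longrightarrow> integrable unit_lebesgue (\<lambda>x. (norm (f x))\<^sup>2)"
  by (simp add: L2_def)

lemma L2_I_bound:
  assumes "f \<in> borel_measurable unit_lebesgue" "integrable unit_lebesgue g"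
    and "\<And>x. x \<in> {0..1} \<Longrightarrow> (norm (f x))\<^sup>2 \<le> g x"
  shows "f \<in> L2"
proof -
  have "integrable unit_lebesgue (\<lambda>x. (norm (f x))\<^sup>2)"
    by (rule Bochner_Integration.integrable_bound[OF assms(2)])
      (use assms in \<open>auto intro!: AE_I2 order_trans[OF assms(3)]\<close>)
  then show ?thesis using assms by (simp add: L2_def)
qed

lemma integrable_const_unit: "integrable unit_lebesgue (\<lambda>x. c :: 'b::{banach, second_countable_topology})"
  using finite_measure.integrable_const[OF finite_measure_unit_lebesgue] .

lemma L2_bounded:
  assumes "f \<in> borel_measurable unit_lebesgue" "\<And>x. x \<in> {0..1} \<Longrightarrow> norm (f x) \<le> B"
  shows "f \<in> L2"
  by (rule L2_I_bound[OF assms(1) integrable_const_unit[of "B\<^sup>2"]]) (use assms in \<open>auto intro: power_mono\<close>)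

lemma L2_continuous: "continuous_on {0..1} f \<Longrightarrow> f \<in> L2"
  by (metis L2_bounded bounded_iff compact_Icc compact_continuous_image compact_imp_bounded
      continuous_imp_measurable_on_sets_lebesgue image_eqI lmeasurable_cbox fmeasurableD cbox_interval)

lemma L2_add: "f \<in> L2 \<Longrightarrow> g \<in> L2 \<Longrightarrow> (\<lambda>x. f x + g x) \<in> L2"
proof (rule L2_I_bound)
  assume fg: "f \<in> L2" "g \<in> L2"
  then show "(\<lambda>x. f x + g x) \<in> borel_measurable unit_lebesgue"
    by (intro borel_measurable_add L2_measurable)
  show "integrable unit_lebesgue (\<lambda>x. 2 * (norm (f x))\<^sup>2 + 2 * (norm (g x))\<^sup>2)"
    using fg by (intro Bochner_Integration.integrable_add integrable_mult_right L2_integrable)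
  fix x
  have "(norm (f x + g x))\<^sup>2 \<le> (norm (f x) + norm (g x))\<^sup>2" by (intro power_mono norm_triangle_ineq) auto
  also have "\<dots> \<le> 2 * (norm (f x))\<^sup>2 + 2 * (norm (g x))\<^sup>2"
    using sum_squares_bound[of "norm (f x)" "norm (g x)"] by (simp add: power2_sum)
  finally show "(norm (f x + g x))\<^sup>2 \<le> 2 * (norm (f x))\<^sup>2 + 2 * (norm (g x))\<^sup>2" .
qed

lemma norm_smult_vec: "norm (c *s (v :: complex ^ 'n::finite)) = norm c * norm v"
  by (simp add: norm_vec_def norm_mult L2_set_right_distrib)

lemma L2_bounded_linear:
  fixes F :: "complex ^ 'n::finite \<Rightarrow> complex ^ 'm::finite"
  assumes "bounded_linear F" "f \<in> L2"
  shows "(\<lambda>x. F (f x)) \<in> L2"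
proof -
  obtain K where K: "K \<ge> 0" "\<And>v. norm (F v) \<le> norm v * K" using bounded_linear.nonneg_bounded[OF assms(1)] by blast
  show ?thesis
  proof (rule L2_I_bound)
    show "(\<lambda>x. F (f x)) \<in> borel_measurable unit_lebesgue"
      using linear_continuous_on[OF assms(1)] L2_measurable[OF assms(2)] by (rule borel_measurable_continuous_on)
    show "integrable unit_lebesgue (\<lambda>x. (norm (f x))\<^sup>2 * K\<^sup>2)" by (intro integrable_mult_left L2_integrable assms(2))
    show "(norm (F (f x)))\<^sup>2 \<le> (norm (f x))\<^sup>2 * K\<^sup>2" for x
      unfolding power_mult_distrib[symmetric] by (rule power_mono[OF K(2)]) simp
  qed
qed

lemma L2_scale: "f \<in> L2 \<Longrightarrow> (\<lambda>x. c *s f x) \<in> L2" for f :: "'n::finite vfun"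
  by (rule L2_bounded_linear[OF bounded_linear_intro[where K = "norm c"]])
    (simp_all add: vec_eq_iff algebra_simps norm_smult_vec)

lemma L2_diff: "f \<in> L2 \<Longrightarrow> g \<in> L2 \<Longrightarrow> (\<lambda>x. f x - g x) \<in> L2"
  using L2_add[of f "\<lambda>x. (-1) *s g x"] L2_scale[of g "-1"]
  by (simp add: vector_sneg_minus1[symmetric])

lemma L2_sum: "(\<And>i. i \<in> I \<Longrightarrow> f i \<in> L2) \<Longrightarrow> (\<lambda>x. \<Sum>i\<in>I. f i x) \<in> L2"
  by (induction I rule: infinite_finite_induct) (auto intro: L2_add L2_continuous)

lemma measurable_cnj: "f \<in> borel_measurable M \<Longrightarrow> (\<lambda>x. cnj (f x)) \<in> borel_measurable M"
  by (rule borel_measurable_continuous_on[of cnj]) (intro continuous_intros)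

lemma L2_inner_integrable:
  assumes "f \<in> L2" "g \<in> L2"
  shows "integrable unit_lebesgue (\<lambda>x. f x $ j * cnj (g x $ j))"
proof (rule Bochner_Integration.integrable_bound)
  show "integrable unit_lebesgue (\<lambda>x. (norm (f x))\<^sup>2 + (norm (g x))\<^sup>2)"
    using assms by (intro Bochner_Integration.integrable_add L2_integrable)
  show "(\<lambda>x. f x $ j * cnj (g x $ j)) \<in> borel_measurable unit_lebesgue"
    using assms by (intro borel_measurable_times measurable_cnj measurable_vec_nth L2_measurable)
  have "norm (f x $ j * cnj (g x $ j)) \<le> (norm (f x))\<^sup>2 + (norm (g x))\<^sup>2" for x
  proof -
    have "norm (f x $ j) * norm (g x $ j) \<le> norm (f x) * norm (g x)"
      by (intro mult_mono Finite_Cartesian_Product.norm_nth_le) auto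
    also have "\<dots> \<le> (norm (f x))\<^sup>2 + (norm (g x))\<^sup>2"
      using sum_squares_bound[of "norm (f x)" "norm (g x)"] mult_nonneg_nonneg[OF norm_ge_zero norm_ge_zero, of "f x" "g x"]
      by linarith
    finally show ?thesis by (simp add: norm_mult)
  qed
  then show "AE x in unit_lebesgue. norm (f x $ j * cnj (g x $ j)) \<le> norm ((norm (f x))\<^sup>2 + (norm (g x))\<^sup>2)"
    by (auto intro: order_trans)
qed

lemma L2_inner_sum: "f \<in> L2 \<Longrightarrow> g \<in> L2 \<Longrightarrow>
    L2_inner f g = (\<Sum>j\<in>UNIV. LINT x|unit_lebesgue. f x $ j * cnj (g x $ j))"
  unfolding L2_inner_def by (rule Bochner_Integration.integral_sum) (rule L2_inner_integrable)

lemma L2_inner_add_left: "f \<in> L2 \<Longrightarrow> h \<in> L2 \<Longrightarrow> g \<in> L2 \<Longrightarrow>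
    L2_inner (\<lambda>x. f x + h x) g = L2_inner f g + L2_inner h g"
  by (simp add: L2_inner_sum L2_add L2_inner_integrable distrib_right sum.distrib)

lemma L2_inner_scale_left: "f \<in> L2 \<Longrightarrow> g \<in> L2 \<Longrightarrow> L2_inner (\<lambda>x. c *s f x) g = c * L2_inner f g"
  by (simp add: L2_inner_sum L2_scale mult.assoc sum_distrib_left)

lemma L2_inner_commute: "L2_inner g f = cnj (L2_inner f g)"
  unfolding L2_inner_def by (subst Bochner_Integration.integral_cnj[symmetric]) (simp add: mult.commute)

lemma L2_inner_diff_left: "f \<in> L2 \<Longrightarrow> h \<in> L2 \<Longrightarrow> g \<in> L2 \<Longrightarrow>
    L2_inner (\<lambda>x. f x - h x) g = L2_inner f g - L2_inner h g"
  using L2_inner_add_left[of f "\<lambda>x. (-1) *s h x" g] L2_inner_scale_left[of h g "-1"] L2_scale[of h "-1"]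
  by (simp add: vector_sneg_minus1[symmetric])

lemma L2_inner_diff_right: "f \<in> L2 \<Longrightarrow> h \<in> L2 \<Longrightarrow> g \<in> L2 \<Longrightarrow>
    L2_inner g (\<lambda>x. f x - h x) = L2_inner g f - L2_inner g h"
  by (subst (1 2 3) L2_inner_commute) (simp add: L2_inner_diff_left)

lemma L2_inner_scale_right: "f \<in> L2 \<Longrightarrow> g \<in> L2 \<Longrightarrow> L2_inner g (\<lambda>x. c *s f x) = cnj c * L2_inner g f"
  by (subst (1 2) L2_inner_commute) (simp add: L2_inner_scale_left)

lemma L2_norm_nonneg: "L2_norm f \<ge> 0"
  by (simp add: L2_norm_def integral_nonneg_AE)

lemma L2_norm_power2: "(L2_norm f)\<^sup>2 = (LINT x|unit_lebesgue. (norm (f x))\<^sup>2)"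
  by (simp add: L2_norm_def integral_nonneg_AE)

lemma L2_inner_self: "L2_inner f f = of_real ((L2_norm f)\<^sup>2)"
proof -
  have "(\<Sum>j\<in>UNIV. f x $ j * cnj (f x $ j)) = of_real ((norm (f x))\<^sup>2)" for x
    by (simp add: norm_vec_def L2_set_def sum_nonneg flip: complex_norm_square)
  then show ?thesis unfolding L2_inner_def L2_norm_power2 by (simp only: integral_complex_of_real)
qed

lemma L2_norm_diff_power2:
  assumes "f \<in> L2" "g \<in> L2"
  shows "(L2_norm (\<lambda>x. f x - t *s g x))\<^sup>2 =
    (L2_norm f)\<^sup>2 - 2 * Re (cnj t * L2_inner f g) + (norm t)\<^sup>2 * (L2_norm g)\<^sup>2"
proof -
  have "complex_of_real ((L2_norm (\<lambda>x. f x - t *s g x))\<^sup>2) =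
      L2_inner f f - cnj t * L2_inner f g - (t * L2_inner g f - t * cnj t * L2_inner g g)"
    using assms by (subst L2_inner_self[symmetric]) (simp add: L2_inner_diff_left L2_inner_diff_right
        L2_inner_scale_left L2_inner_scale_right L2_diff L2_scale algebra_simps)
  also have "t * L2_inner g f = cnj (cnj t * L2_inner f g)" using L2_inner_commute[of g f] by simp
  finally have "Re (complex_of_real ((L2_norm (\<lambda>x. f x - t *s g x))\<^sup>2)) =
      Re (L2_inner f f - cnj t * L2_inner f g - (cnj (cnj t * L2_inner f g) - t * cnj t * L2_inner g g))" by simp
  then show ?thesis
    by (simp add: L2_inner_self flip: complex_norm_square)
qed

text \<open>The choice \<open>t = z / b\<close> minimizes the right-hand side of \<open>le\<close>;
  for \<open>b = 0\<close> that side is affine in \<open>t\<close> and bounded below only if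
  \<open>z = 0\<close>. With \<open>d = 0\<close> this yields the Cauchy-Schwarz inequality; with
  \<open>d\<close> a squared distance it measures how far a minimizing sequence is from being
  orthogonal to a subspace.\<close>

lemma quadratic_form_bound:
  fixes z :: complex
  assumes "b \<ge> 0" and le: "\<And>t. d \<le> a - 2 * Re (cnj t * z) + (norm t)\<^sup>2 * b"
  shows "(norm z)\<^sup>2 \<le> (a - d) * b"
proof -
  have zz: "cnj z * z = (of_real (norm z))\<^sup>2"
    using complex_norm_square[of z] by (simp only: mult.commute of_real_power)
  show ?thesis
  proof (cases "b = 0")
    case False
    have 1: "cnj (z / of_real b) * z = of_real ((norm z)\<^sup>2 / b)"
      using zz by simp
    have "d \<le> a - 2 * ((norm z)\<^sup>2 / b) + (norm z)\<^sup>2 / b\<^sup>2 * b"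
      using le[of "z / of_real b"] \<open>b \<ge> 0\<close> unfolding 1 by (simp add: norm_divide power_divide)
    also have "\<dots> = a - (norm z)\<^sup>2 / b" using False by (simp add: power2_eq_square field_simps)
    finally show ?thesis using False \<open>b \<ge> 0\<close> by (simp add: field_simps)
  next
    case True
    have "z = 0"
    proof (rule ccontr)
      assume z: "z \<noteq> 0"
      \<comment> \<open>With this \<open>s\<close>, the hypothesis at \<open>t = s * z\<close> reads
        \<open>d \<le> d - 1\<close>.\<close>
      define s where "s = (a - d + 1) / (2 * (norm z)\<^sup>2)"
      have "cnj (of_real s * z) * z = of_real (s * (norm z)\<^sup>2)"
        using zz by simp
      then have "d \<le> a - 2 * Re (of_real (s * (norm z)\<^sup>2))" using le[of "of_real s * z"] True by (metis mult_zero_right add_0_right)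
      moreover have "s * (norm z)\<^sup>2 = (a - d + 1) / 2" using z by (simp add: s_def)
      ultimately show False unfolding Re_complex_of_real by (simp add: field_simps)
    qed
    then show ?thesis using True by simp
  qed
qed

lemma L2_Cauchy_Schwarz:
  assumes "f \<in> L2" "g \<in> L2"
  shows "norm (L2_inner f g) \<le> L2_norm f * L2_norm g"
proof -
  have "(norm (L2_inner f g))\<^sup>2 \<le> ((L2_norm f)\<^sup>2 - 0) * (L2_norm g)\<^sup>2"
    by (rule quadratic_form_bound) (simp, metis L2_norm_diff_power2[OF assms] zero_le_power2)
  then have "(norm (L2_inner f g))\<^sup>2 \<le> (L2_norm f * L2_norm g)\<^sup>2" by (simp add: power_mult_distrib)
  then show ?thesis by (rule power2_le_imp_le) (simp add: L2_norm_nonneg)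
qed

text \<open>Only the values on \<open>L2\<close> are constrained. The bound by
  \<open>L2_norm\<close> makes \<open>l\<close> respect equality almost everywhere, although
  \<open>l\<close> acts on representatives.\<close>

definition L2_functional :: "('n::finite vfun \<Rightarrow> complex) \<Rightarrow> bool" where
  "L2_functional l \<longleftrightarrow>
     (\<forall>f\<in>L2. \<forall>g\<in>L2. l (\<lambda>x. f x + g x) = l f + l g) \<and>
     (\<forall>f\<in>L2. \<forall>c. l (\<lambda>x. c *s f x) = c * l f) \<and>
     (\<exists>K\<ge>0. \<forall>f\<in>L2. norm (l f) \<le> K * L2_norm f)"

text \<open>The functional is the limit of the inner products with \<open>h - u n\<close>, where \<open>u n\<close> is a minimizing
  sequence for the distance of \<open>h\<close> to \<open>V\<close>; this makes the completeness of the space dispensable.\<close>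

lemma separating_functional:
  assumes V: "V \<subseteq> L2" "V \<noteq> {}" and add: "\<And>u v. u \<in> V \<Longrightarrow> v \<in> V \<Longrightarrow> (\<lambda>x. u x + v x) \<in> V"
    and scale: "\<And>c u. u \<in> V \<Longrightarrow> (\<lambda>x. c *s u x) \<in> V"
    and h: "h \<in> L2" "h \<notin> L2_closure V"
  shows "\<exists>l. L2_functional l \<and> (\<forall>u\<in>V. l u = 0) \<and> l h \<noteq> 0"
proof -
  obtain \<epsilon> where \<epsilon>: "\<epsilon> > 0" "\<And>u. u \<in> V \<Longrightarrow> \<epsilon> \<le> L2_norm (\<lambda>x. h x - u x)"
    using h by (auto simp: L2_closure_def not_less)
  define D where "D = (\<lambda>u. (L2_norm (\<lambda>x. h x - u x))\<^sup>2) ` V"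
  define d where "d = Inf D"
  have D: "D \<noteq> {}" "bdd_below D" using V by (auto simp: D_def intro!: bdd_belowI[of _ 0])
  have "d \<ge> \<epsilon>\<^sup>2" unfolding d_def
    by (rule cInf_greatest[OF D(1)]) (auto simp: D_def intro!: power_mono \<epsilon> less_imp_le[OF \<epsilon>(1)])
  then have d0: "d > 0" using \<epsilon> by (smt (verit) zero_less_power2)
  have dle: "d \<le> (L2_norm (\<lambda>x. h x - u x))\<^sup>2" if "u \<in> V" for u
    unfolding d_def by (rule cInf_lower[OF _ D(2)]) (use that in \<open>auto simp: D_def\<close>)
  have "\<exists>u\<in>V. (L2_norm (\<lambda>x. h x - u x))\<^sup>2 < d + 1 / real (Suc n)" for n
    using cInf_lessD[OF D(1), of "d + 1 / real (Suc n)"] by (auto simp: D_def d_def)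
  then obtain u where u: "\<And>n. u n \<in> V" "\<And>n. (L2_norm (\<lambda>x. h x - u n x))\<^sup>2 < d + 1 / real (Suc n)"
    by metis
  define e where "e n = (\<lambda>x. h x - u n x)" for n
  define \<delta> where "\<delta> n = sqrt (1 / real (Suc n))" for n
  have \<delta>: "\<delta> \<longlonglongrightarrow> 0" and \<delta>1: "0 \<le> \<delta> n" "\<delta> n \<le> 1" for n
  proof -
    have "(\<lambda>n. sqrt (inverse (real (Suc n)))) \<longlonglongrightarrow> sqrt 0"
      by (intro tendsto_real_sqrt LIMSEQ_inverse_real_of_nat)
    then show "\<delta> \<longlonglongrightarrow> 0" by (simp add: \<delta>_def[abs_def] inverse_eq_divide)
  qed (auto simp: \<delta>_def)
  have eL2: "e n \<in> L2" for n unfolding e_def using h V u by (intro L2_diff) auto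
  \<comment> \<open>Near-orthogonality: \<open>u n + t *s v\<close> stays in \<open>V\<close>, so
    its distance to \<open>h\<close> is bounded below by \<open>d\<close> for all \<open>t\<close>,
    while \<open>e n\<close> exceeds this infimum by less than
    \<open>(\<delta> n)\<^sup>2\<close>.\<close>
  have small: "norm (L2_inner (e n) v) \<le> \<delta> n * L2_norm v" if v: "v \<in> V" for n v
  proof -
    have vL: "v \<in> L2" using v V by auto
    have "(norm (L2_inner (e n) v))\<^sup>2 \<le> ((L2_norm (e n))\<^sup>2 - d) * (L2_norm v)\<^sup>2"
    proof (rule quadratic_form_bound)
      fix t
      have "(\<lambda>x. e n x - t *s v x) = (\<lambda>x. h x - (u n x + t *s v x))" by (auto simp: e_def)
      then show "d \<le> (L2_norm (e n))\<^sup>2 - 2 * Re (cnj t * L2_inner (e n) v) + (norm t)\<^sup>2 * (L2_norm v)\<^sup>2"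
        using dle[OF add[OF u(1)[of n] scale[OF v, of t]]] L2_norm_diff_power2[OF eL2 vL, of n t] by simp
    qed simp
    also have "\<dots> \<le> (\<delta> n * L2_norm v)\<^sup>2"
      unfolding power_mult_distrib using u(2)[of n]
      by (intro mult_right_mono) (auto simp: \<delta>_def e_def)
    finally show ?thesis by (rule power2_le_imp_le) (simp add: \<delta>1 L2_norm_nonneg)
  qed
  have small': "norm (L2_inner v (e n)) \<le> \<delta> n * L2_norm v" if v: "v \<in> V" for n v
    using small[OF v, of n] by (subst L2_inner_commute) simp
  have ediff: "(\<lambda>x. e n x - e m x) \<in> V" for n m
    using add[OF u(1)[of m] scale[OF u(1)[of n], of "-1"]] by (simp add: e_def algebra_simps)
  \<comment> \<open>The difference itself lies in \<open>V\<close>, so near-orthogonality can be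
    tested against it; this makes the inner products with \<open>e n\<close> a Cauchy
    sequence.\<close>
  have edist: "L2_norm (\<lambda>x. e n x - e m x) \<le> \<delta> n + \<delta> m" for n m
  proof -
    let ?v = "\<lambda>x. e n x - e m x"
    have "complex_of_real ((L2_norm ?v)\<^sup>2) = L2_inner (e n) ?v - L2_inner (e m) ?v"
      by (subst L2_inner_self[symmetric], subst L2_inner_diff_left) (auto simp: eL2 L2_diff)
    then have "norm (complex_of_real ((L2_norm ?v)\<^sup>2)) \<le> norm (L2_inner (e n) ?v) + norm (L2_inner (e m) ?v)"
      using norm_triangle_ineq4 by simp
    then have "(L2_norm ?v)\<^sup>2 \<le> norm (L2_inner (e n) ?v) + norm (L2_inner (e m) ?v)"
      unfolding norm_of_real abs_power2 .
    also have "\<dots> \<le> (\<delta> n + \<delta> m) * L2_norm ?v"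
      using small[OF ediff, of n n m] small[OF ediff, of m n m] by (simp add: distrib_right)
    finally show ?thesis
      using L2_norm_nonneg[of ?v] \<delta>1[of n] \<delta>1[of m]
      by (cases "L2_norm ?v = 0") (auto simp: power2_eq_square)
  qed
  have conv: "convergent (\<lambda>n. L2_inner f (e n))" if f: "f \<in> L2" for f
  proof (rule Cauchy_convergent, rule CauchyI)
    fix r :: real assume r: "r > 0"
    have "(\<lambda>n. L2_norm f * \<delta> n) \<longlonglongrightarrow> L2_norm f * 0" by (intro tendsto_intros \<delta>)
    then have "\<forall>\<^sub>F n in sequentially. L2_norm f * \<delta> n < r / 2" using r by (intro order_tendstoD) auto
    then obtain N where N: "\<And>n. n \<ge> N \<Longrightarrow> L2_norm f * \<delta> n < r / 2" by (auto simp: eventually_sequentially)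
    show "\<exists>M. \<forall>m\<ge>M. \<forall>n\<ge>M. norm (L2_inner f (e m) - L2_inner f (e n)) < r"
    proof (intro exI allI impI)
      fix m n assume mn: "m \<ge> N" "n \<ge> N"
      have "norm (L2_inner f (e m) - L2_inner f (e n)) = norm (L2_inner f (\<lambda>x. e m x - e n x))"
        by (simp add: L2_inner_diff_right eL2 f)
      also have "\<dots> \<le> L2_norm f * (\<delta> m + \<delta> n)"
        by (rule order_trans[OF L2_Cauchy_Schwarz])
          (auto simp: f eL2 L2_diff L2_norm_nonneg intro!: mult_left_mono edist)
      also have "\<dots> < r" using N[OF mn(1)] N[OF mn(2)] by (simp add: distrib_left)
      finally show "norm (L2_inner f (e m) - L2_inner f (e n)) < r" .
    qed
  qed
  define l where "l f = lim (\<lambda>n. L2_inner f (e n))" for f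
  have l: "(\<lambda>n. L2_inner f (e n)) \<longlonglongrightarrow> l f" if "f \<in> L2" for f
    using conv[OF that] by (simp add: l_def convergent_LIMSEQ_iff)
  have en: "L2_norm (e n) \<le> sqrt (d + 1)" for n
  proof -
    have "1 / real (Suc n) \<le> 1" by simp
    then have "(L2_norm (e n))\<^sup>2 \<le> d + 1" using u(2)[of n] unfolding e_def by linarith
    then show ?thesis by (rule real_le_rsqrt)
  qed
  have func: "L2_functional l"
    unfolding L2_functional_def
  proof (intro conjI ballI allI)
    fix f g :: "'a vfun" assume fg: "f \<in> L2" "g \<in> L2"
    have "(\<lambda>n. L2_inner (\<lambda>x. f x + g x) (e n)) \<longlonglongrightarrow> l f + l g"
      using tendsto_add[OF l[OF fg(1)] l[OF fg(2)]] by (simp add: L2_inner_add_left fg eL2)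
    then show "l (\<lambda>x. f x + g x) = l f + l g" using l[OF L2_add[OF fg]] LIMSEQ_unique by blast
  next
    fix f :: "'a vfun" and c assume f: "f \<in> L2"
    have "(\<lambda>n. L2_inner (\<lambda>x. c *s f x) (e n)) \<longlonglongrightarrow> c * l f"
      using tendsto_mult_left[OF l[OF f], of c] by (simp add: L2_inner_scale_left f eL2)
    then show "l (\<lambda>x. c *s f x) = c * l f" using l[OF L2_scale[OF f]] LIMSEQ_unique by blast
  next
    have "norm (l f) \<le> sqrt (d + 1) * L2_norm f" if f: "f \<in> L2" for f
    proof (rule Lim_norm_ubound[OF _ l[OF f]])
      have "norm (L2_inner f (e n)) \<le> sqrt (d + 1) * L2_norm f" for n
        using L2_Cauchy_Schwarz[OF f eL2[of n]] mult_left_mono[OF en[of n] L2_norm_nonneg[of f]]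
        by (simp add: mult.commute)
      then show "\<forall>\<^sub>F n in sequentially. norm (L2_inner f (e n)) \<le> sqrt (d + 1) * L2_norm f" by simp
    qed simp
    moreover have "sqrt (d + 1) \<ge> 0" using d0 by simp
    ultimately show "\<exists>K\<ge>0. \<forall>f\<in>L2. norm (l f) \<le> K * L2_norm f" by metis
  qed
  have lV: "l v = 0" if v: "v \<in> V" for v
  proof -
    have "(\<lambda>n. L2_inner v (e n)) \<longlonglongrightarrow> 0"
    proof (rule Lim_null_comparison)
      show "\<forall>\<^sub>F n in sequentially. norm (L2_inner v (e n)) \<le> \<delta> n * L2_norm v" using small'[OF v] by simp
      show "(\<lambda>n. \<delta> n * L2_norm v) \<longlonglongrightarrow> 0" using tendsto_mult_right[OF \<delta>, of "L2_norm v"] by simp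
    qed
    then show ?thesis using l[of v] v V LIMSEQ_unique by blast
  qed
  have lh: "l h \<noteq> 0"
  proof -
    have "l (e 0) = l h"
    proof -
      have "l (\<lambda>x. e 0 x + u 0 x) = l (e 0) + l (u 0)"
        using func eL2 u(1) V unfolding L2_functional_def by blast
      then show ?thesis using lV[OF u(1)[of 0]] by (simp add: e_def)
    qed
    \<comment> \<open>\<open>e 0\<close> and \<open>e n\<close> differ by an element of
      \<open>V\<close> of norm at most 2, which is nearly orthogonal to \<open>e n\<close>. So the
      inner product is close to the squared norm of \<open>e n\<close>, and the limit
      \<open>l (e 0) = l h\<close> has real part at least \<open>d\<close>.\<close>
    have "d - 2 * \<delta> n \<le> Re (L2_inner (e 0) (e n))" for n
    proof -
      let ?v = "\<lambda>x. e 0 x - e n x"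
      have "L2_inner ?v (e n) = L2_inner (e 0) (e n) - of_real ((L2_norm (e n))\<^sup>2)"
        by (simp add: L2_inner_diff_left eL2 L2_inner_self)
      then have "Re (L2_inner (e 0) (e n)) = (L2_norm (e n))\<^sup>2 + Re (L2_inner ?v (e n))" by simp
      moreover have "\<bar>Re (L2_inner ?v (e n))\<bar> \<le> \<delta> n * L2_norm ?v"
        using small'[OF ediff] abs_Re_le_cmod order_trans by blast
      moreover have "\<delta> n * L2_norm ?v \<le> \<delta> n * 2"
        using edist[of 0 n] \<delta>1[of n] \<delta>1[of 0] by (intro mult_left_mono) auto
      moreover have "d \<le> (L2_norm (e n))\<^sup>2" unfolding e_def by (rule dle[OF u(1)])
      ultimately show ?thesis by linarith
    qed
    moreover have "(\<lambda>n. d - 2 * \<delta> n) \<longlonglongrightarrow> d - 2 * 0" by (intro tendsto_intros \<delta>)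
    moreover have "(\<lambda>n. Re (L2_inner (e 0) (e n))) \<longlonglongrightarrow> Re (l (e 0))"
      by (rule tendsto_Re[OF l[OF eL2]])
    ultimately have "d - 2 * 0 \<le> Re (l (e 0))" by (intro LIMSEQ_le) auto
    then show ?thesis using d0 \<open>l (e 0) = l h\<close> by auto
  qed
  show ?thesis by (rule exI[of _ l], rule conjI[OF func], rule conjI[OF ballI[OF lV] lh])
qed

section \<open>Bounded functionals and the density of polynomials\<close>

lemma L2_functional_add: "L2_functional l \<Longrightarrow> f \<in> L2 \<Longrightarrow> g \<in> L2 \<Longrightarrow> l (\<lambda>x. f x + g x) = l f + l g"
  by (simp add: L2_functional_def)

lemma L2_functional_scale: "L2_functional l \<Longrightarrow> f \<in> L2 \<Longrightarrow> l (\<lambda>x. c *s f x) = c * l f"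
  by (simp add: L2_functional_def)

lemma L2_functional_diff: "L2_functional l \<Longrightarrow> f \<in> L2 \<Longrightarrow> g \<in> L2 \<Longrightarrow> l (\<lambda>x. f x - g x) = l f - l g"
  using L2_functional_add[of l f "\<lambda>x. (-1) *s g x"] L2_functional_scale[of l g "-1"] L2_scale[of g "-1"]
  by (simp add: vector_sneg_minus1[symmetric])

lemma L2_functional_zero: "L2_functional l \<Longrightarrow> l (\<lambda>x. 0) = 0"
  using L2_functional_scale[of l "\<lambda>x. 0" 0] L2_continuous[of "\<lambda>x. 0"] by simp

lemma L2_functional_sum:
  assumes "L2_functional l" "finite I" "\<And>i. i \<in> I \<Longrightarrow> f i \<in> L2"
  shows "l (\<lambda>x. \<Sum>i\<in>I. f i x) = (\<Sum>i\<in>I. l (f i))"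
  using assms(2,3)
proof (induction I rule: finite_induct)
  case (insert x F)
  have "l (\<lambda>y. f x y + (\<Sum>i\<in>F. f i y)) = l (f x) + l (\<lambda>y. \<Sum>i\<in>F. f i y)"
    by (intro L2_functional_add[OF assms(1)] L2_sum insert.prems) auto
  then show ?case using insert by simp
qed (simp add: L2_functional_zero[OF assms(1)])

lemma L2_norm_tendsto_0:
  assumes f: "f \<in> L2" "\<And>n. g n \<in> L2" and w: "integrable unit_lebesgue w"
    and lim: "AE x in unit_lebesgue. (\<lambda>n. g n x) \<longlonglongrightarrow> f x"
    and le: "\<And>n x. x \<in> {0..1} \<Longrightarrow> (norm (f x - g n x))\<^sup>2 \<le> w x"
  shows "(\<lambda>n. L2_norm (\<lambda>x. f x - g n x)) \<longlonglongrightarrow> 0"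
proof -
  have "(\<lambda>n. LINT x|unit_lebesgue. (norm (f x - g n x))\<^sup>2) \<longlonglongrightarrow> (LINT x|unit_lebesgue. (0::real))"
  proof (rule integral_dominated_convergence[where w = w])
    show "AE x in unit_lebesgue. (\<lambda>n. (norm (f x - g n x))\<^sup>2) \<longlonglongrightarrow> 0"
      using lim
    proof eventually_elim
      case (elim x)
      have "(\<lambda>n. (norm (f x - g n x))\<^sup>2) \<longlonglongrightarrow> (norm (f x - f x))\<^sup>2" by (intro tendsto_intros elim)
      then show ?case by simp
    qed
    show "(\<lambda>x. (norm (f x - g n x))\<^sup>2) \<in> borel_measurable unit_lebesgue" for n
      using L2_measurable[OF L2_diff[OF f(1) f(2)[of n]]] by measurable
  qed (use w le in auto)
  then have "(\<lambda>n. sqrt (LINT x|unit_lebesgue. (norm (f x - g n x))\<^sup>2)) \<longlonglongrightarrow> sqrt 0"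
    by (intro tendsto_real_sqrt) simp
  then show ?thesis by (simp add: L2_norm_def)
qed

lemma L2_functional_limit_zero:
  assumes l: "L2_functional l" and f: "f \<in> L2" "\<And>n. g n \<in> L2" "\<And>n. l (g n) = 0"
    and lim: "(\<lambda>n. L2_norm (\<lambda>x. f x - g n x)) \<longlonglongrightarrow> 0"
  shows "l f = 0"
proof -
  obtain K where K: "\<forall>f\<in>L2. norm (l f) \<le> K * L2_norm f" using l unfolding L2_functional_def by blast
  have "norm (l f) \<le> K * L2_norm (\<lambda>x. f x - g n x)" for n
    using bspec[OF K L2_diff[OF f(1) f(2)[of n]]] L2_functional_diff[OF l f(1) f(2)[of n]] f(3) by simp
  moreover have "(\<lambda>n. K * L2_norm (\<lambda>x. f x - g n x)) \<longlonglongrightarrow> K * 0" by (intro tendsto_intros lim)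
  ultimately have "norm (l f) \<le> K * 0" by (intro LIMSEQ_le_const) auto
  then show ?thesis by simp
qed

lemma L2_norm_le_sup:
  assumes "f \<in> L2" "\<And>x. x \<in> {0..1} \<Longrightarrow> norm (f x) \<le> B" "B \<ge> 0"
  shows "L2_norm f \<le> B"
proof -
  have "(L2_norm f)\<^sup>2 \<le> (LINT x|unit_lebesgue. B\<^sup>2)"
    unfolding L2_norm_power2
    by (intro integral_mono L2_integrable assms integrable_const_unit) (auto intro!: power_mono assms)
  then show ?thesis using assms(3) measure_unit_lebesgue_UNIV by (intro power2_le_imp_le[of "L2_norm f" B]) auto
qed

lemma vec_axis_expansion: "(v :: complex ^ 'n::finite) = (\<Sum>k\<in>UNIV. v $ k *s axis k 1)"
  by (simp add: vec_eq_iff axis_def if_distrib cong: if_cong)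

text \<open>Density of the monomials in stages: polynomials by linearity, continuous functions by
  Stone-Weierstrass, bounded measurable functions as pointwise limits of continuous ones, and all of
  \<open>L2\<close> by truncating large values. Every passage to the limit is in the
  \<open>L2_norm\<close>, where \<open>l\<close> is continuous.\<close>

lemma L2_functional_eq_zeroI:
  fixes l :: "'n::finite vfun \<Rightarrow> complex"
  assumes l: "L2_functional l" and mono: "\<And>n k. l (\<lambda>x. of_real x ^ n *s axis k 1) = 0" and f: "f \<in> L2"
  shows "l f = 0"
proof -
  have axis_L2: "continuous_on {0..1} c \<Longrightarrow> (\<lambda>x. c x *s axis k 1) \<in> L2" for c k
    by (rule L2_continuous) (auto simp: vector_scalar_mult_def intro!: continuous_intros)
  have real_poly: "l (\<lambda>x. (c * of_real (q x)) *s axis k 1) = 0" if q: "real_polynomial_function q" for c q k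
  proof -
    obtain a n where q: "q = (\<lambda>x. \<Sum>i\<le>n. a i * x ^ i)" using q real_polynomial_function_iff_sum by metis
    have "(\<lambda>x. (c * of_real (q x)) *s axis k 1) = (\<lambda>x. \<Sum>i\<le>n. (c * of_real (a i)) *s (of_real x ^ i *s axis k 1 :: complex ^ 'n))"
      by (auto simp: q sum_distrib_left vec.scale_sum_left mult_ac)
    moreover have "l \<dots> = (\<Sum>i\<le>n. l (\<lambda>x. (c * of_real (a i)) *s (of_real x ^ i *s axis k 1)))"
      by (rule L2_functional_sum[OF l]) (auto intro!: L2_scale axis_L2 continuous_intros)
    moreover have "l (\<lambda>x. (c * of_real (a i)) *s (of_real x ^ i *s axis k 1)) = 0" for i
      by (subst L2_functional_scale[OF l]) (auto intro!: axis_L2 continuous_intros simp: mono)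
    ultimately show ?thesis by simp
  qed
  have poly: "l p = 0" if p: "polynomial_function p" for p
  proof -
    have re: "real_polynomial_function (\<lambda>x. Re (p x $ k))" and im: "real_polynomial_function (\<lambda>x. Im (p x $ k))" for k
    proof -
      have "bounded_linear (\<lambda>v :: complex ^ 'n. Re (v $ k))" "bounded_linear (\<lambda>v :: complex ^ 'n. Im (v $ k))"
        by (intro bounded_linear_compose[OF bounded_linear_Re] bounded_linear_compose[OF bounded_linear_Im] bounded_linear_vec_nth)+
      then show "real_polynomial_function (\<lambda>x. Re (p x $ k))" "real_polynomial_function (\<lambda>x. Im (p x $ k))"
        using p by (auto simp: polynomial_function_def comp_def)
    qed
    have cont: "continuous_on {0..1} (\<lambda>x. Re (p x $ k))" "continuous_on {0..1} (\<lambda>x. Im (p x $ k))" for k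
      using continuous_on_polymonial_function[OF p, of "{0..1}"] by (auto intro!: continuous_intros)
    let ?g = "\<lambda>k x. (1 * of_real (Re (p x $ k))) *s (axis k 1 :: complex ^ 'n)"
    let ?h = "\<lambda>k x. (\<i> * of_real (Im (p x $ k))) *s (axis k 1 :: complex ^ 'n)"
    have L: "?g k \<in> L2" "?h k \<in> L2" for k by (intro axis_L2 continuous_intros cont)+
    have "p = (\<lambda>x. \<Sum>k\<in>UNIV. ?g k x + ?h k x)"
    proof
      fix x
      have "1 * of_real (Re (p x $ k)) + \<i> * of_real (Im (p x $ k)) = p x $ k" for k
        using complex_eq[of "p x $ k"] by simp
      then have "?g k x + ?h k x = p x $ k *s axis k 1" for k
        by (metis vec.scale_left_distrib)
      then show "p x = (\<Sum>k\<in>UNIV. ?g k x + ?h k x)" using vec_axis_expansion[of "p x"] by simp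
    qed
    then have "l p = (\<Sum>k\<in>UNIV. l (\<lambda>x. ?g k x + ?h k x))"
      using L2_functional_sum[OF l finite, of UNIV "\<lambda>k x. ?g k x + ?h k x"] L2_add[OF L] by metis
    also have "\<dots> = (\<Sum>k\<in>UNIV. l (?g k) + l (?h k))" by (intro sum.cong refl L2_functional_add[OF l] L)
    also have "\<dots> = 0" using real_poly[OF re, of 1] real_poly[OF im, of \<i>] by simp
    finally show ?thesis .
  qed
  have cont: "l g = 0" if g: "continuous_on {0..1} g" for g
  proof -
    have "\<exists>p. polynomial_function p \<and> (\<forall>x\<in>{0..1}. norm (g x - p x) < 1 / real (Suc n))" for n
      by (rule Stone_Weierstrass_polynomial_function[OF compact_Icc g]) simp
    then obtain p where p: "\<And>n. polynomial_function (p n)" "\<And>n x. x \<in> {0..1} \<Longrightarrow> norm (g x - p n x) < 1 / real (Suc n)"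
      by metis
    have pL: "p n \<in> L2" for n by (intro L2_continuous continuous_on_polymonial_function p)
    have gL: "g \<in> L2" by (rule L2_continuous[OF g])
    show ?thesis
    proof (rule L2_functional_limit_zero[OF l gL pL poly[OF p(1)]])
      show "(\<lambda>n. L2_norm (\<lambda>x. g x - p n x)) \<longlonglongrightarrow> 0"
      proof (rule tendsto_sandwich[OF _ _ tendsto_const LIMSEQ_inverse_real_of_nat])
        have "L2_norm (\<lambda>x. g x - p n x) \<le> inverse (real (Suc n))" for n
          using p(2)[of _ n] by (intro L2_norm_le_sup L2_diff gL pL) (auto simp: inverse_eq_divide intro: less_imp_le)
        then show "\<forall>\<^sub>F n in sequentially. L2_norm (\<lambda>x. g x - p n x) \<le> inverse (real (Suc n))" by simp
      qed (simp add: L2_norm_nonneg)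
    qed
  qed
  have bdd: "l g = 0" if g: "g \<in> borel_measurable unit_lebesgue" and le: "\<And>x. norm (g x) \<le> B" and B: "B > 0" for g B
  proof -
    have "g measurable_on {0..1}" using g by (simp add: measurable_on_iff_borel_measurable)
    then obtain N s where N: "negligible N" and s: "\<And>n. continuous_on UNIV (s n)"
      "\<And>x. x \<notin> N \<Longrightarrow> (\<lambda>n. s n x) \<longlonglongrightarrow> (if x \<in> {0..1} then g x else 0)"
      unfolding measurable_on_def by blast
    \<comment> \<open>The approximants \<open>s n\<close> converge only pointwise and may be
      unbounded. The radial retraction onto the ball of radius \<open>B\<close> gives them a common
      bound for dominated convergence and fixes all values of \<open>g\<close>.\<close>
    define clamp where "clamp v = (B / max B (norm v)) *\<^sub>R v" for v :: "complex ^ 'n"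
    have clamp: "norm (clamp v) \<le> B" for v using B by (simp add: clamp_def field_simps max_def)
    have clamp_id: "clamp v = v" if "norm v \<le> B" for v using that B by (simp add: clamp_def max_def)
    have clamp_cont: "continuous_on UNIV clamp" unfolding clamp_def
      using B by (intro continuous_intros) (auto simp: max_def)
    have sL: "(\<lambda>x. clamp (s n x)) \<in> L2" "l (\<lambda>x. clamp (s n x)) = 0" for n
      using continuous_on_compose2[OF clamp_cont s(1)[of n]]
      by (auto intro!: L2_continuous cont intro: continuous_on_subset)
    have gL: "g \<in> L2" by (rule L2_bounded[OF g le])
    show ?thesis
    proof (rule L2_functional_limit_zero[OF l gL sL(1) sL(2)])
      show "(\<lambda>n. L2_norm (\<lambda>x. g x - clamp (s n x))) \<longlonglongrightarrow> 0"
      proof (rule L2_norm_tendsto_0[OF gL sL(1) integrable_const_unit[of "(2 * B)\<^sup>2"]])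
        have "AE x in lebesgue. x \<notin> N" using N by (simp add: AE_not_in negligible_iff_null_sets)
        then have "AE x in unit_lebesgue. x \<notin> N"
          by (simp add: AE_restrict_space_iff) (erule eventually_mono, simp)
        then show "AE x in unit_lebesgue. (\<lambda>n. clamp (s n x)) \<longlonglongrightarrow> g x"
          using AE_space
        proof eventually_elim
          case (elim x)
          then have "(\<lambda>n. s n x) \<longlonglongrightarrow> g x" using s(2)[of x] by simp
          then have "(\<lambda>n. clamp (s n x)) \<longlonglongrightarrow> clamp (g x)"
            using clamp_cont by (intro continuous_on_tendsto_compose[OF clamp_cont]) auto
          then show ?case by (simp add: clamp_id le)
        qed
        fix n x
        have "norm (g x - clamp (s n x)) \<le> 2 * B"
          using norm_triangle_ineq4[of "g x" "clamp (s n x)"] le[of x] clamp[of "s n x"] by linarith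
        then show "(norm (g x - clamp (s n x)))\<^sup>2 \<le> (2 * B)\<^sup>2" by (intro power_mono) auto
      qed
    qed
  qed
  define g where "g n x = (if norm (f x) \<le> real (Suc n) then f x else 0)" for n x
  have gm: "g n \<in> borel_measurable unit_lebesgue" for n
    unfolding g_def using L2_measurable[OF f] by measurable
  have gB: "norm (g n x) \<le> real (Suc n)" for n x by (simp add: g_def)
  have gL: "g n \<in> L2" for n by (rule L2_bounded[OF gm gB])
  show ?thesis
  proof (rule L2_functional_limit_zero[OF l f gL bdd[OF gm gB]])
    show "(\<lambda>n. L2_norm (\<lambda>x. f x - g n x)) \<longlonglongrightarrow> 0"
    proof (rule L2_norm_tendsto_0[OF f gL L2_integrable[OF f]])
      have "(\<lambda>n. g n x) \<longlonglongrightarrow> f x" for x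
      proof (rule tendsto_eventually)
        obtain m where m: "norm (f x) \<le> real m" using real_arch_simple by blast
        show "\<forall>\<^sub>F n in sequentially. g n x = f x"
          using eventually_ge_at_top[of m] by eventually_elim (use m in \<open>auto simp: g_def\<close>)
      qed
      then show "AE x in unit_lebesgue. (\<lambda>n. g n x) \<longlonglongrightarrow> f x" by simp
    qed (auto simp: g_def)
  qed simp
qed

section \<open>Integrals over [0,1] and absolutely continuous functions\<close>

lemma L2_integrable1:
  fixes g :: "'n::finite vfun"
  assumes "g \<in> L2"
  shows "integrable unit_lebesgue g"
proof (rule Bochner_Integration.integrable_bound)
  show "integrable unit_lebesgue (\<lambda>x. 1 + (norm (g x))\<^sup>2)"
    by (intro Bochner_Integration.integrable_add integrable_const_unit L2_integrable assms)
  have "norm (g x) \<le> 1 + (norm (g x))\<^sup>2" for x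
  proof -
    have "2 * norm (g x) \<le> (norm (g x))\<^sup>2 + 1" using sum_squares_bound[of "norm (g x)" 1] by simp
    then show ?thesis using norm_ge_zero[of "g x"] by linarith
  qed
  then show "AE x in unit_lebesgue. norm (g x) \<le> norm (1 + (norm (g x))\<^sup>2)"
    by (auto intro: order_trans)
qed (rule L2_measurable[OF assms])

lemma unit_set_integrable:
  fixes g :: "real \<Rightarrow> 'b::euclidean_space"
  assumes g: "integrable unit_lebesgue g" and "A \<in> sets lebesgue" "A \<subseteq> {0..1}"
  shows "set_integrable lebesgue A g"
proof -
  have "set_integrable lebesgue {0..1} g"
    using g by (simp add: integrable_restrict_space set_integrable_def)
  then show ?thesis by (rule set_integrable_subset) (use assms in auto)
qed

lemma unit_set_integral:
  fixes g :: "real \<Rightarrow> 'b::euclidean_space"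
  assumes "A \<in> sets lebesgue" "A \<subseteq> {0..1}"
  shows "(LINT t:A|lebesgue. g t) = (LINT t|unit_lebesgue. indicator A t *\<^sub>R g t)"
proof -
  have "(LINT t|unit_lebesgue. indicator A t *\<^sub>R g t) = (LINT t|lebesgue. indicator {0..1} t *\<^sub>R (indicator A t *\<^sub>R g t))"
    by (subst integral_restrict_space) (auto simp: set_lebesgue_integral_def)
  also have "(\<lambda>t. indicator {0..1} t *\<^sub>R (indicator A t *\<^sub>R g t)) = (\<lambda>t. indicator A t *\<^sub>R g t)"
    using assms by (auto simp: indicator_def fun_eq_iff)
  finally show ?thesis by (simp add: set_lebesgue_integral_def)
qed

lemma integral_vec_nth:
  fixes g :: "'n::finite vfun"
  assumes "g \<in> L2" "x \<in> {0..1}"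
  shows "(LINT t:{0..x}|lebesgue. g t) $ k = (LINT t:{0..x}|lebesgue. g t $ k)"
proof -
  have "integrable lebesgue (\<lambda>t. indicator {0..x} t *\<^sub>R g t)"
    using unit_set_integrable[OF L2_integrable1[OF assms(1)], of "{0..x}"] assms(2)
    by (auto simp: set_integrable_def)
  from integral_bounded_linear[OF bounded_linear_vec_nth this, of k] show ?thesis
    by (simp add: set_lebesgue_integral_def)
qed

lemma W12_deriv_iff:
  "W12_deriv y g \<longleftrightarrow> g \<in> L2 \<and> (\<forall>k. \<forall>x\<in>{0..1}. y x $ k = y 0 $ k + (LINT t:{0..x}|lebesgue. g t $ k))"
proof -
  have "y x = y 0 + (LINT t:{0..x}|lebesgue. g t) \<longleftrightarrow>
      (\<forall>k. y x $ k = y 0 $ k + (LINT t:{0..x}|lebesgue. g t $ k))" if "g \<in> L2" "x \<in> {0..1}" for x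
    by (simp only: vec_eq_iff vector_add_component integral_vec_nth[OF that])
  then show ?thesis unfolding W12_deriv_def by blast
qed

lemma continuous_imp_integrable_unit:
  fixes f :: "real \<Rightarrow> 'b::euclidean_space"
  assumes "continuous_on {0..1} f"
  shows "integrable unit_lebesgue f"
proof -
  have "set_integrable lborel {0..1} f"
    unfolding set_integrable_def by (rule borel_integrable_compact[OF compact_Icc assms])
  then have "set_integrable lebesgue {0..1} f"
    unfolding set_integrable_def by (simp add: integrable_completion)
  then show ?thesis by (simp add: integrable_restrict_space set_integrable_def)
qed

lemma FTC_lebesgue:
  fixes F f :: "real \<Rightarrow> complex"
  assumes "\<And>x. x \<in> {0..1} \<Longrightarrow> (F has_vector_derivative f x) (at x)" "continuous_on {0..1} f" "x \<in> {0..1}"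
  shows "F x = F 0 + (LINT t:{0..x}|lebesgue. f t)"
proof -
  have "set_integrable lebesgue {0..x} f"
    using assms(3) by (intro unit_set_integrable continuous_imp_integrable_unit assms) auto
  then have "(LINT t:{0..x}|lebesgue. f t) = integral {0..x} f"
    by (rule set_lebesgue_integral_eq_integral)
  moreover have "(f has_integral F x - F 0) {0..x}"
    using assms by (intro fundamental_theorem_of_calculus) (auto intro: has_vector_derivative_at_within)
  ultimately show ?thesis by (simp add: integral_unique)
qed

lemma W12_deriv_smooth:
  fixes y g :: "'n::finite vfun"
  assumes "\<And>k x. x \<in> {0..1} \<Longrightarrow> ((\<lambda>x. y x $ k) has_vector_derivative g x $ k) (at x)"
    and "\<And>k. continuous_on {0..1} (\<lambda>x. g x $ k)"
  shows "W12_deriv y g"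
  unfolding W12_deriv_iff
proof (intro conjI allI ballI)
  have "continuous_on {0..1} (\<lambda>x. \<chi> k. g x $ k)" by (rule continuous_on_vec_lambda) (rule assms(2))
  then show "g \<in> L2" by (intro L2_continuous) simp
qed (rule FTC_lebesgue; use assms in auto)

section \<open>Linear spans and a dual criterion for completeness\<close>

lemma lin_spanI:
  fixes m :: nat and c :: "nat \<Rightarrow> complex"
  shows "(\<And>k. k < m \<Longrightarrow> f k \<in> S) \<Longrightarrow> (\<lambda>x. \<Sum>k<m. c k *s f k x) \<in> lin_span S"
  unfolding lin_span_def mem_Collect_eq by (rule exI[of _ m], rule exI[of _ c], rule exI[of _ f]) simp

lemma lin_span_add:
  assumes "u \<in> lin_span S" "v \<in> lin_span S"
  shows "(\<lambda>x. u x + v x) \<in> lin_span S"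
proof -
  obtain m c f where u: "u = (\<lambda>x. \<Sum>k<m. c k *s f k x)" "\<forall>k<(m::nat). f k \<in> S"
    using assms(1) by (auto simp: lin_span_def)
  obtain m' c' f' where v: "v = (\<lambda>x. \<Sum>k<m'. c' k *s f' k x)" "\<forall>k<(m'::nat). f' k \<in> S"
    using assms(2) by (auto simp: lin_span_def)
  let ?c = "\<lambda>k. if k < m then c k else c' (k - m)" and ?f = "\<lambda>k. if k < m then f k else f' (k - m)"
  have "(\<Sum>k<m + m'. ?c k *s ?f k x) = u x + v x" for x
  proof -
    have "sum h {..<m + m'} = sum h {..<m} + sum h {m..<m+m'}" for h :: "nat \<Rightarrow> complex ^ 'a"
      by (simp add: lessThan_atLeast0 sum.atLeastLessThan_concat)
    then have "(\<Sum>k<m + m'. ?c k *s ?f k x) = (\<Sum>k<m. ?c k *s ?f k x) + (\<Sum>k=m..<m+m'. ?c k *s ?f k x)" .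
    also have "(\<Sum>k=m..<m+m'. ?c k *s ?f k x) = (\<Sum>k<m'. c' k *s f' k x)"
      using sum.shift_bounds_nat_ivl[of "\<lambda>k. ?c k *s ?f k x" 0 m m'] by (simp add: lessThan_atLeast0 add.commute)
    also have "(\<Sum>k<m. ?c k *s ?f k x) = (\<Sum>k<m. c k *s f k x)" by (rule sum.cong) auto
    finally show ?thesis by (simp add: u v)
  qed
  then have "(\<lambda>x. u x + v x) = (\<lambda>x. \<Sum>k<m + m'. ?c k *s ?f k x)" by (simp add: fun_eq_iff)
  moreover have "(\<lambda>x. \<Sum>k<m + m'. ?c k *s ?f k x) \<in> lin_span S"
    by (rule lin_spanI) (use u(2) v(2) in auto)
  ultimately show ?thesis by (simp only:)
qed

lemma lin_span_scale:
  assumes "u \<in> lin_span S"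
  shows "(\<lambda>x. a *s u x) \<in> lin_span S"
proof -
  obtain m c f where u: "u = (\<lambda>x. \<Sum>k<m. c k *s f k x)" "\<forall>k<(m::nat). f k \<in> S"
    using assms(1) by (auto simp: lin_span_def)
  have "(\<lambda>x. a *s u x) = (\<lambda>x. \<Sum>k<m. (a * c k) *s f k x)"
    by (simp add: u vec.scale_sum_right)
  moreover have "(\<lambda>x. \<Sum>k<m. (a * c k) *s f k x) \<in> lin_span S"
    by (rule lin_spanI) (use u(2) in auto)
  ultimately show ?thesis by (simp only:)
qed

lemma lin_span_superset:
  assumes "u \<in> S"
  shows "u \<in> lin_span S"
proof -
  have "(\<lambda>x. \<Sum>k<Suc 0. 1 *s u x) \<in> lin_span S" by (rule lin_spanI) (rule assms)
  then show ?thesis by (simp only: sum.lessThan_Suc lessThan_0 sum.empty add_0 vec.scale_one)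
qed

lemma lin_span_mono: "S \<subseteq> T \<Longrightarrow> lin_span S \<subseteq> lin_span T"
  unfolding lin_span_def by blast

text \<open>Separation needs a subspace of \<open>L2\<close>, which the span need not be for an
  arbitrary relation \<open>T\<close>. It is therefore intersected with \<open>L2\<close>; a
  function outside the closure of the span is also outside the closure of the intersection.\<close>

lemma complete_operatorI:
  assumes "\<And>l f. L2_functional l \<Longrightarrow> (\<And>u. u \<in> lin_span (root_functions T) \<Longrightarrow> u \<in> L2 \<Longrightarrow> l u = 0) \<Longrightarrow>
      f \<in> L2 \<Longrightarrow> l f = 0"
  shows "complete_operator T"
proof -
  let ?V = "lin_span (root_functions T) \<inter> L2"
  have "h \<in> L2_closure (lin_span (root_functions T))" if h: "h \<in> L2" for h
  proof (rule ccontr)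
    assume "h \<notin> L2_closure (lin_span (root_functions T))"
    then have "h \<notin> L2_closure ?V" by (auto simp: L2_closure_def)
    moreover have "(\<lambda>x. 0) \<in> ?V"
    proof -
      have "(\<lambda>x. \<Sum>k<(0::nat). (0::complex) *s (0 :: complex ^ 'a)) \<in> lin_span (root_functions T)"
        by (rule lin_spanI) simp
      then show ?thesis using L2_continuous[of "\<lambda>_. 0"] by simp
    qed
    moreover have "(\<lambda>x. u x + v x) \<in> ?V" if "u \<in> ?V" "v \<in> ?V" for u v
      using that by (auto intro: lin_span_add L2_add)
    moreover have "(\<lambda>x. c *s u x) \<in> ?V" if "u \<in> ?V" for u c
      using that by (auto intro: lin_span_scale L2_scale)
    ultimately have "\<exists>l. L2_functional l \<and> (\<forall>u\<in>?V. l u = 0) \<and> l h \<noteq> 0"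
      by (intro separating_functional[OF _ _ _ _ h]) auto
    then obtain l where "L2_functional l" "\<forall>u\<in>?V. l u = 0" "l h \<noteq> 0" by (elim exE conjE) (rule that)
    then show False using assms h by blast
  qed
  then show ?thesis unfolding complete_operator_def by (auto simp: L2_closure_def)
qed

section \<open>Exponential sums and the Phragmen-Lindelof principle\<close>

lemma norm_tail_le:
  fixes a :: "nat \<Rightarrow> complex"
  assumes a: "\<And>k. norm (a k) \<le> C" and r: "norm x \<le> 1/2" and s: "(\<lambda>k. a k * x ^ k) sums y"
  shows "norm (y - (\<Sum>k<n. a k * x ^ k)) \<le> 2 * C * norm x ^ n"
proof -
  have C: "0 \<le> C" using a[of 0] norm_ge_zero order_trans by blast
  have t: "(\<lambda>k. a (k + n) * x ^ (k + n)) sums (y - (\<Sum>k<n. a k * x ^ k))"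
    using sums_split_initial_segment[OF s, of n] .
  have g: "(\<lambda>k. C * norm x ^ n * norm x ^ k) sums (C * norm x ^ n * (1 / (1 - norm x)))"
    by (intro sums_mult geometric_sums) (use r in auto)
  have le: "norm (a (k + n) * x ^ (k + n)) \<le> C * norm x ^ n * norm x ^ k" for k
    using mult_right_mono[OF a[of "k + n"], of "norm x ^ (k + n)"]
    by (simp add: norm_mult norm_power power_add mult_ac)
  have "norm (y - (\<Sum>k<n. a k * x ^ k)) \<le> (\<Sum>k. C * norm x ^ n * norm x ^ k)"
    unfolding sums_unique[OF t] by (rule norm_suminf_le[OF le sums_summable[OF g]])
  also have "\<dots> = C * norm x ^ n * (1 / (1 - norm x))" using sums_unique[OF g] by simp
  also have "\<dots> \<le> C * norm x ^ n * 2"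
    by (intro mult_left_mono) (use r C in \<open>auto simp: field_simps\<close>)
  finally show ?thesis by (simp add: mult_ac)
qed

text \<open>A quantitative minimum modulus property. What matters is that \<open>N\<close> depends
  on \<open>n\<close> alone: if \<open>C\<close> and \<open>1 / \<eta>\<close> grow at most
  exponentially in \<open>z\<close>, the lower bound on the circle decays at most
  exponentially.\<close>

definition circle_bound :: "nat \<Rightarrow> nat \<Rightarrow> bool" where
  "circle_bound n N \<longleftrightarrow> (\<forall>f z C \<eta>. f holomorphic_on UNIV \<longrightarrow> (\<forall>w\<in>cball z 1. norm (f w) \<le> C) \<longrightarrow> 0 < \<eta> \<longrightarrow>
     \<eta> \<le> C \<longrightarrow> (\<exists>k\<le>n. \<eta> \<le> norm ((deriv ^^ k) f z / fact k)) \<longrightarrow>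
     (\<exists>r>0. r \<le> 1/2 \<and> (\<forall>w. norm (w - z) = r \<longrightarrow> C * (\<eta> / (16 * C)) ^ N \<le> norm (f w))))"

text \<open>The circle is chosen so small that a single Taylor term dominates the sum of all the others.\<close>

lemma circle_lower_bound: "\<exists>N. circle_bound n N"
proof (induction n rule: less_induct)
  case (less n)
  obtain N0 where N0: "n > 0 \<Longrightarrow> circle_bound (n - 1) N0"
    using less[of "n-1"] by (cases "n = 0") auto
  \<comment> \<open>The exponent \<open>n + 1\<close> serves the case of a dominating
    \<open>n\<close>-th term. The other exponent pays for the induction step, where
    \<open>\<eta>\<close> drops to \<open>\<eta>'\<close> and \<open>\<eta>' / (16 * C)\<close> is
    at least \<open>(t / 16) ^ (n + 2)\<close>.\<close>
  define N where "N = max (n + 1) ((n + 2) * N0)"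
  show ?case
    unfolding circle_bound_def
  proof (intro exI[of _ N] allI impI)
    fix f :: "complex \<Rightarrow> complex" and z C \<eta>
    assume hol: "f holomorphic_on UNIV" and bd: "\<forall>w\<in>cball z 1. norm (f w) \<le> C"
      and eta: "0 < \<eta>" "\<eta> \<le> C" and ex: "\<exists>k\<le>n. \<eta> \<le> norm ((deriv ^^ k) f z / fact k)"
    define a where "a k = (deriv ^^ k) f z / fact k" for k
    define t where "t = \<eta> / C"
    have C: "C > 0" using eta by simp
    have t: "0 < t" "t \<le> 1" "\<eta> = C * t" "\<eta> / (16 * C) = t / 16"
      using eta C by (auto simp: t_def)
    have ak: "norm (a k) \<le> C" for k
    proof -
      have "norm ((deriv ^^ k) f z) \<le> fact k * C / 1 ^ k"
        by (rule Cauchy_inequality)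
          (use hol bd in \<open>auto intro: holomorphic_on_subset holomorphic_on_imp_continuous_on simp: dist_norm\<close>)
      then show ?thesis by (simp add: a_def norm_divide field_simps)
    qed
    \<comment> \<open>The threshold for the lower coefficients: if one of them reaches it, the
      induction hypothesis applies with \<open>\<eta>'\<close>; otherwise all lower terms are
      negligible against the \<open>n\<close>-th.\<close>
    define \<eta>' where "\<eta>' = C * (t / 16) ^ (n + 1)"
    have t16: "0 < t / 16" "t / 16 \<le> 1" using t by auto
    have pow: "(t / 16) ^ N \<le> (t / 16) ^ m" if "m \<le> N" for m
      using power_decreasing[OF that, of "t/16"] t16 by auto
    show "\<exists>r>0. r \<le> 1/2 \<and> (\<forall>w. norm (w - z) = r \<longrightarrow> C * (\<eta> / (16 * C)) ^ N \<le> norm (f w))"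
    proof (cases "\<exists>k<n. \<eta>' \<le> norm (a k)")
      case True
      then obtain k where k: "k < n" "\<eta>' \<le> norm (a k)" by blast
      then have n: "n > 0" and k': "k \<le> n - 1" by auto
      have ex': "\<exists>k\<le>n-1. \<eta>' \<le> norm ((deriv ^^ k) f z / fact k)"
        using k(2) k' unfolding a_def by blast
      have e': "0 < \<eta>'" "\<eta>' \<le> C"
        using C t16 power_le_one[of "t/16" "n+1"] by (auto simp: \<eta>'_def)
      have le: "(t / 16) ^ N \<le> (\<eta>' / (16 * C)) ^ N0"
      proof -
        have "(t / 16) ^ (n + 2) \<le> \<eta>' / (16 * C)"
          using C t by (auto simp: \<eta>'_def field_simps mult_left_le)
        then have "((t / 16) ^ (n + 2)) ^ N0 \<le> (\<eta>' / (16 * C)) ^ N0"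
          by (intro power_mono) (use t in auto)
        moreover have "(t / 16) ^ N \<le> ((t / 16) ^ (n + 2)) ^ N0"
          unfolding power_mult[symmetric] by (rule pow) (simp add: N_def)
        ultimately show ?thesis by linarith
      qed
      from N0[OF n, unfolded circle_bound_def, rule_format, OF hol _ e' ex'] bd
      obtain r where r: "r > 0" "r \<le> 1/2"
        "\<And>w. norm (w - z) = r \<Longrightarrow> C * (\<eta>' / (16 * C)) ^ N0 \<le> norm (f w)" by blast
      show ?thesis
        using r le C unfolding t(4)
        by (intro exI[of _ r]) (auto intro: order_trans[OF mult_left_mono[OF le]])
    next
      case False
      with ex have an: "\<eta> \<le> norm (a n)"
      proof -
        obtain k where k: "k \<le> n" "\<eta> \<le> norm (a k)" using ex by (auto simp: a_def)
        have "\<eta>' \<le> \<eta>"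
        proof -
          have "(t / 16) ^ (n + 1) \<le> t / 16" using power_decreasing[of 1 "n+1" "t/16"] t16 by simp
          also have "\<dots> \<le> t" using t by simp
          finally show ?thesis using C by (simp add: \<eta>'_def t(3))
        qed
        then have "\<not> k < n" using False k by (meson order_trans)
        then show ?thesis using k by simp
      qed
      \<comment> \<open>With this radius the bound \<open>2 * C * r ^ Suc n\<close> for the Taylor
        tail is exactly a quarter of \<open>\<eta> * r ^ n\<close>. The lower terms take at most
        another quarter, so half of the \<open>n\<close>-th term survives.\<close>
      define r where "r = t / 8"
      have r: "0 < r" "r \<le> 1/2" using t by (auto simp: r_def)
      have "C * (t / 16) ^ N \<le> norm (f w)" if w: "norm (w - z) = r" for w
      proof -
        have s: "(\<lambda>k. a k * (w - z) ^ k) sums f w"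
          unfolding a_def
          by (rule holomorphic_power_series[where r = 1])
            (use hol w r in \<open>auto intro: holomorphic_on_subset simp: dist_norm norm_minus_commute\<close>)
        have tail: "norm (f w - (\<Sum>k<Suc n. a k * (w - z) ^ k)) \<le> 2 * C * r ^ Suc n"
          using norm_tail_le[OF ak _ s, of "Suc n"] w r by simp
        have low: "norm (\<Sum>k<n. a k * (w - z) ^ k) \<le> real n * \<eta>'"
        proof -
          have "norm (a k * (w - z) ^ k) \<le> \<eta>'" if "k < n" for k
          proof -
            have "\<eta>' \<ge> 0" using C t by (simp add: \<eta>'_def)
            have "norm (a k) * r ^ k \<le> \<eta>' * 1"
              by (rule mult_mono) (use False that r power_le_one[of r k] \<open>\<eta>' \<ge> 0\<close> in \<open>auto simp: not_le intro: less_imp_le\<close>)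
            then show ?thesis by (simp add: norm_mult norm_power w)
          qed
          then show ?thesis
            using sum_norm_bound[of "{..<n}" "\<lambda>k. a k * (w - z) ^ k" \<eta>'] by simp
        qed
        have low': "real n * \<eta>' \<le> \<eta> * r ^ n / 4"
        proof -
          \<comment> \<open>The factor 2 between the scale \<open>t / 16\<close> of the threshold
            and the radius \<open>t / 8\<close> absorbs the number \<open>n\<close> of lower
            terms.\<close>
          have "real n \<le> 2 ^ n" using less_exp[of n] by (metis less_imp_le of_nat_le_iff of_nat_numeral of_nat_power)
          then have "real n * (t ^ n / 16 ^ n) \<le> 2 ^ n * (t ^ n / 16 ^ n)"
            by (intro mult_right_mono) (use t in auto)
          also have "\<dots> = r ^ n"
          proof -
            have "(16::real) ^ n = 2 ^ n * 8 ^ n" by (simp flip: power_mult_distrib)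
            then show ?thesis by (simp add: r_def power_divide)
          qed
          finally have "real n * (t / 16) ^ n \<le> r ^ n" by (simp add: power_divide)
          then have "(C * t / 16) * (real n * (t / 16) ^ n) \<le> (C * t / 16) * r ^ n"
            by (intro mult_left_mono) (use C t in auto)
          moreover have "(C * t / 16) * r ^ n \<le> \<eta> * r ^ n / 4" using C t r by (simp add: field_simps)
          ultimately show ?thesis by (simp add: \<eta>'_def mult_ac)
        qed
        have "f w - (\<Sum>k<Suc n. a k * (w - z) ^ k) + (\<Sum>k<n. a k * (w - z) ^ k) + a n * (w - z) ^ n = f w"
          by simp
        then have "norm (a n * (w - z) ^ n) \<le> norm (f w) + 2 * C * r ^ Suc n + real n * \<eta>'"
          using tail low norm_triangle_ineq4 by (smt (verit, ccfv_SIG) add_diff_cancel_left' norm_triangle_ineq norm_triangle_sub add.commute)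
        moreover have "\<eta> * r ^ n \<le> norm (a n * (w - z) ^ n)"
          using an r by (simp add: norm_mult norm_power w)
        moreover have "2 * C * r ^ Suc n = \<eta> * r ^ n / 4"
          using C by (simp add: t(3) r_def)
        ultimately have "\<eta> * r ^ n / 2 \<le> norm (f w)" using low' by linarith
        moreover have "C * (t / 16) ^ (n + 1) \<le> \<eta> * r ^ n / 2"
        proof -
          have "(t / 16) ^ n \<le> r ^ n" by (intro power_mono) (use t in \<open>auto simp: r_def\<close>)
          then have "(C * t / 16) * (t / 16) ^ n \<le> (C * t / 2) * r ^ n"
            by (intro mult_mono) (use C t in auto)
          then show ?thesis by (simp add: t(3) mult_ac)
        qed
        moreover have "C * (t / 16) ^ N \<le> C * (t / 16) ^ (n + 1)"
          using pow[of "n + 1"] C by (simp add: N_def)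
        ultimately show ?thesis by linarith
      qed
      then show ?thesis using r unfolding t(4) by blast
    qed
  qed
qed

section \<open>Taylor coefficients of exponential sums\<close>

lemma higher_deriv_exp_sum:
  fixes c :: "complex \<Rightarrow> complex"
  assumes "finite S"
  shows "(deriv ^^ k) (\<lambda>w. \<Sum>\<omega>\<in>S. c \<omega> * exp (\<omega> * w)) = (\<lambda>w. \<Sum>\<omega>\<in>S. c \<omega> * \<omega> ^ k * exp (\<omega> * w))"
proof (induction k)
  case (Suc k)
  have "((\<lambda>w. \<Sum>\<omega>\<in>S. c \<omega> * \<omega> ^ k * exp (\<omega> * w)) has_field_derivative
      (\<Sum>\<omega>\<in>S. c \<omega> * \<omega> ^ Suc k * exp (\<omega> * w))) (at w)" for w
    by (rule DERIV_sum) (auto intro!: derivative_eq_intros)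
  then show ?case by (auto simp: Suc intro: DERIV_imp_deriv)
qed simp

text \<open>Applying the differential operator that kills all other exponentials isolates one term.\<close>

lemma exp_sum_deriv_lower_bound:
  fixes c :: "complex \<Rightarrow> complex"
  assumes S: "finite S" "\<omega>0 \<in> S" "c \<omega>0 \<noteq> 0"
  shows "\<exists>n. \<exists>\<kappa>>0. \<forall>w. \<exists>k\<le>n.
    \<kappa> * norm (exp (\<omega>0 * w)) \<le> norm ((deriv ^^ k) (\<lambda>w. \<Sum>\<omega>\<in>S. c \<omega> * exp (\<omega> * w)) w / fact k)"
proof -
  define f where "f = (\<lambda>w. \<Sum>\<omega>\<in>S. c \<omega> * exp (\<omega> * w))"
  \<comment> \<open>Applying \<open>P\<close> to differentiation multiplies the term of frequency
    \<open>\<omega>\<close> by \<open>poly P \<omega>\<close>, which vanishes unless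
    \<open>\<omega> = \<omega>0\<close>. The factorials in \<open>a\<close> convert derivatives into
    Taylor coefficients.\<close>
  define P :: "complex poly" where "P = (\<Prod>\<omega>\<in>S-{\<omega>0}. [:-\<omega>, 1:])"
  define n where "n = degree P"
  define a where "a k = coeff P k * fact k" for k
  \<comment> \<open>The summand 1 keeps \<open>A\<close> positive and makes the final comparison,
    \<open>A - 1\<close> against \<open>A\<close>, strict.\<close>
  define A where "A = (\<Sum>k\<le>n. norm (a k)) + 1"
  have poly: "poly P x = (\<Prod>\<omega>\<in>S-{\<omega>0}. x - \<omega>)" for x
    by (simp add: P_def poly_prod)
  have P0: "poly P \<omega>0 \<noteq> 0" using S by (auto simp: poly)
  have P1: "poly P \<omega> = 0" if "\<omega> \<in> S" "\<omega> \<noteq> \<omega>0" for \<omega>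
    using that S by (auto simp: poly)
  have A: "A > 0" unfolding A_def by (smt (verit) norm_ge_zero sum_nonneg)
  define \<kappa> where "\<kappa> = norm (c \<omega>0 * poly P \<omega>0) / A"
  have "\<exists>k\<le>n. \<kappa> * norm (exp (\<omega>0 * w)) \<le> norm ((deriv ^^ k) f w / fact k)" for w
  proof (rule ccontr)
    assume neg: "\<not> (\<exists>k\<le>n. \<kappa> * norm (exp (\<omega>0 * w)) \<le> norm ((deriv ^^ k) f w / fact k))"
    then have less: "norm ((deriv ^^ k) f w / fact k) \<le> \<kappa> * norm (exp (\<omega>0 * w))" if "k \<le> n" for k
      using that by (meson linear)
    have strict: "norm ((deriv ^^ 0) f w / fact 0) < \<kappa> * norm (exp (\<omega>0 * w))"
      using neg by (meson not_le zero_le)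
    have "(\<Sum>k\<le>n. a k * ((deriv ^^ k) f w / fact k)) = (\<Sum>k\<le>n. \<Sum>\<omega>\<in>S. coeff P k * (c \<omega> * \<omega> ^ k * exp (\<omega> * w)))"
      unfolding f_def higher_deriv_exp_sum[OF S(1)] a_def sum_distrib_left[symmetric]
      by (intro sum.cong refl) simp
    also have "\<dots> = (\<Sum>\<omega>\<in>S. c \<omega> * exp (\<omega> * w) * poly P \<omega>)"
      by (subst sum.swap) (simp add: poly_altdef n_def sum_distrib_left mult_ac)
    also have "\<dots> = c \<omega>0 * exp (\<omega>0 * w) * poly P \<omega>0"
      using S P1 by (subst sum.remove[OF S(1,2)]) auto
    finally have "norm (c \<omega>0 * exp (\<omega>0 * w) * poly P \<omega>0) = norm (\<Sum>k\<le>n. a k * ((deriv ^^ k) f w / fact k))"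
      by simp
    also have "\<dots> \<le> (\<Sum>k\<le>n. norm (a k) * (\<kappa> * norm (exp (\<omega>0 * w))))"
      by (intro sum_norm_le) (metis atMost_iff less mult_left_mono norm_ge_zero norm_mult)
    also have "\<dots> = (A - 1) * (\<kappa> * norm (exp (\<omega>0 * w)))"
      by (simp add: A_def sum_distrib_right)
    also have "\<dots> < A * (\<kappa> * norm (exp (\<omega>0 * w)))"
      using strict norm_ge_zero by (smt (verit) mult_strict_right_mono)
    also have "\<dots> = norm (c \<omega>0 * exp (\<omega>0 * w) * poly P \<omega>0)"
      using A by (simp add: \<kappa>_def norm_mult)
    finally show False by simp
  qed
  moreover have "\<kappa> > 0" using S P0 A by (simp add: \<kappa>_def)
  ultimately show ?thesis unfolding f_def by blast
qed

section \<open>The Phragmen-Lindelof principle for cones and for three rays\<close>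

lemma Re_coordinates:
  assumes "Im (cnj b1 * b2) \<noteq> 0"
  obtains p where "Re (b1 * p) = s" "Re (b2 * p) = t"
proof -
  define d where "d = Im b1 * Re b2 - Re b1 * Im b2"
  have d: "d \<noteq> 0" using assms by (simp add: d_def algebra_simps)
  define p where "p = Complex ((Im b1 * t - Im b2 * s) / d) ((Re b1 * t - Re b2 * s) / d)"
  have "Re (b1 * p) * d = s * d" "Re (b2 * p) * d = t * d"
    using d by (simp_all add: p_def left_diff_distrib) (simp_all add: d_def algebra_simps)
  then show thesis using d that[of p] by simp
qed

text \<open>Cramer's rule in the real basis \<open>p\<close>, \<open>q\<close>: the imaginary parts
  are real 2 by 2 determinants.\<close>

lemma cone_coordinates:
  fixes p q w :: complex
  assumes "Im (cnj p * q) \<noteq> 0"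
  shows "w = of_real (Im (w * cnj q) / Im (p * cnj q)) * p + of_real (Im (w * cnj p) / Im (q * cnj p)) * q"
proof -
  have neg: "Im (q * cnj p) = - Im (p * cnj q)" and nz: "Im (p * cnj q) \<noteq> 0"
    using assms by (auto simp: algebra_simps)
  have "Re w * Im (p * cnj q) = Im (w * cnj q) * Re p - Im (w * cnj p) * Re q"
    "Im w * Im (p * cnj q) = Im (w * cnj q) * Im p - Im (w * cnj p) * Im q"
    by (simp_all add: algebra_simps)
  moreover have "r = X / E * s + Y / (- E) * t" if "r * E = X * s - Y * t" "E \<noteq> 0" for r X Y E s t :: real
    using that by (simp add: field_simps)
  moreover have "Re (of_real r * z) = r * Re z" "Im (of_real r * z) = r * Im z" for r z by simp_all
  ultimately show ?thesis using nz by (intro complex_eqI) (simp_all only: plus_complex.sel neg)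
qed

text \<open>Since \<open>p\<close> and \<open>q\<close> are independent over the reals, the cone
  opens by less than pi. There is room for an exponent \<open>\<rho>\<close> greater than 1 such
  that \<open>\<zeta> powr \<rho>\<close>, for a rotated and shifted variable
  \<open>\<zeta>\<close>, still has positive real part on the cone. The factor
  \<open>exp (- \<epsilon> * \<zeta> powr \<rho>)\<close> then beats the growth of \<open>f\<close>
  without spoiling the bounds on the edges; the maximum principle applies to truncated cones, and
  \<open>\<epsilon>\<close> tends to 0.\<close>

lemma phragmen_lindelof_cone:
  fixes f :: "complex \<Rightarrow> complex"
  assumes hol: "f holomorphic_on UNIV" and ind: "Im (cnj p * q) \<noteq> 0"
    and growth: "\<And>w. norm (f w) \<le> A * exp (K * norm w)"
    and ray1: "\<And>t. t \<ge> 0 \<Longrightarrow> norm (f (of_real t * p)) \<le> B"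
    and ray2: "\<And>t. t \<ge> 0 \<Longrightarrow> norm (f (of_real t * q)) \<le> B"
    and B: "B > 0" and ab: "\<alpha> > 0" "\<beta> > 0"
  shows "norm (f (of_real \<alpha> * p + of_real \<beta> * q)) \<le> B"
proof -
  \<comment> \<open>Multiplication by \<open>e\<close> moves the cone into the right half
    plane.\<close>
  obtain e where e: "Re (p * e) = 1" "Re (q * e) = 1" by (rule Re_coordinates[OF ind])
  have e0: "e \<noteq> 0" using e by auto
  \<comment> \<open>A lower bound for the cosine of the argument on the rotated cone: it works for
    both generators, whose real part is 1, and by the triangle inequality for their nonnegative
    combinations.\<close>
  define \<kappa> where "\<kappa> = 1 / max 1 (max (norm (p * e)) (norm (q * e)))"
  have \<kappa>: "0 < \<kappa>" and \<kappa>1: "\<kappa> \<le> 1" by (auto simp: \<kappa>_def)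
  have Rep: "Re (p * e) \<ge> \<kappa> * norm (p * e)" and Req: "Re (q * e) \<ge> \<kappa> * norm (q * e)"
    unfolding e \<kappa>_def by (auto simp: field_simps)
  define Cn where "Cn = {of_real a * p + of_real b * q | a b. a \<ge> 0 \<and> b \<ge> 0}"
  \<comment> \<open>The shift by 1 keeps the vertex away from 0, so that
    \<open>Ln (\<zeta> w)\<close> is holomorphic near the whole closed cone.\<close>
  define \<zeta> where "\<zeta> w = w * e + 1" for w
  have cone: "Re (\<zeta> w) \<ge> 1 \<and> Re (\<zeta> w) \<ge> \<kappa> * norm (\<zeta> w) \<and> norm (\<zeta> w) \<ge> \<kappa> * norm e * norm w" if wCn: "w \<in> Cn" for w
  proof -
    obtain a b where w: "w = of_real a * p + of_real b * q" "a \<ge> 0" "b \<ge> 0" using wCn unfolding Cn_def by blast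
    have "Re (w * e) = a * Re (p * e) + b * Re (q * e)" by (simp add: w algebra_simps)
    also have "\<dots> \<ge> a * (\<kappa> * norm (p * e)) + b * (\<kappa> * norm (q * e))"
      using w Rep Req by (intro add_mono mult_left_mono)
    also have "a * (\<kappa> * norm (p * e)) + b * (\<kappa> * norm (q * e)) = \<kappa> * (norm (of_real a * (p * e)) + norm (of_real b * (q * e)))"
      unfolding norm_mult norm_of_real using w(2,3) by (simp add: algebra_simps)
    also have "\<dots> \<ge> \<kappa> * norm (w * e)"
      using \<kappa> norm_triangle_ineq[of "of_real a * (p * e)" "of_real b * (q * e)"]
      by (intro mult_left_mono) (auto simp: w algebra_simps)
    finally have 1: "Re (w * e) \<ge> \<kappa> * norm (w * e)" .
    have 2: "norm (\<zeta> w) \<le> norm (w * e) + 1" unfolding \<zeta>_def using norm_triangle_ineq[of "w * e" 1] by simp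
    have "\<kappa> * norm (\<zeta> w) \<le> \<kappa> * norm (w * e) + \<kappa>"
      using mult_left_mono[OF 2, of \<kappa>] \<kappa> by (simp add: algebra_simps)
    moreover have "0 \<le> \<kappa> * norm (w * e)" using \<kappa> by auto
    moreover have "norm (\<zeta> w) \<ge> Re (\<zeta> w)" by (rule complex_Re_le_cmod)
    ultimately show ?thesis using 1 \<kappa>1 by (auto simp: \<zeta>_def norm_mult mult_ac)
  qed
  \<comment> \<open>A bound for the argument on the cone. \<open>arccos \<kappa>\<close> may be 0,
    so it is replaced by at least 1, which is still below \<open>pi / 2\<close>, to permit division
    by \<open>\<theta>\<close>.\<close>
  define \<theta> where "\<theta> = max (arccos \<kappa>) 1"
  have \<theta>: "\<theta> > 0" "\<theta> < pi / 2" "cos \<theta> \<le> \<kappa>"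
  proof -
    have "arccos \<kappa> < arccos 0" using \<kappa> \<kappa>1 by (intro arccos_less_arccos) auto
    then show "\<theta> > 0" "\<theta> < pi / 2" using pi_gt3 by (auto simp: \<theta>_def)
    have "cos \<theta> \<le> cos (arccos \<kappa>)" using \<open>\<theta> < pi/2\<close> \<kappa> \<kappa>1 by (intro cos_monotone_0_pi_le) (auto simp: \<theta>_def arccos_lbound)
    then show "cos \<theta> \<le> \<kappa>" using \<kappa> \<kappa>1 by simp
  qed
  \<comment> \<open>The midpoint between 1, the order of growth of \<open>f\<close>, and
    \<open>pi / (2 * \<theta>)\<close>, beyond which the real part of \<open>g\<close> would no
    longer be controlled.\<close>
  define \<rho> where "\<rho> = (1 + pi / (2 * \<theta>)) / 2"
  have \<rho>: "\<rho> > 1" "\<rho> * \<theta> < pi / 2" using \<theta> by (auto simp: \<rho>_def field_simps)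
  define \<gamma> where "\<gamma> = cos (\<rho> * \<theta>)"
  have \<gamma>: "\<gamma> > 0" unfolding \<gamma>_def by (rule cos_gt_zero) (use \<rho> \<theta> in auto)
  define g where "g w = exp (of_real \<rho> * Ln (\<zeta> w))" for w
  have Reg: "Re (g w) \<ge> \<gamma> * norm (\<zeta> w) powr \<rho>" if "w \<in> Cn" for w
  proof -
    have nz: "\<zeta> w \<noteq> 0" using cone[OF that] by auto
    have "norm (\<zeta> w) * cos (Arg (\<zeta> w)) = Re (\<zeta> w)"
      using nz by (metis Re_exp Arg_eq_Im_Ln Re_Ln exp_Ln exp_ln zero_less_norm_iff)
    then have "cos \<theta> \<le> cos \<bar>Arg (\<zeta> w)\<bar>"
      using cone[OF that] nz \<theta> by (smt (verit) cos_abs_real mult.commute mult_le_cancel_left_pos zero_less_norm_iff)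
    then have "\<bar>Arg (\<zeta> w)\<bar> \<le> \<theta>"
      using \<theta> Arg_bounded[of "\<zeta> w"] by (subst (asm) cos_mono_le_eq) auto
    then have "cos (\<rho> * \<theta>) \<le> cos \<bar>\<rho> * Arg (\<zeta> w)\<bar>"
      using \<rho> \<theta> by (intro cos_monotone_0_pi_le) (auto simp: abs_mult)
    then have "\<gamma> \<le> cos (\<rho> * Arg (\<zeta> w))" by (simp add: \<gamma>_def)
    moreover have "Re (g w) = norm (\<zeta> w) powr \<rho> * cos (\<rho> * Arg (\<zeta> w))"
      using nz by (simp add: g_def Re_exp Arg_eq_Im_Ln powr_def)
    ultimately show ?thesis by (simp add: mult.commute[of \<gamma>] mult_left_mono)
  qed
  define w0 where "w0 = of_real \<alpha> * p + of_real \<beta> * q"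
  have bound: "norm (f w0) \<le> B * exp (\<epsilon> * Re (g w0))" if \<epsilon>: "\<epsilon> > 0" for \<epsilon>
  proof -
    define h where "h w = f w * exp (- of_real \<epsilon> * g w)" for w
    have nh: "norm (h w) = norm (f w) * exp (- \<epsilon> * Re (g w))" for w
      by (simp add: h_def norm_mult)
    have gpos: "Re (g w) \<ge> 0" if "w \<in> Cn" for w
      using Reg[OF that] \<gamma> by (smt (verit) mult_nonneg_nonneg powr_ge_zero)
    \<comment> \<open>The exponent \<open>\<rho>\<close> exceeds 1, so the damping wins on distant
      arcs. There \<open>h\<close> is bounded by \<open>B\<close> outright, and the truncation
      radius can be chosen.\<close>
    have "((\<lambda>R. \<bar>A\<bar> * exp (K * R) * exp (- \<epsilon> * (\<gamma> * (\<kappa> * norm e * R) powr \<rho>))) \<longlongrightarrow> 0) at_top"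
    proof -
      have pos: "\<kappa> * norm e > 0" using \<kappa> e0 by auto
      define c where "c = \<epsilon> * \<gamma> * (\<kappa> * norm e) powr \<rho>"
      have c: "c > 0" unfolding c_def
        by (intro mult_pos_pos \<gamma> \<epsilon>) (simp only: powr_gt_zero, use pos in linarith)
      have lim: "((\<lambda>R. \<bar>A\<bar> * exp (K * R - c * R powr \<rho>)) \<longlongrightarrow> 0) at_top"
        using c \<rho>(1) by real_asymp
      have ev: "\<forall>\<^sub>F R in at_top. \<bar>A\<bar> * exp (K * R - c * R powr \<rho>) =
          \<bar>A\<bar> * exp (K * R) * exp (- \<epsilon> * (\<gamma> * (\<kappa> * norm e * R) powr \<rho>))"
        using eventually_gt_at_top[of 0]
      proof eventually_elim
        case (elim R)
        then show ?case using pos by (simp add: powr_mult c_def exp_diff exp_minus field_simps)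
      qed
      show ?thesis using lim by (rule Lim_transform_eventually[OF _ ev])
    qed
    then have "\<forall>\<^sub>F R in at_top. \<bar>A\<bar> * exp (K * R) * exp (- \<epsilon> * (\<gamma> * (\<kappa> * norm e * R) powr \<rho>)) < B"
      using B by (rule order_tendstoD)
    then have "\<forall>\<^sub>F R in at_top. \<bar>A\<bar> * exp (K * R) * exp (- \<epsilon> * (\<gamma> * (\<kappa> * norm e * R) powr \<rho>)) < B \<and> R > norm w0"
      using eventually_gt_at_top[of "norm w0"] by eventually_elim auto
    then obtain R where R: "\<bar>A\<bar> * exp (K * R) * exp (- \<epsilon> * (\<gamma> * (\<kappa> * norm e * R) powr \<rho>)) < B" "R > norm w0"
      by (auto simp: eventually_at_top_linorder)
    have arc: "norm (h w) \<le> B" if w: "w \<in> Cn" "norm w = R" for w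
    proof -
      have "norm (h w) \<le> \<bar>A\<bar> * exp (K * R) * exp (- \<epsilon> * (\<gamma> * (\<kappa> * norm e * R) powr \<rho>))"
        unfolding nh
      proof (intro mult_mono)
        show "norm (f w) \<le> \<bar>A\<bar> * exp (K * R)" using growth[of w] w
          by (smt (verit) exp_gt_zero mult_right_mono)
        have "(\<kappa> * norm e * R) powr \<rho> \<le> norm (\<zeta> w) powr \<rho>"
          using cone[OF w(1)] w \<rho> \<kappa> by (intro powr_mono2) auto
        then have "\<gamma> * (\<kappa> * norm e * R) powr \<rho> \<le> Re (g w)"
          using Reg[OF w(1)] \<gamma> by (smt (verit) mult_left_mono)
        then show "exp (- \<epsilon> * Re (g w)) \<le> exp (- \<epsilon> * (\<gamma> * (\<kappa> * norm e * R) powr \<rho>))"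
          using \<epsilon> by simp
      qed auto
      then show ?thesis using R by linarith
    qed
    define a where "a w = Im (w * cnj q) / Im (p * cnj q)" for w
    define b where "b w = Im (w * cnj p) / Im (q * cnj p)" for w
    have ind': "Im (p * cnj q) \<noteq> 0" "Im (q * cnj p) \<noteq> 0" using ind by (auto simp: algebra_simps)
    have decomp: "w = of_real (a w) * p + of_real (b w) * q" for w
      unfolding a_def b_def by (rule cone_coordinates[OF ind])
    have ab_eq: "a (of_real s * p + of_real t * q) = s" "b (of_real s * p + of_real t * q) = t" for s t
      using ind' by (auto simp: a_def b_def field_simps)
    define S where "S = {w. a w > 0 \<and> b w > 0} \<inter> ball 0 R"
    have cont_a: "continuous_on UNIV a" "continuous_on UNIV b"
      unfolding a_def b_def by (intro continuous_intros; use ind' in auto)+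
    have oS: "open S" unfolding S_def Collect_conj_eq
      by (intro open_Int open_Collect_less cont_a continuous_intros open_ball)
    have "closure S \<subseteq> {w. a w \<ge> 0} \<inter> {w. b w \<ge> 0} \<inter> cball 0 R"
      by (rule closure_minimal) (auto simp: S_def intro!: closed_Int closed_Collect_le cont_a continuous_intros)
    then have clS: "closure S \<subseteq> Cn \<inter> cball 0 R" unfolding Cn_def using decomp by blast
    have holh: "h holomorphic_on closure S"
    proof -
      have "closure S \<subseteq> {w. Re (\<zeta> w) > 0}" using clS cone by force
      moreover have "h holomorphic_on {w. Re (\<zeta> w) > 0}"
        unfolding h_def g_def \<zeta>_def
        by (intro holomorphic_intros holomorphic_on_subset[OF hol]) (auto simp: complex_nonpos_Reals_iff)
      ultimately show ?thesis by (rule holomorphic_on_subset[rotated])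
    qed
    have fr: "norm (h w) \<le> B" if w: "w \<in> frontier S" for w
    proof -
      have wC: "w \<in> Cn" "norm w \<le> R" "w \<notin> S" using w clS oS by (auto simp: frontier_def interior_open)
      have pos: "a w \<ge> 0" "b w \<ge> 0" using wC(1) ab_eq by (auto simp: Cn_def)
      then consider "norm w = R" | "a w = 0" | "b w = 0" using wC by (fastforce simp: S_def)
      then show ?thesis
      proof cases
        case 1 then show ?thesis using arc wC by blast
      next
        case 2
        then have "w = of_real (b w) * q" using decomp[of w] by (metis add_0 add.right_neutral mult_zero_left of_real_0)
        then have "norm (f w) \<le> B" using ray2[of "b w"] pos by metis
        moreover have "exp (- \<epsilon> * Re (g w)) \<le> 1" using gpos[OF wC(1)] \<epsilon> by auto
        ultimately show ?thesis unfolding nh by (smt (verit) mult_left_le norm_ge_zero exp_gt_zero)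
      next
        case 3
        then have "w = of_real (a w) * p" using decomp[of w] by (metis add_0 add.right_neutral mult_zero_left of_real_0)
        then have "norm (f w) \<le> B" using ray1[of "a w"] pos by metis
        moreover have "exp (- \<epsilon> * Re (g w)) \<le> 1" using gpos[OF wC(1)] \<epsilon> by auto
        ultimately show ?thesis unfolding nh by (smt (verit) mult_left_le norm_ge_zero exp_gt_zero)
      qed
    qed
    have "norm (h w0) \<le> B"
    proof (rule maximum_modulus_frontier[where S = S and f = h])
      show "h holomorphic_on interior S" using holh closure_subset[of S] interior_subset[of S]
        by (blast intro: holomorphic_on_subset)
      show "continuous_on (closure S) h" using holh by (rule holomorphic_on_imp_continuous_on)
      show "bounded S" by (auto simp: S_def)
      show "w0 \<in> S" using R ab ab_eq by (auto simp: S_def w0_def)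
    qed (rule fr)
    then show ?thesis unfolding nh by (simp add: exp_minus field_simps)
  qed
  have "((\<lambda>\<epsilon>. B * exp (\<epsilon> * Re (g w0))) \<longlongrightarrow> B * exp (0 * Re (g w0))) (at_right 0)"
    by (intro tendsto_intros)
  moreover have "\<forall>\<^sub>F \<epsilon> in at_right 0. norm (f w0) \<le> B * exp (\<epsilon> * Re (g w0))"
    using eventually_at_right_less[of 0] by eventually_elim (rule bound)
  ultimately have "norm (f w0) \<le> B * exp (0 * Re (g w0))"
    by (rule tendsto_lowerbound) simp
  then show ?thesis by (simp add: w0_def)
qed

text \<open>A vanishing positive combination makes the three closed cones spanned by two of the rays
  cover the plane, and any two of the directions are independent over the reals.\<close>

lemma phragmen_lindelof_three_rays:
  fixes f :: "complex \<Rightarrow> complex"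
  assumes hol: "f holomorphic_on UNIV"
    and growth: "\<And>w. norm (f w) \<le> A * exp (K * norm w)"
    and rays: "\<And>p t. p \<in> {p1, p2, p3} \<Longrightarrow> t \<ge> 0 \<Longrightarrow> norm (f (of_real t * p)) \<le> B"
    and B: "B > 0" and ind: "Im (cnj p1 * p2) \<noteq> 0"
    and pos: "\<alpha>1 > 0" "\<alpha>2 > 0" "\<alpha>3 > 0"
    and zero: "of_real \<alpha>1 * p1 + of_real \<alpha>2 * p2 + of_real \<alpha>3 * p3 = 0"
  shows "norm (f w) \<le> B"
proof -
  have p3: "p3 = of_real (- (\<alpha>1 / \<alpha>3)) * p1 + of_real (- (\<alpha>2 / \<alpha>3)) * p2"
  proof -
    have "of_real \<alpha>3 * p3 = - (of_real \<alpha>1 * p1 + of_real \<alpha>2 * p2)"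
      using zero by (metis add.commute eq_neg_iff_add_eq_0)
    moreover have "p3 = (of_real \<alpha>3 * p3) / of_real \<alpha>3" using pos by simp
    ultimately have "p3 = - (of_real \<alpha>1 * p1 + of_real \<alpha>2 * p2) / of_real \<alpha>3" by simp
    then show ?thesis by (simp add: add_divide_distrib diff_divide_distrib)
  qed
  have ind23: "Im (cnj p2 * p3) \<noteq> 0" and ind13: "Im (cnj p1 * p3) \<noteq> 0"
  proof -
    have "Im (cnj p2 * p3) = (\<alpha>1 / \<alpha>3) * Im (cnj p1 * p2)" unfolding p3 by (simp add: algebra_simps diff_divide_distrib)
    then show "Im (cnj p2 * p3) \<noteq> 0" using ind pos by simp
    have "Im (cnj p1 * p3) = - (\<alpha>2 / \<alpha>3) * Im (cnj p1 * p2)" unfolding p3 by (simp add: algebra_simps diff_divide_distrib)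
    then show "Im (cnj p1 * p3) \<noteq> 0" using ind pos by simp
  qed
  have cone: "norm (f (of_real a * p + of_real b * q)) \<le> B"
    if "a \<ge> 0" "b \<ge> 0" and pq: "p \<in> {p1, p2, p3}" "q \<in> {p1, p2, p3}" "Im (cnj p * q) \<noteq> 0" for a b p q
  proof (cases "a = 0 \<or> b = 0")
    case True
    then show ?thesis using rays[OF pq(1) \<open>a \<ge> 0\<close>] rays[OF pq(2) \<open>b \<ge> 0\<close>] by auto
  next
    case False
    then show ?thesis
      using phragmen_lindelof_cone[OF hol pq(3) growth rays[OF pq(1)] rays[OF pq(2)] B] that by simp
  qed
  define a where "a = Im (w * cnj p2) / Im (p1 * cnj p2)"
  define b where "b = Im (w * cnj p1) / Im (p2 * cnj p1)"
  have w: "w = of_real a * p1 + of_real b * p2" unfolding a_def b_def by (rule cone_coordinates[OF ind])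
  have shift: "w = of_real (a + s * \<alpha>1) * p1 + of_real (b + s * \<alpha>2) * p2 + of_real (s * \<alpha>3) * p3" for s
  proof -
    have "of_real (a + s * \<alpha>1) * p1 + of_real (b + s * \<alpha>2) * p2 + of_real (s * \<alpha>3) * p3 =
        w + of_real s * (of_real \<alpha>1 * p1 + of_real \<alpha>2 * p2 + of_real \<alpha>3 * p3)"
      by (subst w) (simp add: algebra_simps)
    then show ?thesis using zero by simp
  qed
  \<comment> \<open>The smallest multiple of the relation \<open>zero\<close> that makes the
    coefficients of \<open>p1\<close> and \<open>p2\<close> nonnegative; one of them then becomes 0.
    If \<open>a\<close> or \<open>b\<close> is negative, \<open>s\<close> is nonnegative and so is
    the coefficient of \<open>p3\<close>.\<close>
  define s where "s = max (- a / \<alpha>1) (- b / \<alpha>2)"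
  consider "a \<ge> 0" "b \<ge> 0" | "s \<ge> 0" "s = - a / \<alpha>1" "b + s * \<alpha>2 \<ge> 0" | "s \<ge> 0" "s = - b / \<alpha>2" "a + s * \<alpha>1 \<ge> 0"
  proof (cases "a \<ge> 0 \<and> b \<ge> 0")
    case False
    then have "s \<ge> 0" using pos by (auto simp: s_def le_max_iff_disj divide_le_0_iff)
    show ?thesis
    proof (cases "- a / \<alpha>1 \<ge> - b / \<alpha>2")
      case True
      then have "s = - a / \<alpha>1" by (simp add: s_def)
      moreover have "b + s * \<alpha>2 \<ge> 0" using pos pos_divide_le_eq[of \<alpha>2 "- b" s] by (simp add: s_def)
      ultimately show ?thesis using that \<open>s \<ge> 0\<close> by blast
    next
      case False
      then have "s = - b / \<alpha>2" by (simp add: s_def)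
      moreover have "a + s * \<alpha>1 \<ge> 0" using pos pos_divide_le_eq[of \<alpha>1 "- a" s] by (simp add: s_def)
      ultimately show ?thesis using that \<open>s \<ge> 0\<close> by blast
    qed
  qed blast
  then show ?thesis
  proof cases
    case 1
    then show ?thesis using cone[of a b p1 p2] ind by (subst w) auto
  next
    case 2
    then have "a + s * \<alpha>1 = 0" using pos by simp
    then have "w = of_real (b + s * \<alpha>2) * p2 + of_real (s * \<alpha>3) * p3" using shift[of s] by simp
    moreover have "s * \<alpha>3 \<ge> 0" using 2(1) pos by (intro mult_nonneg_nonneg) auto
    ultimately show ?thesis using cone[OF 2(3) _ _ _ ind23, of "s * \<alpha>3"] by blast
  next
    case 3
    then have "b + s * \<alpha>2 = 0" using pos by simp
    then have "w = of_real (a + s * \<alpha>1) * p1 + of_real (s * \<alpha>3) * p3" using shift[of s] by simp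
    moreover have "s * \<alpha>3 \<ge> 0" using 3(1) pos by (intro mult_nonneg_nonneg) auto
    ultimately show ?thesis using cone[OF 3(3) _ _ _ ind13, of "s * \<alpha>3"] by blast
  qed
qed

section \<open>Quotients of entire functions by exponential sums\<close>

lemma exp_sum_norm_le:
  fixes c :: "complex \<Rightarrow> complex"
  assumes "finite S"
  shows "\<exists>A K. A > 0 \<and> K \<ge> 0 \<and> (\<forall>w. norm (\<Sum>\<omega>\<in>S. c \<omega> * exp (\<omega> * w)) \<le> A * exp (K * norm w))"
proof (intro exI conjI allI)
  let ?K = "\<Sum>\<omega>\<in>S. norm \<omega>" and ?A = "1 + (\<Sum>\<omega>\<in>S. norm (c \<omega>))"
  show "?A > 0" by (smt (verit) norm_ge_zero sum_nonneg)
  show "?K \<ge> 0" by (simp add: sum_nonneg)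
  fix w
  have "norm (\<Sum>\<omega>\<in>S. c \<omega> * exp (\<omega> * w)) \<le> (\<Sum>\<omega>\<in>S. norm (c \<omega>) * exp (?K * norm w))"
  proof (rule sum_norm_le)
    fix \<omega> assume "\<omega> \<in> S"
    have "Re (\<omega> * w) \<le> norm \<omega> * norm w" by (metis complex_Re_le_cmod norm_mult)
    also have "\<dots> \<le> ?K * norm w"
      by (intro mult_right_mono member_le_sum) (use assms \<open>\<omega> \<in> S\<close> in auto)
    finally show "norm (c \<omega> * exp (\<omega> * w)) \<le> norm (c \<omega>) * exp (?K * norm w)"
      by (simp add: norm_mult mult_left_mono)
  qed
  also have "\<dots> \<le> ?A * exp (?K * norm w)"
    by (simp add: sum_distrib_right[symmetric])
  finally show "norm (\<Sum>\<omega>\<in>S. c \<omega> * exp (\<omega> * w)) \<le> ?A * exp (?K * norm w)" .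
qed

text \<open>Dividing by \<open>f\<close> is harmless on a suitable circle around \<open>z\<close>,
  where \<open>f\<close> is at least exponentially small by \<open>circle_bound\<close>. The bound
  for \<open>G\<close> on this circle holds at its centre, also if \<open>z\<close> is a zero of
  \<open>f\<close>.\<close>

lemma exp_sum_quotient_growth:
  fixes c :: "complex \<Rightarrow> complex"
  assumes S: "finite S" "\<omega>0 \<in> S" "c \<omega>0 \<noteq> 0" and G: "G holomorphic_on UNIV"
    and f_def: "f = (\<lambda>w. \<Sum>\<omega>\<in>S. c \<omega> * exp (\<omega> * w))"
    and le: "\<And>w. norm (f w * G w) \<le> A * exp (K * norm w)"
  shows "\<exists>A' K'. \<forall>w. norm (G w) \<le> A' * exp (K' * norm w)"
proof -
  obtain n \<kappa> where \<kappa>: "\<kappa> > 0"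
    and low: "\<And>w. \<exists>k\<le>n. \<kappa> * norm (exp (\<omega>0 * w)) \<le> norm ((deriv ^^ k) f w / fact k)"
    using exp_sum_deriv_lower_bound[of S \<omega>0 c] S unfolding f_def by blast
  obtain A1 K1 where A1: "A1 > 0" "K1 \<ge> 0" "\<And>w. norm (f w) \<le> A1 * exp (K1 * norm w)"
    using exp_sum_norm_le[OF S(1), of c] unfolding f_def by blast
  obtain N where N: "circle_bound n N"
    using circle_lower_bound[of n] ..
  have holf: "f holomorphic_on UNIV" unfolding f_def by (intro holomorphic_intros)
  define K2 where "K2 = max K1 (max (norm \<omega>0) (max K 0))"
  define A2 where "A2 = max A1 (max \<kappa> (max A 1))"
  have K2: "K2 \<ge> K1" "K2 \<ge> norm \<omega>0" "K2 \<ge> K" "K2 \<ge> 0" by (auto simp: K2_def)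
  have A2: "A2 \<ge> A1" "A2 \<ge> \<kappa>" "A2 \<ge> A" "A2 \<ge> 1" by (auto simp: A2_def)
  \<comment> \<open>\<open>E z\<close> bounds all exponentials involved on the whole unit disc
    around \<open>z\<close>, not only at \<open>z\<close>; its reciprocal bounds the exponential of
    frequency \<open>\<omega>0\<close> at \<open>z\<close> from below.\<close>
  define E where "E w = exp (K2 * (norm w + 1))" for w :: complex
  define q where "q = \<kappa> / (16 * A2)"
  have q: "0 < q" using \<kappa> A2 by (simp add: q_def)
  have main: "norm (G z) \<le> E z ^ (2 * N) / q ^ N" for z
  proof -
    have E1: "E z \<ge> 1" using K2 by (simp add: E_def)
    define C where "C = A2 * E z"
    define \<eta> where "\<eta> = \<kappa> / E z"
    have C: "C > 0" using A2 E1 by (simp add: C_def)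
    have near: "norm w \<le> norm z + 1" if "w \<in> cball z 1" for w
      using that norm_triangle_sub[of w z] by (simp add: dist_norm norm_minus_commute)
    have near_exp: "X * exp (Y * norm w) \<le> C" if "w \<in> cball z 1" "X \<le> A2" "Y \<le> K2" for w X Y
    proof -
      have "Y * norm w \<le> K2 * norm w" using that by (intro mult_right_mono) auto
      also have "\<dots> \<le> K2 * (norm z + 1)" using near[OF that(1)] K2 by (intro mult_left_mono) auto
      finally have "exp (Y * norm w) \<le> E z" by (simp add: E_def)
      then have "X * exp (Y * norm w) \<le> A2 * exp (Y * norm w)" "A2 * exp (Y * norm w) \<le> A2 * E z"
        using that A2 by (auto intro: mult_right_mono mult_left_mono)
      then show ?thesis unfolding C_def by (rule order_trans)
    qed
    have "\<forall>w\<in>cball z 1. norm (f w) \<le> C"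
      using near_exp[of _ A1 K1] A1(3) A2 K2 order_trans by meson
    moreover have "0 < \<eta>" using \<kappa> E1 by (simp add: \<eta>_def)
    moreover have "\<eta> \<le> C"
    proof -
      have "\<eta> \<le> \<kappa>" using \<kappa> E1 by (simp add: \<eta>_def field_simps)
      also have "\<dots> \<le> C" using A2 E1 \<kappa> mult_mono[of \<kappa> A2 1 "E z"] by (simp add: C_def)
      finally show ?thesis .
    qed
    moreover have "\<exists>k\<le>n. \<eta> \<le> norm ((deriv ^^ k) f z / fact k)"
    proof -
      have "- Re (\<omega>0 * z) \<le> norm (\<omega>0 * z)" using abs_Re_le_cmod[of "\<omega>0 * z"] by linarith
      also have "\<dots> \<le> K2 * (norm z + 1)" unfolding norm_mult by (intro mult_mono) (use K2 in auto)
      finally have "1 / E z \<le> norm (exp (\<omega>0 * z))"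
        by (simp add: E_def flip: exp_minus inverse_eq_divide)
      then have "\<eta> \<le> \<kappa> * norm (exp (\<omega>0 * z))" using \<kappa> mult_left_mono[of "1 / E z" _ \<kappa>] by (simp add: \<eta>_def)
      then show ?thesis using low[of z] order_trans by blast
    qed
    ultimately obtain r where r: "r > 0" "r \<le> 1/2"
      "\<And>w. norm (w - z) = r \<Longrightarrow> C * (\<eta> / (16 * C)) ^ N \<le> norm (f w)"
      using N[unfolded circle_bound_def, rule_format, OF holf, of z C \<eta>] by blast
    define m where "m = (\<eta> / (16 * C)) ^ N"
    have m: "m > 0" using \<open>\<eta> > 0\<close> C by (simp add: m_def)
    \<comment> \<open>Cauchy's inequality of order 0 serves as the maximum principle on the
      disc.\<close>
    have "norm ((deriv ^^ 0) G z) \<le> fact 0 * (1 / m) / r ^ 0"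
    proof (rule Cauchy_inequality)
      fix x assume "norm (z - x) = r"
      then have x: "norm (x - z) = r" "x \<in> cball z 1" using r by (auto simp: norm_minus_commute dist_norm)
      have "(C * m) * norm (G x) \<le> norm (f x * G x)"
        using r(3)[OF x(1)] by (simp add: m_def norm_mult mult_right_mono)
      also have "\<dots> \<le> C" using le[of x] near_exp[OF x(2), of A K] A2 K2 by linarith
      finally show "norm (G x) \<le> 1 / m" using C m by (simp add: field_simps)
    qed (use r G in \<open>auto intro: holomorphic_on_subset holomorphic_on_imp_continuous_on\<close>)
    moreover have "\<eta> / (16 * C) = q / E z ^ 2" using A2 E1 by (simp add: \<eta>_def C_def q_def power2_eq_square)
    then have "1 / m = E z ^ (2 * N) / q ^ N" by (simp add: m_def power_divide power_mult)
    ultimately show ?thesis by simp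
  qed
  show ?thesis
  proof (intro exI allI)
    fix w
    have "E w ^ (2 * N) / q ^ N = (exp (2 * N * K2) / q ^ N) * exp ((2 * N * K2) * norm w)"
    proof -
      have "E w ^ (2 * N) = exp (real (2 * N) * (K2 * (norm w + 1)))"
        by (simp only: E_def exp_of_nat_mult)
      also have "real (2 * N) * (K2 * (norm w + 1)) = 2 * N * K2 + (2 * N * K2) * norm w"
        by (simp add: algebra_simps)
      finally show ?thesis by (simp add: exp_add)
    qed
    then show "norm (G w) \<le> (exp (2 * N * K2) / q ^ N) * exp ((2 * N * K2) * norm w)"
      using main[of w] by metis
  qed
qed

text \<open>The order \<open>n\<close> may be 0; then \<open>h\<close> itself is the nonvanishing
  factor, by continuity. A finite order exists since \<open>h\<close> is not identically 0.\<close>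

lemma zero_factorization:
  assumes h: "h holomorphic_on UNIV" "h w1 \<noteq> 0"
  obtains n g r where "r > 0" "g holomorphic_on ball z r" "\<And>w. w \<in> ball z r \<Longrightarrow> h w = (w - z) ^ n * g w"
    "\<And>w. w \<in> ball z r \<Longrightarrow> g w \<noteq> 0" "\<And>i. i < n \<Longrightarrow> (deriv ^^ i) h z = 0" "(deriv ^^ n) h z \<noteq> 0"
proof -
  have "\<exists>n. (deriv ^^ n) h z \<noteq> 0"
    using holomorphic_fun_eq_0_on_connected[OF h(1) open_UNIV connected_UNIV, of z w1] h(2) by auto
  then obtain n where n: "(deriv ^^ n) h z \<noteq> 0" "\<And>i. i < n \<Longrightarrow> (deriv ^^ i) h z = 0"
    using exists_least_iff[of "\<lambda>n. (deriv ^^ n) h z \<noteq> 0"] by auto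
  show thesis
  proof (cases "n = 0")
    case True
    have "isCont h z"
      using h holomorphic_on_imp_continuous_on continuous_on_eq_continuous_at[OF open_UNIV] by auto
    moreover have nz: "h z \<noteq> 0" using n True by simp
    ultimately obtain r where "r > 0" "\<forall>w. dist z w < r \<longrightarrow> h w \<noteq> 0"
      using continuous_at_avoid[of z h 0] by (auto simp: dist_commute)
    then show thesis using True n h
      by (intro that[of r h 0]) (auto intro: holomorphic_on_subset)
  next
    case False
    then have n0: "n > 0" by simp
    obtain g r where "0 < r" "g holomorphic_on ball z r"
      "\<And>w. w \<in> ball z r \<Longrightarrow> h w - h z = (w - z) ^ n * g w" "\<And>w. w \<in> ball z r \<Longrightarrow> g w \<noteq> 0"
      by (rule holomorphic_factor_order_of_zero[OF h(1) open_UNIV UNIV_I n0 n(1) n(2)]) (assumption, rule that)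
    moreover have "h z = 0" using n(2)[OF n0] by simp
    ultimately show thesis using n by (intro that[of r g n]) auto
  qed
qed

text \<open>The hypothesis \<open>zeros\<close> says that at every point \<open>F\<close> vanishes
  at least to the order of \<open>f\<close>, so all singularities of the quotient are removable. An
  identically vanishing \<open>F\<close> is treated apart, as it has no finite order.\<close>

lemma entire_quotient:
  assumes hol: "f holomorphic_on UNIV" "F holomorphic_on UNIV" and nz: "f w0 \<noteq> 0"
    and zeros: "\<And>z k. (\<And>j. j \<le> k \<Longrightarrow> (deriv ^^ j) f z = 0) \<Longrightarrow> (deriv ^^ k) F z = 0"
  shows "\<exists>G. G holomorphic_on UNIV \<and> (\<forall>w. F w = f w * G w)"
proof (intro exI conjI allI)
  let ?q = "\<lambda>w. F w / f w"
  have mero: "?q meromorphic_on UNIV"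
    by (intro meromorphic_intros analytic_on_imp_meromorphic_on) (use hol in \<open>auto simp: analytic_on_open\<close>)
  have lim: "\<exists>c. ?q \<midarrow>z\<rightarrow> c" for z
  proof (cases "\<exists>w1. F w1 \<noteq> 0")
    case False
    then show ?thesis by auto
  next
    case True
    then obtain w1 where w1: "F w1 \<noteq> 0" ..
    obtain n g r where F: "r > 0" "g holomorphic_on ball z r" "\<And>w. w \<in> ball z r \<Longrightarrow> F w = (w - z) ^ n * g w"
      "\<And>w. w \<in> ball z r \<Longrightarrow> g w \<noteq> 0" "\<And>i. i < n \<Longrightarrow> (deriv ^^ i) F z = 0" "(deriv ^^ n) F z \<noteq> 0"
      by (rule zero_factorization[OF hol(2) w1, of z]) (rule that)
    obtain n' g' r' where f: "r' > 0" "g' holomorphic_on ball z r'" "\<And>w. w \<in> ball z r' \<Longrightarrow> f w = (w - z) ^ n' * g' w"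
      "\<And>w. w \<in> ball z r' \<Longrightarrow> g' w \<noteq> 0" "\<And>i. i < n' \<Longrightarrow> (deriv ^^ i) f z = 0" "(deriv ^^ n') f z \<noteq> 0"
      by (rule zero_factorization[OF hol(1) nz, of z]) (rule that)
    \<comment> \<open>If \<open>n\<close> were smaller than \<open>n'\<close>, all derivatives of
      \<open>f\<close> up to order \<open>n\<close> would vanish at \<open>z\<close>, and with them
      the \<open>n\<close>-th derivative of \<open>F\<close>.\<close>
    have "n' \<le> n" using zeros[of n z] F(6) f(5) by (meson le_less_trans not_le)
    have "isCont g z" "isCont g' z" "g' z \<noteq> 0"
      using F f holomorphic_on_imp_continuous_on continuous_on_eq_continuous_at[OF open_ball] centre_in_ball by metis+
    then have l1: "(\<lambda>w. (w - z) ^ (n - n') * g w / g' w) \<midarrow>z\<rightarrow> (z - z) ^ (n - n') * g z / g' z"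
      by (intro tendsto_intros) (auto simp: isCont_def)
    have l2: "\<forall>\<^sub>F w in at z. (w - z) ^ (n - n') * g w / g' w = ?q w"
    proof -
      have "\<forall>\<^sub>F w in at z. w \<in> ball z (min r r') - {z}"
        using F(1) f(1) by (intro eventually_at_in_open) auto
      then show ?thesis
      proof eventually_elim
        case (elim w)
        then show ?case using F(3)[of w] f(3,4)[of w] \<open>n' \<le> n\<close> by (auto simp: power_diff)
      qed
    qed
    show ?thesis by (rule exI, rule Lim_transform_eventually[OF l1 l2])
  qed
  show "remove_sings ?q holomorphic_on UNIV"
  proof -
    have "remove_sings ?q analytic_on {z}" for z
    proof -
      have "?q meromorphic_on {z}" by (rule meromorphic_on_subset[OF mero]) simp
      then show ?thesis using lim[of z] remove_sings_analytic_at meromorphic_on_isolated_singularity by blast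
    qed
    then show ?thesis by (metis UNIV_I analytic_imp_holomorphic analytic_on_analytic_at)
  qed
  fix w
  show "F w = f w * remove_sings ?q w"
  proof (cases "f w = 0")
    case True
    then show ?thesis using zeros[of 0 w] by simp
  next
    case False
    have "F analytic_on {w}" "f analytic_on {w}"
      using hol by (auto simp: analytic_at intro!: exI[of _ UNIV])
    then have "?q analytic_on {w}" using False by (intro analytic_intros) auto
    then show ?thesis using False by simp
  qed
qed

section \<open>Completeness\<close>

text \<open>The \<open>n\<close>-th derivative of \<open>exp (c * w)\<close> with respect to
  \<open>w\<close>.\<close>

definition exp_mono :: "nat \<Rightarrow> complex \<Rightarrow> complex \<Rightarrow> complex" where
  "exp_mono n c w = c ^ n * exp (c * w)"

lemma exp_mono_derivative: "(exp_mono n c has_field_derivative exp_mono (Suc n) c w) (at w)"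
  unfolding exp_mono_def[abs_def] by (auto intro!: derivative_eq_intros)

lemma exp_mono_vector_derivative:
  "((\<lambda>x. exp_mono n (b * of_real x + c) w) has_vector_derivative
    b * (of_nat n * exp_mono (n - 1) (b * of_real x + c) w + w * exp_mono n (b * of_real x + c) w)) (at x)"
proof -
  have "((\<lambda>z. exp_mono n (b * z + c) w) has_field_derivative
      b * (of_nat n * exp_mono (n - 1) (b * of_real x + c) w + w * exp_mono n (b * of_real x + c) w)) (at (of_real x))"
    unfolding exp_mono_def by (auto intro!: derivative_eq_intros simp: algebra_simps)
  from has_vector_derivative_real_field[OF this] show ?thesis by simp
qed

lemma continuous_exp_mono [continuous_intros]:
  "continuous_on S f \<Longrightarrow> continuous_on S (\<lambda>x. exp_mono n (f x) w)"
  unfolding exp_mono_def by (intro continuous_intros)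

lemma axis_continuous: "continuous_on S c \<Longrightarrow> continuous_on S (\<lambda>x. c x *s (axis k 1 :: complex ^ 'n::finite))"
  by (auto simp: vector_scalar_mult_def intro!: continuous_intros)

lemma norm_smult_axis: "norm (c *s (axis k 1 :: complex ^ 'n::finite)) = norm c"
proof -
  have "norm (axis k 1 :: complex ^ 'n) = 1"
    by (simp add: norm_eq_sqrt_inner inner_axis_axis)
  then show ?thesis by (simp add: norm_smult_vec)
qed

lemma axis_L2: "continuous_on {0..1} c \<Longrightarrow> (\<lambda>x. c x *s (axis k 1 :: complex ^ 'n::finite)) \<in> L2"
  by (intro L2_continuous axis_continuous)

lemma DERIV_quadratic:
  fixes f :: "complex \<Rightarrow> complex"
  assumes "\<And>h. norm h \<le> 1 \<Longrightarrow> norm (f (w + h) - f w - h * D) \<le> C * (norm h)\<^sup>2"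
  shows "(f has_field_derivative D) (at w)"
  unfolding DERIV_def
proof (rule LIM_zero_cancel, rule Lim_null_comparison)
  have "\<forall>\<^sub>F h :: complex in at 0. h \<in> ball 0 1 - {0}" by (rule eventually_at_in_open) auto
  then show "\<forall>\<^sub>F h in at 0. norm ((f (w + h) - f w) / h - D) \<le> C * norm h"
  proof eventually_elim
    case (elim h)
    then have "(f (w + h) - f w) / h - D = (f (w + h) - f w - h * D) / h" by (simp add: field_simps)
    then have "norm ((f (w + h) - f w) / h - D) = norm (f (w + h) - f w - h * D) / norm h"
      by (simp only: norm_divide)
    also have "\<dots> \<le> C * (norm h)\<^sup>2 / norm h" by (intro divide_right_mono assms) (use elim in auto)
    finally show ?case using elim by (simp add: power2_eq_square)
  qed
  show "((\<lambda>h. C * norm h) \<longlongrightarrow> 0) (at (0::complex))" by (auto intro!: tendsto_eq_intros)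
qed

text \<open>An abstract \<open>l\<close> is not an integral, so differentiation is passed through it
  by norm continuity: by Taylor's formula for \<open>exp\<close> the remainder is quadratic in
  \<open>h\<close> uniformly on [0,1], hence in the \<open>L2_norm\<close>.\<close>

lemma L2_functional_exp_derivative:
  fixes \<phi> :: "real \<Rightarrow> complex" and k :: "'n::finite"
  assumes l: "L2_functional l" and \<phi>: "continuous_on {0..1} \<phi>"
  shows "((\<lambda>w. l (\<lambda>x. exp_mono n (\<phi> x) w *s axis k 1)) has_field_derivative
      l (\<lambda>x. exp_mono (Suc n) (\<phi> x) w *s axis k 1)) (at w)"
proof -
  obtain K where K: "K \<ge> 0" "\<forall>f\<in>L2. norm (l f) \<le> K * L2_norm f"
    using l unfolding L2_functional_def by blast
  obtain R where R: "R \<ge> 0" "\<And>x. x \<in> {0..1} \<Longrightarrow> norm (\<phi> x) \<le> R"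
  proof -
    have "bounded (\<phi> ` {0..1})" using \<phi> by (intro compact_imp_bounded compact_continuous_image) auto
    then obtain R where "\<forall>y\<in>\<phi> ` {0..1}. norm y \<le> R" by (auto simp: bounded_iff)
    then show thesis by (intro that[of "max R 0"]) (auto intro: max.coboundedI1)
  qed
  let ?e = "\<lambda>n w x. exp_mono n (\<phi> x) w *s (axis k 1 :: complex ^ 'n)"
  have eL: "?e n w \<in> L2" for n w by (intro axis_L2 continuous_intros \<phi>)
  define C where "C = R ^ n * exp (R * norm w) * (R\<^sup>2 * exp R)"
  have C: "C \<ge> 0" using R by (simp add: C_def)
  have bound: "norm (exp_mono n (\<phi> x) (w + h) - exp_mono n (\<phi> x) w - h * exp_mono (Suc n) (\<phi> x) w) \<le> C * (norm h)\<^sup>2"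
    if x: "x \<in> {0..1}" and h: "norm h \<le> 1" for x h
  proof -
    have hR: "norm (\<phi> x * h) \<le> R" using mult_mono[OF R(2)[OF x] h] R by (simp add: norm_mult)
    have "norm (exp (\<phi> x * h) - (\<Sum>i\<le>1. (\<phi> x * h) ^ i / fact i)) \<le> exp \<bar>Re (\<phi> x * h)\<bar> * (norm (\<phi> x * h)) ^ Suc 1 / fact 1"
      by (rule Taylor_exp)
    also have "\<dots> = exp \<bar>Re (\<phi> x * h)\<bar> * (norm (\<phi> x * h))\<^sup>2" by (simp add: power2_eq_square)
    also have "\<dots> \<le> exp R * (R * norm h)\<^sup>2"
    proof (intro mult_mono power_mono)
      show "exp \<bar>Re (\<phi> x * h)\<bar> \<le> exp R" using abs_Re_le_cmod[of "\<phi> x * h"] hR by simp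
      show "norm (\<phi> x * h) \<le> R * norm h" using R(2)[OF x] by (simp add: norm_mult mult_right_mono)
    qed auto
    finally have T: "norm (exp (\<phi> x * h) - 1 - \<phi> x * h) \<le> R\<^sup>2 * exp R * (norm h)\<^sup>2"
      by (simp add: power_mult_distrib mult_ac diff_diff_eq)
    have "Re (\<phi> x * w) \<le> R * norm w"
      using complex_Re_le_cmod[of "\<phi> x * w"] mult_right_mono[OF R(2)[OF x], of "norm w"] by (simp add: norm_mult)
    then have E: "norm (\<phi> x ^ n * exp (\<phi> x * w)) \<le> R ^ n * exp (R * norm w)"
      unfolding norm_mult norm_power by (intro mult_mono power_mono R x) (use R in auto)
    have "exp_mono n (\<phi> x) (w + h) - exp_mono n (\<phi> x) w - h * exp_mono (Suc n) (\<phi> x) w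
        = (\<phi> x ^ n * exp (\<phi> x * w)) * (exp (\<phi> x * h) - 1 - \<phi> x * h)"
      by (simp add: exp_mono_def exp_add algebra_simps)
    then show ?thesis
      using mult_mono[OF E T] R by (simp add: C_def norm_mult mult.assoc)
  qed
  show ?thesis
  proof (rule DERIV_quadratic[where C = "K * C"])
    fix h :: complex assume h: "norm h \<le> 1"
    let ?r = "\<lambda>x. ?e n (w + h) x - ?e n w x - h *s ?e (Suc n) w x"
    have rL: "?r \<in> L2" by (intro L2_diff L2_scale eL)
    have "l ?r = l (\<lambda>x. ?e n (w + h) x - ?e n w x) - l (\<lambda>x. h *s ?e (Suc n) w x)"
      by (rule L2_functional_diff[OF l]) (intro L2_diff L2_scale eL)+
    also have "\<dots> = l (?e n (w + h)) - l (?e n w) - h * l (?e (Suc n) w)"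
      by (simp only: L2_functional_diff[OF l eL eL] L2_functional_scale[OF l eL])
    finally have "norm (l (?e n (w + h)) - l (?e n w) - h * l (?e (Suc n) w)) \<le> K * L2_norm ?r"
      using bspec[OF K(2) rL] by simp
    also have "L2_norm ?r \<le> C * (norm h)\<^sup>2"
    proof (rule L2_norm_le_sup[OF rL])
      fix x :: real assume x: "x \<in> {0..1}"
      have eq: "?r x = (exp_mono n (\<phi> x) (w + h) - exp_mono n (\<phi> x) w - h * exp_mono (Suc n) (\<phi> x) w) *s axis k 1"
        by (simp add: vec_eq_iff algebra_simps)
      show "norm (?r x) \<le> C * (norm h)\<^sup>2"
        using bound[OF x h] unfolding eq norm_smult_axis by simp
    qed (use C in auto)
    finally show "norm (l (?e n (w + h)) - l (?e n w) - h * l (?e (Suc n) w)) \<le> K * C * (norm h)\<^sup>2"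
      using K(1) by (simp add: mult.assoc mult_left_mono)
  qed
qed

section \<open>Solutions depending on the spectral parameter and their Jordan chains\<close>

text \<open>Up to sign, \<open>bvp_sol b1 b2 C D i 0 w\<close> is the solution of \<open>L y = - \<i> w y\<close> that arises from a
  column of the adjugate of the characteristic matrix; \<open>bvp_sol b1 b2 C D i n w\<close> is its \<open>n\<close>-th
  derivative with respect to \<open>w\<close>, and \<open>bvp_det b1 b2 C D n\<close> is the \<open>n\<close>-th derivative of the
  characteristic determinant.\<close>

definition bvp_sol :: "complex \<Rightarrow> complex \<Rightarrow> complex^2^2 \<Rightarrow> complex^2^2 \<Rightarrow> 2 \<Rightarrow> nat \<Rightarrow> complex \<Rightarrow> 2 vfun" where
  "bvp_sol b1 b2 C D i n w x =
     (C$i$2 * exp_mono n (b1 * of_real x) w + D$i$2 * exp_mono n (b1 * of_real x + b2) w) *s axis 1 1 -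
     (C$i$1 * exp_mono n (b2 * of_real x) w + D$i$1 * exp_mono n (b2 * of_real x + b1) w) *s axis 2 1"

definition bvp_det :: "complex \<Rightarrow> complex \<Rightarrow> complex^2^2 \<Rightarrow> complex^2^2 \<Rightarrow> nat \<Rightarrow> complex \<Rightarrow> complex" where
  "bvp_det b1 b2 C D n w =
     (C$1$1 * C$2$2 - C$1$2 * C$2$1) * exp_mono n 0 w + (C$1$1 * D$2$2 - D$1$2 * C$2$1) * exp_mono n b2 w +
     (D$1$1 * C$2$2 - C$1$2 * D$2$1) * exp_mono n b1 w + (D$1$1 * D$2$2 - D$1$2 * D$2$1) * exp_mono n (b1 + b2) w"

lemma bvp_sol_nth:
  "bvp_sol b1 b2 C D i n w x $ 1 = C$i$2 * exp_mono n (b1 * of_real x) w + D$i$2 * exp_mono n (b1 * of_real x + b2) w"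
  "bvp_sol b1 b2 C D i n w x $ 2 = - (C$i$1 * exp_mono n (b2 * of_real x) w + D$i$1 * exp_mono n (b2 * of_real x + b1) w)"
  by (simp_all add: bvp_sol_def axis_def)

text \<open>For \<open>n = 0\<close> a row of the characteristic matrix meets a column of the
  adjugate: component \<open>i\<close> of the boundary form is 0 and the other one is the
  determinant up to sign. Differentiating \<open>n\<close> times in \<open>w\<close> gives the
  rest.\<close>

lemma bvp_sol_boundary:
  assumes "bvp_det b1 b2 C D n w = 0"
  shows "C *v bvp_sol b1 b2 C D i n w 0 + D *v bvp_sol b1 b2 C D i n w 1 = 0"
  using assms exhaust_2[of i]
  by (auto simp: vec_eq_iff forall_2 matrix_vector_mult_def sum_2 bvp_sol_nth bvp_det_def algebra_simps)

lemma diag2_mult: "(diag2 p q *v v) $ 1 = p * v $ 1" "(diag2 p q *v v) $ 2 = q * v $ 2"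
  by (simp_all add: diag2_def matrix_vector_mult_def sum_2)

abbreviation (input) bvp_op :: "complex \<Rightarrow> complex \<Rightarrow> complex^2^2 \<Rightarrow> complex^2^2 \<Rightarrow> 2 operator" where
  "bvp_op b1 b2 C D \<equiv> L_op (diag2 (inverse b1) (inverse b2)) C D"

lemma L_opI:
  assumes "f \<in> L2" "h \<in> L2" "W12_deriv f y'" "C *v f 0 + D *v f 1 = 0" "\<And>x. (- \<i>) *s (B *v y' x) = h x"
  shows "(f, h) \<in> L_op B C D"
  unfolding L_op_def mem_Collect_eq prod.case ae_eq_def
  by (intro conjI assms(1,2), rule exI[of _ f], rule exI[of _ y'], intro conjI assms(3,4) AE_I2 refl assms(5)[symmetric])

text \<open>Differentiating \<open>L y = - \<i> w y\<close> in \<open>w\<close> by Leibniz' rule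
  adds \<open>n\<close> times the previous derivative; for \<open>n = 0\<close> the factor
  \<open>of_nat n\<close> removes the term at \<open>n - 1\<close>. The scalar \<open>c\<close> is
  carried along to absorb the factors that accumulate in a Jordan chain.\<close>

lemma bvp_sol_L_op:
  fixes C D :: "complex^2^2"
  assumes b: "b1 \<noteq> 0" "b2 \<noteq> 0" and det: "bvp_det b1 b2 C D n w = 0"
  shows "(\<lambda>x. c *s bvp_sol b1 b2 C D i n w x,
          \<lambda>x. (- \<i> * c) *s (of_nat n *s bvp_sol b1 b2 C D i (n - 1) w x + w *s bvp_sol b1 b2 C D i n w x))
        \<in> bvp_op b1 b2 C D"
proof -
  let ?Y = "bvp_sol b1 b2 C D i"
  let ?y = "\<lambda>x. c *s ?Y n w x"
  let ?z = "\<lambda>x. of_nat n *s ?Y (n - 1) w x + w *s ?Y n w x"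
  let ?y' = "\<lambda>x. \<chi> k. c * (if k = 1 then b1 else b2) * ?z x $ k"
  have contv: "continuous_on {0..1} (\<lambda>x. ?Y n w x)" for n
    unfolding bvp_sol_def by (intro continuous_intros axis_continuous)
  have W: "W12_deriv ?y ?y'"
  proof (rule W12_deriv_smooth)
    show "((\<lambda>x. ?y x $ k) has_vector_derivative ?y' x $ k) (at x)" for k x
    proof -
      have d: "((\<lambda>x. exp_mono n (b * of_real x) w) has_vector_derivative
        b * (of_nat n * exp_mono (n - 1) (b * of_real x) w + w * exp_mono n (b * of_real x) w)) (at x)" for b
        using exp_mono_vector_derivative[of n b 0 w x] by simp
      have e: "((\<lambda>x. c * (P * exp_mono n (b * of_real x) w + Q * exp_mono n (b * of_real x + a) w)) has_vector_derivative
          c * (P * (b * (of_nat n * exp_mono (n - 1) (b * of_real x) w + w * exp_mono n (b * of_real x) w)) +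
            Q * (b * (of_nat n * exp_mono (n - 1) (b * of_real x + a) w + w * exp_mono n (b * of_real x + a) w)))) (at x)"
        for P Q b a
        by (rule has_vector_derivative_mult_right[OF has_vector_derivative_add[OF has_vector_derivative_mult_right[OF d]
              has_vector_derivative_mult_right[OF exp_mono_vector_derivative]]])
      consider "k = 1" | "k = 2" using exhaust_2[of k] by blast
      then show ?thesis
      proof cases
        case 1
        then show ?thesis using e[of "C$i$2" b1 "D$i$2" b2] by (simp add: bvp_sol_nth algebra_simps)
      next
        case 2
        then show ?thesis using e[of "- C$i$1" b2 "- D$i$1" b1] by (simp add: bvp_sol_nth algebra_simps)
      qed
    qed
    show "continuous_on {0..1} (\<lambda>x. ?y' x $ k)" for k
      using exhaust_2[of k] by (auto intro!: continuous_intros contv)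
  qed
  have "(- \<i>) *s (diag2 (inverse b1) (inverse b2) *v ?y' x) = (- \<i> * c) *s ?z x" for x
    using b by (simp add: vec_eq_iff forall_2 diag2_mult field_simps)
  moreover have "C *v ?y 0 + D *v ?y 1 = 0"
    using bvp_sol_boundary[OF det, of i] by (simp add: vector_scalar_commute flip: vec.scale_right_distrib)
  moreover have "?y \<in> L2" "(\<lambda>x. (- \<i> * c) *s ?z x) \<in> L2"
    by (intro L2_scale L2_add L2_continuous contv)+
  ultimately show ?thesis by (intro L_opI[OF _ _ W]) auto
qed

lemma op_shiftI: "(f, h) \<in> T \<Longrightarrow> (\<lambda>x. h x - \<mu> *s f x) = g \<Longrightarrow> (f, g) \<in> op_shift T \<mu>"
  unfolding op_shift_def by blast

text \<open>The derivatives form a Jordan chain: the operator shifted by \<open>- \<i> * w\<close>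
  lowers the order by one, up to a factor. Powers are taken on their natural domain, so every member
  of the chain must satisfy the boundary conditions; hence all derivatives of the determinant up to
  order \<open>n\<close> have to vanish.\<close>

lemma bvp_sol_root:
  fixes C D :: "complex^2^2"
  assumes b: "b1 \<noteq> 0" "b2 \<noteq> 0" and det: "\<And>j. j \<le> n \<Longrightarrow> bvp_det b1 b2 C D j w = 0"
  shows "(\<lambda>x. c *s bvp_sol b1 b2 C D i n w x)
    \<in> op_kernel (op_shift (bvp_op b1 b2 C D) (- \<i> * w) ^^ Suc n)"
  using det
proof (induction n arbitrary: c)
  case 0
  have "(\<lambda>x. c *s bvp_sol b1 b2 C D i 0 w x, \<lambda>x. 0) \<in> op_shift (bvp_op b1 b2 C D) (- \<i> * w)"
    using bvp_sol_L_op[OF b 0[OF order_refl], of c i] by (rule op_shiftI) (simp add: vec_eq_iff fun_eq_iff)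
  then show ?case unfolding op_kernel_def by (auto simp: ae_eq_def)
next
  case (Suc n)
  let ?S = "op_shift (bvp_op b1 b2 C D) (- \<i> * w)"
  let ?c = "- \<i> * c * of_nat (Suc n)"
  have "(\<lambda>x. c *s bvp_sol b1 b2 C D i (Suc n) w x, \<lambda>x. ?c *s bvp_sol b1 b2 C D i n w x) \<in> ?S"
    using bvp_sol_L_op[OF b Suc.prems[OF order_refl], of c i]
    by (rule op_shiftI) (simp add: vec_eq_iff fun_eq_iff algebra_simps)
  moreover obtain g where "((\<lambda>x. ?c *s bvp_sol b1 b2 C D i n w x), g) \<in> ?S ^^ Suc n" "ae_eq g (\<lambda>x. 0)"
    using Suc.IH[of ?c] Suc.prems by (auto simp: op_kernel_def)
  ultimately show ?case unfolding op_kernel_def by (blast intro: relpow_Suc_I2)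
qed

lemma not_ae_unit: "\<not> (AE x in unit_lebesgue. False)"
proof
  assume "AE x in unit_lebesgue. False"
  from AE_E[OF this] obtain N where "{x \<in> space unit_lebesgue. \<not> False} \<subseteq> N"
    "emeasure unit_lebesgue N = 0" "N \<in> sets unit_lebesgue" .
  moreover have "{x \<in> space unit_lebesgue. \<not> False} = {0..1}" by auto
  ultimately have "emeasure unit_lebesgue {0..1} = 0"
    using emeasure_mono[of "{0..1}" N unit_lebesgue] by simp
  moreover have "measure unit_lebesgue {0..1} = 1" by (rule measure_unit_lebesgue_UNIV)
  ultimately show False by (simp add: measure_def)
qed

text \<open>A column of the adjugate may vanish at a zero of the determinant. The eigenfunction is
  therefore built from a kernel vector of the characteristic matrix \<open>M\<close>; it vanishes at
  no point.\<close>

lemma bvp_eigenvalue: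
  fixes C D :: "complex^2^2"
  assumes b: "b1 \<noteq> 0" "b2 \<noteq> 0" and det: "bvp_det b1 b2 C D 0 w = 0"
  shows "op_eigenvalue (bvp_op b1 b2 C D) (- \<i> * w)"
proof -
  define M where "M = C + D ** diag2 (exp (b1 * w)) (exp (b2 * w))"
  have "det M = bvp_det b1 b2 C D 0 w"
    by (simp add: M_def det_2 bvp_det_def exp_mono_def matrix_matrix_mult_def sum_2 diag2_def exp_add algebra_simps)
  then have "\<not> invertible M" using det by (simp add: invertible_det_nz)
  then obtain v where v: "M *v v = 0" "v \<noteq> 0"
    unfolding invertible_left_inverse matrix_left_invertible_ker by blast
  define y where "y x = (\<chi> k. v $ k * exp ((if k = 1 then b1 else b2) * of_real x * w))" for x :: real
  define y' where "y' x = (\<chi> k. (if k = 1 then b1 else b2) * w * y x $ k)" for x :: real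
  have cont: "continuous_on {0..1} y"
    unfolding y_def by (intro continuous_on_vec_lambda continuous_intros)
  have W: "W12_deriv y y'"
  proof (rule W12_deriv_smooth)
    show "((\<lambda>x. y x $ k) has_vector_derivative y' x $ k) (at x)" for k x
    proof -
      have "((\<lambda>z. v $ k * exp ((if k = 1 then b1 else b2) * z * w)) has_field_derivative y' x $ k) (at (of_real x))"
        by (auto simp: y_def y'_def intro!: derivative_eq_intros)
      from has_vector_derivative_real_field[OF this] show ?thesis by (simp add: y_def)
    qed
    show "continuous_on {0..1} (\<lambda>x. y' x $ k)" for k using exhaust_2[of k] by (auto simp: y'_def intro!: continuous_intros cont)
  qed
  have yL: "y \<in> L2" by (rule L2_continuous[OF cont])
  have "(y, \<lambda>x. (- \<i> * w) *s y x) \<in> bvp_op b1 b2 C D"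
  proof -
    have "(- \<i>) *s (diag2 (inverse b1) (inverse b2) *v y' x) = (- \<i> * w) *s y x" for x
      using b by (simp add: vec_eq_iff forall_2 diag2_mult y'_def)
    moreover have "C *v y 0 + D *v y 1 = 0"
      using v(1) by (simp add: M_def y_def vec_eq_iff forall_2 matrix_vector_mult_def matrix_matrix_mult_def sum_2 diag2_def algebra_simps)
    ultimately show ?thesis by (intro L_opI[OF yL L2_scale[OF yL] W]) auto
  qed
  then have "(y, \<lambda>x. 0) \<in> op_shift (bvp_op b1 b2 C D) (- \<i> * w)"
    by (rule op_shiftI) simp
  then have "y \<in> op_kernel (op_shift (bvp_op b1 b2 C D) (- \<i> * w))"
    unfolding op_kernel_def by (auto simp: ae_eq_def)
  moreover have "\<not> ae_eq y (\<lambda>x. 0)"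
  proof
    assume "ae_eq y (\<lambda>x. 0)"
    moreover have "y x \<noteq> 0" for x using v(2) by (auto simp: y_def vec_eq_iff)
    ultimately show False using not_ae_unit by (simp add: ae_eq_def)
  qed
  ultimately show ?thesis unfolding op_eigenvalue_def by blast
qed

lemma bvp_sol_root_function:
  fixes C D :: "complex^2^2"
  assumes b: "b1 \<noteq> 0" "b2 \<noteq> 0" and det: "\<And>j. j \<le> n \<Longrightarrow> bvp_det b1 b2 C D j w = 0"
  shows "bvp_sol b1 b2 C D i n w \<in> root_functions (bvp_op b1 b2 C D)"
proof -
  have "bvp_sol b1 b2 C D i n w \<in> op_kernel (op_shift (bvp_op b1 b2 C D) (- \<i> * w) ^^ Suc n)"
    using bvp_sol_root[OF b det, of n 1 i] by simp
  then have "bvp_sol b1 b2 C D i n w \<in> root_subspace (bvp_op b1 b2 C D) (- \<i> * w)"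
    unfolding root_subspace_def by (intro lin_span_superset UN_I[of "Suc n"]) auto
  moreover have "op_eigenvalue (bvp_op b1 b2 C D) (- \<i> * w)"
    by (rule bvp_eigenvalue[OF b det]) simp
  ultimately show ?thesis unfolding root_functions_def by blast
qed

section \<open>Asymptotics along rays\<close>

lemma exp_ray_tendsto_0: "Re c < 0 \<Longrightarrow> ((\<lambda>t. exp (c * of_real t)) \<longlongrightarrow> 0) at_top"
proof (rule tendsto_norm_zero_cancel)
  assume "Re c < 0"
  then have "((\<lambda>t. exp (Re c * t)) \<longlongrightarrow> 0) at_top" by real_asymp
  then show "((\<lambda>t. norm (exp (c * of_real t))) \<longlongrightarrow> 0) at_top" by simp
qed

text \<open>Along the ray through \<open>p\<close>, the exponential with frequency \<open>dom_freq b1 b2 p\<close> dominates the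
  other exponentials of the characteristic determinant, and \<open>dom_coeff b1 b2 C D p\<close> is its coefficient.\<close>

definition dom_freq :: "complex \<Rightarrow> complex \<Rightarrow> complex \<Rightarrow> complex" where
  "dom_freq b1 b2 p = of_bool (Re (b1 * p) \<ge> 0) * b1 + of_bool (Re (b2 * p) \<ge> 0) * b2"

definition dom_coeff :: "complex \<Rightarrow> complex \<Rightarrow> complex^2^2 \<Rightarrow> complex^2^2 \<Rightarrow> complex \<Rightarrow> complex" where
  "dom_coeff b1 b2 C D p =
     (let X = (if Re (b1 * p) < 0 then C else D); Y = (if Re (b2 * p) < 0 then C else D)
      in X$1$1 * Y$2$2 - Y$1$2 * X$2$1)"

abbreviation (input) damp :: "complex \<Rightarrow> complex \<Rightarrow> complex \<Rightarrow> real \<Rightarrow> complex" where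
  "damp b1 b2 p t \<equiv> exp (- dom_freq b1 b2 p * (of_real t * p))"

text \<open>One parameter square for all exponentials that occur: its corners give the terms of the
  determinant, its edges the terms of the solutions at points of [0,1].\<close>

abbreviation (input) scaled_exp :: "complex \<Rightarrow> complex \<Rightarrow> complex \<Rightarrow> real \<Rightarrow> real \<Rightarrow> real \<Rightarrow> complex" where
  "scaled_exp b1 b2 p u v t \<equiv> exp_mono 0 (of_real u * b1 + of_real v * b2) (of_real t * p) * damp b1 b2 p t"

lemma scaled_exp_eq:
  "scaled_exp b1 b2 p u v t =
   exp ((of_real (u - of_bool (Re (b1 * p) \<ge> 0)) * (b1 * p) + of_real (v - of_bool (Re (b2 * p) \<ge> 0)) * (b2 * p)) * of_real t)"
  by (simp add: exp_mono_def dom_freq_def algebra_simps flip: exp_add)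

lemma of_bool_sign_le:
  fixes r u :: real
  assumes "0 \<le> u" "u \<le> 1"
  shows "(u - of_bool (r \<ge> 0)) * r \<le> 0"
  using assms by (auto simp: mult_le_0_iff)

lemma of_bool_sign_less:
  fixes r u :: real
  assumes "0 < u" "u < 1" "r \<noteq> 0"
  shows "(u - of_bool (r \<ge> 0)) * r < 0"
  using assms by (auto simp: mult_less_0_iff)

text \<open>The real part of the exponent is affine in \<open>u\<close> and in \<open>v\<close>, and
  \<open>dom_freq\<close> is the corner of the square where it is maximal.\<close>

lemma scaled_exp_le:
  assumes "u \<in> {0..1}" "v \<in> {0..1}" "t \<ge> 0"
  shows "norm (scaled_exp b1 b2 p u v t) \<le> 1"
proof -
  have "0 \<le> u" "u \<le> 1" "0 \<le> v" "v \<le> 1" using assms by auto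
  then have "((u - of_bool (Re (b1 * p) \<ge> 0)) * Re (b1 * p) + (v - of_bool (Re (b2 * p) \<ge> 0)) * Re (b2 * p)) * t \<le> 0"
    by (intro mult_nonpos_nonneg[OF add_nonpos_nonpos] of_bool_sign_le assms(3))
  moreover have "Re ((of_real r * x + of_real s * y) * of_real t) = (r * Re x + s * Re y) * t" for r s x y
    by simp
  ultimately show ?thesis unfolding scaled_exp_eq norm_exp_eq_Re by simp
qed

text \<open>Each disjunct of the last hypothesis puts \<open>(u, v)\<close> off the dominating
  corner, where the real part of the exponent is strictly negative; inner values of a coordinate are
  listed because solutions at inner points of [0,1] produce them.\<close>

lemma scaled_exp_tendsto:
  assumes uv: "u \<in> {0..1}" "v \<in> {0..1}" and p: "Re (b1 * p) \<noteq> 0" "Re (b2 * p) \<noteq> 0"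
    and "(0 < u \<and> u < 1) \<or> (0 < v \<and> v < 1)
      \<or> (u \<noteq> of_bool (Re (b1 * p) \<ge> 0)) \<or> (v \<noteq> of_bool (Re (b2 * p) \<ge> 0))"
  shows "((\<lambda>t. scaled_exp b1 b2 p u v t) \<longlongrightarrow> 0) at_top"
  unfolding scaled_exp_eq
proof (rule exp_ray_tendsto_0)
  have 1: "(u - of_bool (Re (b1 * p) \<ge> 0)) * Re (b1 * p) \<le> 0" "(v - of_bool (Re (b2 * p) \<ge> 0)) * Re (b2 * p) \<le> 0"
    using uv of_bool_sign_le[of u "Re (b1 * p)"] of_bool_sign_le[of v "Re (b2 * p)"]
    by (simp_all del: times_complex.sel mult_le_0_iff)
  have 2: "(u - of_bool (Re (b1 * p) \<ge> 0)) * Re (b1 * p) \<noteq> 0 \<or> (v - of_bool (Re (b2 * p) \<ge> 0)) * Re (b2 * p) \<noteq> 0"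
    using assms(3-5) of_bool_sign_less[of u "Re (b1 * p)"] of_bool_sign_less[of v "Re (b2 * p)"] by auto
  have "Re (of_real r * x + of_real s * y) = r * Re x + s * Re y" for r s x y by simp
  then show "Re (of_real (u - of_bool (Re (b1 * p) \<ge> 0)) * (b1 * p) + of_real (v - of_bool (Re (b2 * p) \<ge> 0)) * (b2 * p)) < 0"
    using 1 2 by (simp only:) linarith
qed

lemma bvp_det_ray:
  assumes p: "Re (b1 * p) \<noteq> 0" "Re (b2 * p) \<noteq> 0"
  shows "((\<lambda>t. bvp_det b1 b2 C D 0 (of_real t * p) * damp b1 b2 p t)
    \<longlongrightarrow> dom_coeff b1 b2 C D p) at_top"
proof -
  define E where "E u v = (\<lambda>t. scaled_exp b1 b2 p u v t)" for u v :: real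
  have lim: "(E u v \<longlongrightarrow> of_bool (u = of_bool (Re (b1 * p) \<ge> 0) \<and> v = of_bool (Re (b2 * p) \<ge> 0))) at_top"
    if "u \<in> {0, 1}" "v \<in> {0, 1}" for u v
  proof (cases "u = of_bool (Re (b1 * p) \<ge> 0) \<and> v = of_bool (Re (b2 * p) \<ge> 0)")
    case True
    then have "E u v = (\<lambda>t. 1)" unfolding E_def scaled_exp_eq by simp
    then show ?thesis using True by simp
  next
    case False
    then have "(E u v \<longlongrightarrow> 0) at_top" unfolding E_def by (intro scaled_exp_tendsto p) (use that in auto)
    then show ?thesis by (simp only: False of_bool_eq)
  qed
  have eq: "bvp_det b1 b2 C D 0 (of_real t * p) * damp b1 b2 p t =
      (C$1$1 * C$2$2 - C$1$2 * C$2$1) * E 0 0 t + (C$1$1 * D$2$2 - D$1$2 * C$2$1) * E 0 1 t +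
     (D$1$1 * C$2$2 - C$1$2 * D$2$1) * E 1 0 t + (D$1$1 * D$2$2 - D$1$2 * D$2$1) * E 1 1 t" for t
    unfolding bvp_det_def E_def by (simp add: distrib_right mult.assoc)
  note L = tendsto_mult_left[OF lim]
  show ?thesis unfolding eq
    by (rule tendsto_eq_rhs[OF tendsto_add[OF tendsto_add[OF tendsto_add[OF L L] L] L]]; (simp; fail)?)
      (cases "Re (b1 * p) < 0"; cases "Re (b2 * p) < 0"; simp add: dom_coeff_def Let_def del: times_complex.sel)+
qed

text \<open>The scalar \<open>s\<close> is either the damping factor along a ray or 1, the latter
  for the growth in the whole plane.\<close>

lemma bvp_sol_norm_le:
  assumes "\<And>u v. u \<in> {0..1} \<Longrightarrow> v \<in> {0..1} \<Longrightarrow> norm (exp_mono 0 (of_real u * b1 + of_real v * b2) w * s) \<le> B"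
    and x: "x \<in> {0..1}"
  shows "norm (s *s bvp_sol b1 b2 C D i 0 w x) \<le> (norm (C$i$1) + norm (C$i$2) + norm (D$i$1) + norm (D$i$2)) * B"
proof -
  define E where "E u v = exp_mono 0 (of_real u * b1 + of_real v * b2) w * s" for u v :: real
  have E: "norm (E u v) \<le> B" if "u \<in> {0..1}" "v \<in> {0..1}" for u v using assms(1)[OF that] by (simp add: E_def)
  have "s *s bvp_sol b1 b2 C D i 0 w x =
      (C$i$2 * E x 0 + D$i$2 * E x 1) *s axis 1 1 - (C$i$1 * E 0 x + D$i$1 * E 1 x) *s axis 2 1"
    by (simp add: vec_eq_iff forall_2 bvp_sol_nth axis_def E_def algebra_simps)
  moreover have "norm (a *s axis 1 1 - b *s axis 2 1 :: complex ^ 2) \<le> norm a + norm b" for a b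
    using norm_triangle_ineq4[of "a *s axis 1 1 :: complex ^ 2" "b *s axis 2 1"] by (simp add: norm_smult_axis)
  ultimately have "norm (s *s bvp_sol b1 b2 C D i 0 w x) \<le> norm (C$i$2 * E x 0 + D$i$2 * E x 1) + norm (C$i$1 * E 0 x + D$i$1 * E 1 x)"
    by (simp only:)
  also have "\<dots> \<le> norm (C$i$2) * norm (E x 0) + norm (D$i$2) * norm (E x 1) + (norm (C$i$1) * norm (E 0 x) + norm (D$i$1) * norm (E 1 x))"
    by (intro add_mono order_trans[OF norm_triangle_ineq] eq_refl) (simp_all add: norm_mult)
  also have "\<dots> \<le> norm (C$i$2) * B + norm (D$i$2) * B + (norm (C$i$1) * B + norm (D$i$1) * B)"
    by (intro add_mono mult_left_mono E) (use x in auto)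
  finally show ?thesis by (simp add: algebra_simps)
qed

lemma bvp_sol_continuous: "continuous_on S (bvp_sol b1 b2 C D i n w)"
  unfolding bvp_sol_def[abs_def] by (intro continuous_intros axis_continuous)

text \<open>For \<open>0 < x < 1\<close> the frequencies of the solution at \<open>x\<close> lie
  inside the edges of the square, so all damped exponentials tend to 0, and they are bounded by 1.
  Dominated convergence, with the endpoints as a null set, gives convergence in the
  \<open>L2_norm\<close>; it works with sequences, hence the integer steps along the ray.\<close>

lemma bvp_sol_ray:
  fixes l :: "2 vfun \<Rightarrow> complex"
  assumes l: "L2_functional l" and p: "Re (b1 * p) \<noteq> 0" "Re (b2 * p) \<noteq> 0"
  shows "\<exists>B. \<forall>t\<ge>0. norm (l (bvp_sol b1 b2 C D i 0 (of_real t * p)) * damp b1 b2 p t) \<le> B"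
    and "(\<lambda>m. l (bvp_sol b1 b2 C D i 0 (of_real (real m) * p)) * damp b1 b2 p (real m)) \<longlonglongrightarrow> 0"
proof -
  define N where "N = norm (C$i$1) + norm (C$i$2) + norm (D$i$1) + norm (D$i$2)"
  have N: "N \<ge> 0" by (simp add: N_def)
  let ?s = "\<lambda>t. damp b1 b2 p t"
  let ?Y = "\<lambda>t. bvp_sol b1 b2 C D i 0 (of_real t * p)"
  have YL: "?Y t \<in> L2" for t by (rule L2_continuous[OF bvp_sol_continuous])
  have le: "norm (?s t *s ?Y t x) \<le> N" if "t \<ge> 0" "x \<in> {0..1}" for t x
    using bvp_sol_norm_le[of b1 b2 "of_real t * p" "?s t" 1 x C D i] scaled_exp_le that by (simp add: N_def)
  have eq: "l (?Y t) * ?s t = l (\<lambda>x. ?s t *s ?Y t x)" for t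
    unfolding L2_functional_scale[OF l YL] by (rule mult.commute)
  obtain K where K: "K \<ge> 0" "\<forall>f\<in>L2. norm (l f) \<le> K * L2_norm f"
    using l unfolding L2_functional_def by blast
  have "norm (l (?Y t) * ?s t) \<le> K * N" if "t \<ge> 0" for t
  proof -
    have "norm (l (?Y t) * ?s t) \<le> K * L2_norm (\<lambda>x. ?s t *s ?Y t x)"
      unfolding eq by (rule bspec[OF K(2) L2_scale[OF YL]])
    also have "\<dots> \<le> K * N" by (intro mult_left_mono L2_norm_le_sup L2_scale YL le that N K)
    finally show ?thesis .
  qed
  then show "\<exists>B. \<forall>t\<ge>0. norm (l (?Y t) * ?s t) \<le> B" by blast
  let ?g = "\<lambda>m::nat. \<lambda>x. ?s (real m) *s ?Y (real m) x"
  have zL: "(\<lambda>x. 0 :: complex ^ 2) \<in> L2" by (rule L2_continuous) simp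
  have lim: "(\<lambda>m. ?g m x) \<longlonglongrightarrow> 0" if x: "0 < x" "x < 1" for x
  proof (rule vec_tendstoI)
    fix k :: 2
    define E where "E u v = (\<lambda>m::nat. scaled_exp b1 b2 p u v (real m))" for u v :: real
    have E: "E u v \<longlonglongrightarrow> 0" if "u \<in> {0..1}" "v \<in> {0..1}" "0 < u \<and> u < 1 \<or> 0 < v \<and> v < 1" for u v
      unfolding E_def
      by (rule filterlim_compose[OF scaled_exp_tendsto filterlim_real_sequentially]) (use that p in auto)
    have "(\<lambda>m. C$i$2 * E x 0 m + D$i$2 * E x 1 m) \<longlonglongrightarrow> C$i$2 * 0 + D$i$2 * 0"
      "(\<lambda>m. - (C$i$1 * E 0 x m + D$i$1 * E 1 x m)) \<longlonglongrightarrow> - (C$i$1 * 0 + D$i$1 * 0)"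
      by (intro tendsto_intros E; use x in simp)+
    moreover have "?g m x $ 1 = C$i$2 * E x 0 m + D$i$2 * E x 1 m" "?g m x $ 2 = - (C$i$1 * E 0 x m + D$i$1 * E 1 x m)" for m
      by (simp_all add: bvp_sol_nth E_def algebra_simps)
    ultimately show "(\<lambda>m. ?g m x $ k) \<longlonglongrightarrow> 0 $ k"
      using exhaust_2[of k] by auto
  qed
  have "(\<lambda>m. L2_norm (\<lambda>x. 0 - ?g m x)) \<longlonglongrightarrow> 0"
  proof (rule L2_norm_tendsto_0[OF zL L2_scale[OF YL] integrable_const_unit[of "N\<^sup>2"]])
    have "AE x in unit_lebesgue. x \<notin> {0, 1}"
      by (rule AE_not_in) (simp add: null_sets_restrict_space null_sets_completionI)
    then show "AE x in unit_lebesgue. (\<lambda>m. ?g m x) \<longlonglongrightarrow> 0"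
      using AE_space
    proof eventually_elim
      case (elim x)
      then show ?case by (intro lim) auto
    qed
    show "(norm (0 - ?g m x))\<^sup>2 \<le> N\<^sup>2" if "x \<in> {0..1}" for m x
      using le[of "real m" x] that by (intro power_mono) auto
  qed
  then have lim0: "(\<lambda>m. K * L2_norm (\<lambda>x. 0 - ?g m x)) \<longlonglongrightarrow> 0"
    using tendsto_mult_left[of _ 0 _ K] by simp
  show "(\<lambda>m. l (?Y (real m)) * ?s (real m)) \<longlonglongrightarrow> 0"
  proof (rule Lim_null_comparison[OF _ lim0])
    have "norm (l (?Y (real m)) * ?s (real m)) \<le> K * L2_norm (\<lambda>x. 0 - ?g m x)" for m
    proof -
      have "L2_norm (\<lambda>x. 0 - ?g m x) = L2_norm (?g m)" by (simp add: L2_norm_def)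
      then show ?thesis unfolding eq using bspec[OF K(2) L2_scale[OF YL[of "real m"], of "?s (real m)"]] by simp
    qed
    then show "\<forall>\<^sub>F m in sequentially. norm (l (?Y (real m)) * ?s (real m)) \<le> K * L2_norm (\<lambda>x. 0 - ?g m x)" by simp
  qed
qed

section \<open>Functionals that vanish on all root functions\<close>

lemma bvp_functional_derivative:
  assumes l: "L2_functional l"
  shows "((\<lambda>w. l (bvp_sol b1 b2 C D i n w)) has_field_derivative l (bvp_sol b1 b2 C D i (Suc n) w)) (at w)"
proof -
  let ?e = "\<lambda>\<phi> k n w. l (\<lambda>x. exp_mono n (\<phi> x) w *s axis k 1)"
  let ?f = "\<lambda>n w. C$i$2 * ?e (\<lambda>x. b1 * of_real x) 1 n w + D$i$2 * ?e (\<lambda>x. b1 * of_real x + b2) 1 n w -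
    (C$i$1 * ?e (\<lambda>x. b2 * of_real x) 2 n w + D$i$1 * ?e (\<lambda>x. b2 * of_real x + b1) 2 n w)"
  have eq: "l (bvp_sol b1 b2 C D i n w) = ?f n w" for n w
  proof -
    have L: "(\<lambda>x. exp_mono n (b * of_real x + c) w *s axis k 1) \<in> L2" for b c and k :: 2
      by (intro axis_L2 continuous_intros)
    have L0: "(\<lambda>x. exp_mono n (b * of_real x) w *s axis k 1) \<in> L2" for b and k :: 2
      by (intro axis_L2 continuous_intros)
    have "bvp_sol b1 b2 C D i n w = (\<lambda>x.
       (C$i$2 *s (exp_mono n (b1 * of_real x) w *s axis 1 1) + D$i$2 *s (exp_mono n (b1 * of_real x + b2) w *s axis 1 1)) -
       (C$i$1 *s (exp_mono n (b2 * of_real x) w *s axis 2 1) + D$i$1 *s (exp_mono n (b2 * of_real x + b1) w *s axis 2 1)))"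
      by (rule ext) (simp add: vec_eq_iff bvp_sol_def algebra_simps)
    then show ?thesis
      by (simp only: L2_functional_diff[OF l] L2_functional_add[OF l] L2_functional_scale[OF l] L2_add L2_scale L L0)
  qed
  have "(?f n has_field_derivative ?f (Suc n) w) (at w)"
    by (intro DERIV_diff DERIV_add DERIV_cmult L2_functional_exp_derivative[OF l] continuous_intros)
  then show ?thesis by (simp only: eq)
qed

lemma higher_deriv_family:
  fixes F :: "nat \<Rightarrow> complex \<Rightarrow> complex"
  assumes "\<And>n w. (F n has_field_derivative F (Suc n) w) (at w)"
  shows "(deriv ^^ n) (F 0) = F n"
  by (induction n) (auto intro!: DERIV_imp_deriv assms)

lemma bvp_det_derivative: "(bvp_det b1 b2 C D n has_field_derivative bvp_det b1 b2 C D (Suc n) w) (at w)"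
  unfolding bvp_det_def[abs_def] by (intro DERIV_add DERIV_cmult exp_mono_derivative)

lemma holomorphic_UNIV_I: "(\<And>w. (f has_field_derivative f' w) (at w)) \<Longrightarrow> f holomorphic_on UNIV"
  by (auto simp: holomorphic_on_def field_differentiable_def)

lemma bvp_functional_zero:
  fixes C D :: "complex^2^2" and l :: "2 vfun \<Rightarrow> complex"
  assumes b: "b1 \<noteq> 0" "b2 \<noteq> 0" and ind: "b1 \<noteq> b2" "b1 + b2 \<noteq> 0"
    and rays: "\<And>p. p \<in> {p1, p2, p3} \<Longrightarrow> Re (b1 * p) \<noteq> 0 \<and> Re (b2 * p) \<noteq> 0 \<and> dom_coeff b1 b2 C D p \<noteq> 0"
    and pind: "Im (cnj p1 * p2) \<noteq> 0" and pos: "\<alpha>1 > 0" "\<alpha>2 > 0" "\<alpha>3 > 0"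
    and zero: "of_real \<alpha>1 * p1 + of_real \<alpha>2 * p2 + of_real \<alpha>3 * p3 = 0"
    and l: "L2_functional l"
    and van: "\<And>u. u \<in> root_functions (bvp_op b1 b2 C D) \<Longrightarrow> u \<in> L2 \<Longrightarrow> l u = 0"
  shows "l (bvp_sol b1 b2 C D i 0 w) = 0"
proof -
  define F where "F n w = l (bvp_sol b1 b2 C D i n w)" for n w
  let ?d = "bvp_det b1 b2 C D"
  have dF: "(F n has_field_derivative F (Suc n) w) (at w)" for n w
    unfolding F_def[abs_def] by (rule bvp_functional_derivative[OF l])
  have holF: "F 0 holomorphic_on UNIV" by (rule holomorphic_UNIV_I[OF dF])
  have hold: "?d 0 holomorphic_on UNIV" by (rule holomorphic_UNIV_I[OF bvp_det_derivative])
  have ray_nz: "\<exists>t0\<ge>0. \<exists>\<kappa>>0. \<forall>t\<ge>t0. \<kappa> \<le> norm (?d 0 (of_real t * p) * damp b1 b2 p t)"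
    if "p \<in> {p1, p2, p3}" for p
  proof -
    define \<kappa> where "\<kappa> = norm (dom_coeff b1 b2 C D p) / 2"
    have \<kappa>: "\<kappa> > 0" using rays[OF that] by (simp add: \<kappa>_def)
    have "((\<lambda>t. norm (?d 0 (of_real t * p) * damp b1 b2 p t)) \<longlongrightarrow> norm (dom_coeff b1 b2 C D p)) at_top"
      using rays[OF that] by (intro tendsto_norm bvp_det_ray) auto
    then have "\<forall>\<^sub>F t in at_top. \<kappa> < norm (?d 0 (of_real t * p) * damp b1 b2 p t)"
      using \<kappa> by (intro order_tendstoD(1)) (auto simp: \<kappa>_def)
    then obtain t0 where t0: "\<And>t. t \<ge> t0 \<Longrightarrow> \<kappa> < norm (?d 0 (of_real t * p) * damp b1 b2 p t)"
      by (auto simp: eventually_at_top_linorder)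
    show ?thesis
    proof (rule exI[of _ "max t0 0"], rule conjI, simp, rule exI[of _ \<kappa>], rule conjI[OF \<kappa>], intro allI impI)
      fix t assume "max t0 0 \<le> t"
      then show "\<kappa> \<le> norm (?d 0 (of_real t * p) * damp b1 b2 p t)"
        using t0[of t] by simp
    qed
  qed
  obtain t1 \<kappa>1 where t1: "t1 \<ge> 0" "\<kappa>1 > 0"
    "\<And>t. t \<ge> t1 \<Longrightarrow> \<kappa>1 \<le> norm (?d 0 (of_real t * p1) * damp b1 b2 p1 t)"
    using ray_nz[of p1] by auto
  \<comment> \<open>The dominating coefficient on a single ray already shows that the determinant is
    not identically 0.\<close>
  have nz: "?d 0 (of_real t1 * p1) \<noteq> 0" using t1(2) t1(3)[of t1] by auto
  \<comment> \<open>Divisibility: at a zero of the determinant of order greater than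
    \<open>k\<close>, the \<open>k\<close>-th derivative of the solution is a root function, on
    which \<open>l\<close> vanishes.\<close>
  have zeros: "(deriv ^^ k) (F 0) z = 0" if "\<And>j. j \<le> k \<Longrightarrow> (deriv ^^ j) (?d 0) z = 0" for k z
  proof -
    have "?d j z = 0" if "j \<le> k" for j
      using \<open>\<And>j. j \<le> k \<Longrightarrow> (deriv ^^ j) (?d 0) z = 0\<close>[OF that]
      by (simp add: higher_deriv_family[of ?d, OF bvp_det_derivative])
    then have "bvp_sol b1 b2 C D i k z \<in> root_functions (bvp_op b1 b2 C D)"
      by (rule bvp_sol_root_function[OF b])
    then have "F k z = 0" unfolding F_def by (rule van) (rule L2_continuous[OF bvp_sol_continuous])
    then show ?thesis by (simp add: higher_deriv_family[of F, OF dF])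
  qed
  obtain G where G: "G holomorphic_on UNIV" and FG: "\<And>w. F 0 w = ?d 0 w * G w"
    using entire_quotient[OF hold holF nz zeros] by blast
  obtain K where K: "K \<ge> 0" "\<forall>f\<in>L2. norm (l f) \<le> K * L2_norm f"
    using l unfolding L2_functional_def by blast
  define R where "R = norm b1 + norm b2"
  define N where "N = norm (C$i$1) + norm (C$i$2) + norm (D$i$1) + norm (D$i$2)"
  have growthF: "norm (F 0 w) \<le> K * N * exp (R * norm w)" for w
  proof -
    have E: "norm (exp_mono 0 (of_real u * b1 + of_real v * b2) w * 1) \<le> exp (R * norm w)"
      if "u \<in> {0..1}" "v \<in> {0..1}" for u v
    proof -
      have "norm (of_real u * b1 + of_real v * b2) \<le> u * norm b1 + v * norm b2"
        by (rule order_trans[OF norm_triangle_ineq]) (use that in \<open>simp add: norm_mult\<close>)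
      also have "\<dots> \<le> R" unfolding R_def
        by (intro add_mono mult_left_le_one_le) (use that in auto)
      finally have "norm ((of_real u * b1 + of_real v * b2) * w) \<le> R * norm w"
        unfolding norm_mult by (rule mult_right_mono) simp
      then have "Re ((of_real u * b1 + of_real v * b2) * w) \<le> R * norm w"
        using complex_Re_le_cmod order_trans by blast
      then show ?thesis unfolding exp_mono_def by (simp del: times_complex.sel)
    qed
    have YL: "bvp_sol b1 b2 C D i 0 w \<in> L2" by (rule L2_continuous[OF bvp_sol_continuous])
    have "norm (F 0 w) \<le> K * L2_norm (bvp_sol b1 b2 C D i 0 w)" unfolding F_def by (rule bspec[OF K(2) YL])
    also have "\<dots> \<le> K * (N * exp (R * norm w))"
    proof (intro mult_left_mono L2_norm_le_sup YL K)
      fix x :: real assume "x \<in> {0..1}"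
      then show "norm (bvp_sol b1 b2 C D i 0 w x) \<le> N * exp (R * norm w)"
        using bvp_sol_norm_le[of b1 b2 w 1 "exp (R * norm w)" x C D i, OF E] by (simp add: N_def)
    qed (simp add: N_def)
    finally show ?thesis by (simp add: mult.assoc)
  qed
  obtain A' K' where growthG: "\<And>w. norm (G w) \<le> A' * exp (K' * norm w)"
  proof -
    let ?S = "{0, b1, b2, b1 + b2}"
    \<comment> \<open>By \<open>b\<close> and \<open>ind\<close> the four frequencies are distinct,
      so the determinant is an exponential sum with one coefficient for each frequency.\<close>
    define c where "c \<omega> = (if \<omega> = 0 then C$1$1 * C$2$2 - C$1$2 * C$2$1 else
      if \<omega> = b2 then C$1$1 * D$2$2 - D$1$2 * C$2$1 else
      if \<omega> = b1 then D$1$1 * C$2$2 - C$1$2 * D$2$1 else D$1$1 * D$2$2 - D$1$2 * D$2$1)" for \<omega>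
    have "?d 0 = (\<lambda>w. \<Sum>\<omega>\<in>?S. c \<omega> * exp (\<omega> * w))"
      using b ind by (simp add: fun_eq_iff bvp_det_def exp_mono_def c_def algebra_simps)
    moreover have "\<exists>\<omega>0\<in>?S. c \<omega>0 \<noteq> 0"
    proof (rule ccontr)
      assume "\<not> ?thesis"
      then have "\<forall>\<omega>\<in>?S. c \<omega> = 0" by blast
      then have "(\<Sum>\<omega>\<in>?S. c \<omega> * exp (\<omega> * w)) = 0" for w by (intro sum.neutral) auto
      then have "?d 0 w = 0" for w using calculation by metis
      with nz show False by blast
    qed
    then obtain \<omega>0 where "\<omega>0 \<in> ?S" "c \<omega>0 \<noteq> 0" by blast
    moreover have "norm (?d 0 w * G w) \<le> K * N * exp (R * norm w)" for w
      using growthF[of w] by (simp add: FG)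
    ultimately show thesis
      using exp_sum_quotient_growth[of ?S \<omega>0 c G "?d 0" "K * N" R] G that by auto
  qed
  \<comment> \<open>Far out on the ray the damping factor cancels in the quotient and the damped
    determinant is bounded away from 0; the remaining segment is compact.\<close>
  have ray_bound: "\<exists>B. \<forall>t\<ge>0. norm (G (of_real t * p)) \<le> B" if pp: "p \<in> {p1, p2, p3}" for p
  proof -
    obtain t0 \<kappa> where t0: "t0 \<ge> 0" "\<kappa> > 0"
      "\<And>t. t \<ge> t0 \<Longrightarrow> \<kappa> \<le> norm (?d 0 (of_real t * p) * damp b1 b2 p t)"
      using ray_nz[OF pp] by auto
    obtain B where B: "\<And>t. t \<ge> 0 \<Longrightarrow> norm (F 0 (of_real t * p) * damp b1 b2 p t) \<le> B"
      using bvp_sol_ray(1)[OF l, of b1 p b2 C D i] rays[OF pp] by (auto simp: F_def)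
    have "continuous_on {0..t0} (\<lambda>t. G (of_real t * p))"
      by (rule continuous_on_compose2[OF holomorphic_on_imp_continuous_on[OF G]]) (auto intro!: continuous_intros)
    then have "bounded ((\<lambda>t. G (of_real t * p)) ` {0..t0})"
      by (intro compact_imp_bounded compact_continuous_image compact_Icc)
    then obtain B' where B': "\<forall>t\<in>{0..t0}. norm (G (of_real t * p)) \<le> B'"
      by (auto simp: bounded_iff)
    have "norm (G (of_real t * p)) \<le> max B' (B / \<kappa>)" if "t \<ge> 0" for t
    proof (cases "t \<le> t0")
      case True
      then show ?thesis using B' that by (auto intro: max.coboundedI1)
    next
      case False
      let ?s = "damp b1 b2 p t"
      have "\<kappa> * norm (G (of_real t * p)) \<le> norm (?d 0 (of_real t * p) * ?s) * norm (G (of_real t * p))"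
        using t0(3)[of t] False by (intro mult_right_mono) auto
      also have "\<dots> = norm (F 0 (of_real t * p) * ?s)" by (simp only: FG norm_mult mult_ac)
      also have "\<dots> \<le> B" by (rule B[OF that])
      finally show ?thesis using t0(2) by (simp add: field_simps le_max_iff_disj)
    qed
    then show ?thesis by blast
  qed
  obtain B1 B2 B3 where Bs: "\<And>t. t \<ge> 0 \<Longrightarrow> norm (G (of_real t * p1)) \<le> B1"
    "\<And>t. t \<ge> 0 \<Longrightarrow> norm (G (of_real t * p2)) \<le> B2" "\<And>t. t \<ge> 0 \<Longrightarrow> norm (G (of_real t * p3)) \<le> B3"
    using ray_bound[of p1] ray_bound[of p2] ray_bound[of p3] by auto
  define B where "B = max 1 (max B1 (max B2 B3))"
  have "norm (G w) \<le> B" for w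
  proof (rule phragmen_lindelof_three_rays[OF G growthG _ _ pind pos zero])
    fix p and t :: real assume "p \<in> {p1, p2, p3}" "t \<ge> 0"
    then show "norm (G (of_real t * p)) \<le> B"
      using Bs[of t] by (auto simp: B_def intro: max.coboundedI1 max.coboundedI2)
  qed (simp add: B_def)
  then have "bounded (range G)" by (auto simp: bounded_iff)
  then have "G constant_on UNIV" by (rule Liouville_theorem[OF G])
  then obtain g where g: "\<And>w. G w = g" by (auto simp: constant_on_def)
  \<comment> \<open>With \<open>G\<close> constant, damped \<open>F 0\<close> is \<open>g\<close>
    times the damped determinant. The former tends to 0, the latter to a nonzero coefficient, so
    \<open>g = 0\<close>.\<close>
  have lim: "(\<lambda>m. F 0 (of_real (real m) * p1) * damp b1 b2 p1 (real m)) \<longlonglongrightarrow> 0"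
    unfolding F_def using rays[of p1] by (intro bvp_sol_ray(2)[OF l]) auto
  have "(\<lambda>m. ?d 0 (of_real (real m) * p1) * damp b1 b2 p1 (real m)) \<longlonglongrightarrow> dom_coeff b1 b2 C D p1"
    using rays[of p1] by (intro filterlim_compose[OF bvp_det_ray filterlim_real_sequentially]) auto
  then have "(\<lambda>m. ?d 0 (of_real (real m) * p1) * damp b1 b2 p1 (real m) * g) \<longlonglongrightarrow> dom_coeff b1 b2 C D p1 * g"
    by (rule tendsto_mult_right)
  moreover have "?d 0 (of_real (real m) * p1) * damp b1 b2 p1 (real m) * g =
      F 0 (of_real (real m) * p1) * damp b1 b2 p1 (real m)" for m
    by (simp only: FG g mult_ac)
  ultimately have "(\<lambda>m. F 0 (of_real (real m) * p1) * damp b1 b2 p1 (real m)) \<longlonglongrightarrow> dom_coeff b1 b2 C D p1 * g"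
    by (simp only:)
  then have "dom_coeff b1 b2 C D p1 * g = 0" by (rule LIMSEQ_unique[OF _ lim])
  then have "g = 0" using rays[of p1] by simp
  then show ?thesis using FG[of w] g by (simp add: F_def)
qed

text \<open>Stated for every \<open>T\<close> with at least these root functions, so that it also
  applies to the adjoint, of which only a restriction is known to be a boundary value
  operator.\<close>

lemma bvp_complete:
  fixes C D :: "complex^2^2"
  assumes b: "b1 \<noteq> 0" "b2 \<noteq> 0" and ind: "b1 \<noteq> b2" "b1 + b2 \<noteq> 0"
    and rays: "\<And>p. p \<in> {p1, p2, p3} \<Longrightarrow> Re (b1 * p) \<noteq> 0 \<and> Re (b2 * p) \<noteq> 0 \<and> dom_coeff b1 b2 C D p \<noteq> 0"
    and pind: "Im (cnj p1 * p2) \<noteq> 0" and pos: "\<alpha>1 > 0" "\<alpha>2 > 0" "\<alpha>3 > 0"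
    and zero: "of_real \<alpha>1 * p1 + of_real \<alpha>2 * p2 + of_real \<alpha>3 * p3 = 0"
    and T: "root_functions (bvp_op b1 b2 C D) \<subseteq> root_functions T"
  shows "complete_operator T"
proof (rule complete_operatorI)
  fix l and f :: "2 vfun"
  assume l: "L2_functional l" and van: "\<And>u. u \<in> lin_span (root_functions T) \<Longrightarrow> u \<in> L2 \<Longrightarrow> l u = 0"
    and f: "f \<in> L2"
  have Y: "l (bvp_sol b1 b2 C D i 0 w) = 0" for i w
    by (rule bvp_functional_zero[OF b ind rays pind pos zero l van]) (use T lin_span_superset in blast)+
  let ?b = "\<lambda>k::2. if k = 1 then b1 else b2"
  define \<Phi> where "\<Phi> k n w = l (\<lambda>x. exp_mono n (?b k * of_real x) w *s axis k 1)" for k n w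
  have d\<Phi>: "(\<Phi> k n has_field_derivative \<Phi> k (Suc n) w) (at w)" for k n w
    unfolding \<Phi>_def[abs_def] by (intro L2_functional_exp_derivative[OF l] continuous_intros)
  have split: "(C$i$2 + D$i$2 * exp (b2 * w)) * \<Phi> 1 0 w - (C$i$1 + D$i$1 * exp (b1 * w)) * \<Phi> 2 0 w = 0" for i w
  proof -
    have L: "(\<lambda>x. exp_mono 0 (b * of_real x) w *s axis k 1) \<in> L2" for b and k :: 2
      by (intro axis_L2 continuous_intros)
    have "bvp_sol b1 b2 C D i 0 w = (\<lambda>x. (C$i$2 + D$i$2 * exp (b2 * w)) *s (exp_mono 0 (b1 * of_real x) w *s axis 1 1) -
      (C$i$1 + D$i$1 * exp (b1 * w)) *s (exp_mono 0 (b2 * of_real x) w *s axis 2 1))"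
      by (rule ext) (simp add: vec_eq_iff bvp_sol_def exp_mono_def exp_add algebra_simps)
    then have "l (bvp_sol b1 b2 C D i 0 w) = (C$i$2 + D$i$2 * exp (b2 * w)) * l (\<lambda>x. exp_mono 0 (b1 * of_real x) w *s axis 1 1) -
      (C$i$1 + D$i$1 * exp (b1 * w)) * l (\<lambda>x. exp_mono 0 (b2 * of_real x) w *s axis 2 1)"
      by (simp only: L2_functional_diff[OF l] L2_functional_scale[OF l] L2_scale L)
    then show ?thesis using Y[of i w] by (simp add: \<Phi>_def)
  qed
  \<comment> \<open>For \<open>i = 1, 2\<close> the equations \<open>split\<close> form a linear
    system for \<open>\<Phi> 1\<close> and \<open>\<Phi> 2\<close>; eliminating one of them leaves
    the determinant in front of the other.\<close>
  have det\<Phi>: "bvp_det b1 b2 C D 0 w * \<Phi> k 0 w = 0" for k w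
  proof -
    have "bvp_det b1 b2 C D 0 w * \<Phi> 1 0 w = (C$1$1 + D$1$1 * exp (b1 * w)) *
        ((C$2$2 + D$2$2 * exp (b2 * w)) * \<Phi> 1 0 w - (C$2$1 + D$2$1 * exp (b1 * w)) * \<Phi> 2 0 w) -
        (C$2$1 + D$2$1 * exp (b1 * w)) *
        ((C$1$2 + D$1$2 * exp (b2 * w)) * \<Phi> 1 0 w - (C$1$1 + D$1$1 * exp (b1 * w)) * \<Phi> 2 0 w)"
      by (simp add: bvp_det_def exp_mono_def exp_add algebra_simps)
    moreover have "bvp_det b1 b2 C D 0 w * \<Phi> 2 0 w = (C$1$2 + D$1$2 * exp (b2 * w)) *
        ((C$2$2 + D$2$2 * exp (b2 * w)) * \<Phi> 1 0 w - (C$2$1 + D$2$1 * exp (b1 * w)) * \<Phi> 2 0 w) -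
        (C$2$2 + D$2$2 * exp (b2 * w)) *
        ((C$1$2 + D$1$2 * exp (b2 * w)) * \<Phi> 1 0 w - (C$1$1 + D$1$1 * exp (b1 * w)) * \<Phi> 2 0 w)"
      by (simp add: bvp_det_def exp_mono_def exp_add algebra_simps)
    ultimately show ?thesis using exhaust_2[of k] by (auto simp: split)
  qed
  have \<Phi>0: "\<Phi> k 0 w = 0" for k w
  proof -
    have hold: "bvp_det b1 b2 C D 0 holomorphic_on UNIV" by (rule holomorphic_UNIV_I[OF bvp_det_derivative])
    have hol\<Phi>: "\<Phi> k 0 holomorphic_on UNIV" by (rule holomorphic_UNIV_I[OF d\<Phi>])
    define U where "U = {w. bvp_det b1 b2 C D 0 w \<noteq> 0}"
    have "open U" unfolding U_def
      by (intro open_Collect_neq continuous_intros holomorphic_on_imp_continuous_on hold)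
    moreover have "U \<noteq> {}"
    proof
      assume "U = {}"
      then have "(\<lambda>t. 0) \<longlonglongrightarrow> dom_coeff b1 b2 C D p1"
        using filterlim_compose[OF bvp_det_ray[of b1 p1 b2 C D] filterlim_real_sequentially] rays[of p1]
        by (auto simp: U_def)
      then show False using rays[of p1] by (simp add: LIMSEQ_const_iff)
    qed
    ultimately show ?thesis
      using analytic_continuation_open[of U UNIV "\<Phi> k 0" "\<lambda>_. 0"] hol\<Phi> det\<Phi> by (auto simp: U_def)
  qed
  \<comment> \<open>The derivatives of \<open>\<Phi> k 0\<close> at 0 are, up to powers of the
    nonzero \<open>b1\<close> or \<open>b2\<close>, the values of \<open>l\<close> on the
    monomials.\<close>
  have "l (\<lambda>x. of_real x ^ n *s axis k 1) = 0" for n and k :: 2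
  proof -
    have "\<Phi> k n 0 = (deriv ^^ n) (\<Phi> k 0) 0" by (simp add: higher_deriv_family[of "\<Phi> k", OF d\<Phi>])
    also have "\<Phi> k 0 = (\<lambda>_. 0)" using \<Phi>0 by blast
    finally have "\<Phi> k n 0 = 0" by simp
    moreover have "(\<lambda>x. exp_mono n (?b k * of_real x) 0 *s (axis k 1 :: complex ^ 2)) = (\<lambda>x. ?b k ^ n *s (of_real x ^ n *s axis k 1))"
      by (simp add: exp_mono_def power_mult_distrib)
    moreover have "(\<lambda>x. of_real x ^ n *s (axis k 1 :: complex ^ 2)) \<in> L2"
      by (intro axis_L2 continuous_intros)
    ultimately have "?b k ^ n * l (\<lambda>x. of_real x ^ n *s axis k 1) = 0"
      unfolding \<Phi>_def by (simp only: L2_functional_scale[OF l])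
    then show ?thesis using b by (auto split: if_splits)
  qed
  then show "l f = 0" using L2_functional_eq_zeroI[OF l _ f] by blast
qed

section \<open>The adjoint operator\<close>

lemma unit_integral_split:
  fixes u :: "real \<Rightarrow> complex"
  assumes u: "integrable unit_lebesgue u" and t: "t \<in> {0..1}"
  shows "(LINT s|unit_lebesgue. (if t \<le> s then u s else 0)) =
    (LINT s:{0..1}|lebesgue. u s) - (LINT s:{0..t}|lebesgue. u s)"
proof -
  have "(LINT s|unit_lebesgue. (if t \<le> s then u s else 0)) = (LINT s|unit_lebesgue. indicator {0..1} s *\<^sub>R u s - indicator {0..t} s *\<^sub>R u s)"
  proof (rule integral_cong_AE)
    \<comment> \<open>On [0,1], the condition \<open>t \<le> s\<close> and the complement of
      \<open>{0..t}\<close> differ at the single point \<open>t\<close>.\<close>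
    have "AE s in unit_lebesgue. s \<notin> {t}"
      by (rule AE_not_in) (use t in \<open>simp add: null_sets_restrict_space null_sets_completionI\<close>)
    then show "AE s in unit_lebesgue. (if t \<le> s then u s else 0) = indicator {0..1} s *\<^sub>R u s - indicator {0..t} s *\<^sub>R u s"
      using AE_space by eventually_elim (auto simp: indicator_def)
    have [measurable]: "u \<in> borel_measurable unit_lebesgue" using u by auto
    have [measurable]: "(\<lambda>s. s) \<in> borel_measurable unit_lebesgue"
      using id_borel_measurable_lebesgue_on[of "{0..1}"] by (simp add: id_def)
    show "(\<lambda>s. if t \<le> s then u s else 0) \<in> borel_measurable unit_lebesgue" by measurable
    show "(\<lambda>s. indicator {0..1} s *\<^sub>R u s - indicator {0..t} s *\<^sub>R u s) \<in> borel_measurable unit_lebesgue"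
      by (intro borel_measurable_diff borel_measurable_scaleR borel_measurable_indicator)
        (use t in \<open>auto simp: sets_restrict_space_iff\<close>)
  qed
  also have "\<dots> = (LINT s|unit_lebesgue. indicator {0..1} s *\<^sub>R u s) - (LINT s|unit_lebesgue. indicator {0..t} s *\<^sub>R u s)"
  proof (rule Bochner_Integration.integral_diff)
    show "integrable unit_lebesgue (\<lambda>s. indicator {0..1} s *\<^sub>R u s)" "integrable unit_lebesgue (\<lambda>s. indicator {0..t} s *\<^sub>R u s)"
      using t by (auto intro!: integrable_mult_indicator u simp: sets_restrict_space_iff)
  qed
  also have "\<dots> = (LINT s:{0..1}|lebesgue. u s) - (LINT s:{0..t}|lebesgue. u s)"
    using t by (subst (1 2) unit_set_integral) auto
  finally show ?thesis .
qed

lemma indefinite_integral_continuous_unit: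
  fixes u :: "real \<Rightarrow> complex"
  assumes "integrable unit_lebesgue u"
  shows "continuous_on {0..1} (\<lambda>x. LINT t:{0..x}|lebesgue. u t)"
proof -
  have eq: "integral {0..x} u = (LINT t:{0..x}|lebesgue. u t)" if "x \<in> {0..1}" for x
    by (rule sym, intro set_lebesgue_integral_eq_integral unit_set_integrable assms) (use that in auto)
  have "u integrable_on {0..1}"
    by (intro set_lebesgue_integral_eq_integral unit_set_integrable assms) auto
  then have "continuous_on {0..1} (\<lambda>x. integral {0..x} u)" by (rule indefinite_integral_continuous_1)
  then show ?thesis by (rule continuous_on_eq) (rule eq)
qed

lemma integrable_mult_bounded_unit:
  fixes u f :: "real \<Rightarrow> complex"
  assumes u: "integrable unit_lebesgue u" and f: "continuous_on {0..1} f"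
  shows "integrable unit_lebesgue (\<lambda>x. u x * f x)"
proof -
  have "bounded (f ` {0..1})" using f by (intro compact_imp_bounded compact_continuous_image) auto
  then obtain B where B: "\<forall>x\<in>{0..1}. norm (f x) \<le> B" by (auto simp: bounded_iff)
  have fm: "f \<in> borel_measurable unit_lebesgue" using f by (intro continuous_imp_measurable_on_sets_lebesgue) auto
  show ?thesis
  proof (rule Bochner_Integration.integrable_bound)
    show "integrable unit_lebesgue (\<lambda>x. B * norm (u x))" using u by (intro integrable_mult_right integrable_norm)
    show "(\<lambda>x. u x * f x) \<in> borel_measurable unit_lebesgue" using u fm by (intro borel_measurable_times) auto
    show "AE x in unit_lebesgue. norm (u x * f x) \<le> norm (B * norm (u x))"
    proof (rule AE_I2)
      fix x assume "x \<in> space unit_lebesgue"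
      then have "norm (f x) * norm (u x) \<le> B * norm (u x)" using B by (intro mult_right_mono) auto
      then have "norm (u x * f x) \<le> B * norm (u x)" by (simp add: norm_mult mult.commute)
      then show "norm (u x * f x) \<le> norm (B * norm (u x))" unfolding real_norm_def by (rule order_trans) (rule abs_ge_self)
    qed
  qed
qed

text \<open>Fubini for \<open>u s * v t\<close> on the triangle \<open>t \<le> s\<close>:
  integrating over \<open>t\<close> first gives \<open>u * V\<close>, over \<open>s\<close> first
  gives \<open>v * (U 1 - U)\<close>.\<close>

lemma integration_by_parts_0:
  fixes u v :: "real \<Rightarrow> complex"
  assumes u: "integrable unit_lebesgue u" and v: "integrable unit_lebesgue v"
  defines "U \<equiv> \<lambda>x. LINT t:{0..x}|lebesgue. u t" and "V \<equiv> \<lambda>x. LINT t:{0..x}|lebesgue. v t"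
  shows "(LINT x|unit_lebesgue. u x * V x) + (LINT x|unit_lebesgue. v x * U x) = U 1 * V 1"
proof -
  interpret finite_measure unit_lebesgue by (rule finite_measure_unit_lebesgue)
  interpret P: pair_sigma_finite unit_lebesgue unit_lebesgue ..
  define f where "f s t = (if t \<le> s then u s * v t else 0)" for s t
  have [measurable]: "u \<in> borel_measurable unit_lebesgue" "v \<in> borel_measurable unit_lebesgue" using u v by auto
  have idm [measurable]: "(\<lambda>s. s) \<in> borel_measurable unit_lebesgue"
    using id_borel_measurable_lebesgue_on[of "{0..1}"] by (simp add: id_def)
  have [measurable]: "(\<lambda>p. fst p) \<in> borel_measurable (unit_lebesgue \<Otimes>\<^sub>M unit_lebesgue)"
    "(\<lambda>p. snd p) \<in> borel_measurable (unit_lebesgue \<Otimes>\<^sub>M unit_lebesgue)"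
    by (rule measurable_compose[OF measurable_fst idm], rule measurable_compose[OF measurable_snd idm])
  have [measurable]: "(\<lambda>p. u (fst p)) \<in> borel_measurable (unit_lebesgue \<Otimes>\<^sub>M unit_lebesgue)"
    "(\<lambda>p. v (snd p)) \<in> borel_measurable (unit_lebesgue \<Otimes>\<^sub>M unit_lebesgue)"
    by (rule measurable_compose[OF measurable_fst], simp, rule measurable_compose[OF measurable_snd], simp)
  have fm: "case_prod f \<in> borel_measurable (unit_lebesgue \<Otimes>\<^sub>M unit_lebesgue)"
    unfolding f_def case_prod_beta by measurable
  have int: "integrable (unit_lebesgue \<Otimes>\<^sub>M unit_lebesgue) (case_prod f)"
  proof (rule Bochner_Integration.integrable_bound[OF _ fm])
    show "integrable (unit_lebesgue \<Otimes>\<^sub>M unit_lebesgue) (\<lambda>p. u (fst p) * v (snd p))"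
    proof (rule P.Fubini_integrable)
      show "integrable unit_lebesgue (\<lambda>x. LINT y|unit_lebesgue. norm (u (fst (x, y)) * v (snd (x, y))))"
        using u by (simp add: norm_mult)
      show "AE x in unit_lebesgue. integrable unit_lebesgue (\<lambda>y. u (fst (x, y)) * v (snd (x, y)))"
        using v by simp
    qed measurable
    show "AE p in unit_lebesgue \<Otimes>\<^sub>M unit_lebesgue. norm (case_prod f p) \<le> norm (u (fst p) * v (snd p))"
      by (rule AE_I2) (auto simp: f_def)
  qed
  have U1: "(LINT s|unit_lebesgue. f s t) = v t * (U 1 - U t)" if t: "t \<in> {0..1}" for t
  proof -
    have "(LINT s|unit_lebesgue. f s t) = (LINT s|unit_lebesgue. v t * (if t \<le> s then u s else 0))"
      by (rule Bochner_Integration.integral_cong) (auto simp: f_def)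
    then show ?thesis using unit_integral_split[OF u t] by (simp add: U_def)
  qed
  have V1: "(LINT t|unit_lebesgue. f s t) = u s * V s" if s: "s \<in> {0..1}" for s
  proof -
    have "(LINT t|unit_lebesgue. f s t) = (LINT t|unit_lebesgue. u s * (indicator {0..s} t *\<^sub>R v t))"
      by (rule Bochner_Integration.integral_cong) (auto simp: f_def indicator_def)
    also have "\<dots> = u s * (LINT t|unit_lebesgue. indicator {0..s} t *\<^sub>R v t)"
      by (rule integral_mult_right_zero)
    also have "(LINT t|unit_lebesgue. indicator {0..s} t *\<^sub>R v t) = V s"
      unfolding V_def by (rule unit_set_integral[symmetric]) (use s in auto)
    finally show ?thesis .
  qed
  have cont: "continuous_on {0..1} U" "continuous_on {0..1} V"
    unfolding U_def V_def by (intro indefinite_integral_continuous_unit u v)+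
  have "(LINT s|unit_lebesgue. u s * V s) = (LINT s|unit_lebesgue. (LINT t|unit_lebesgue. f s t))"
    by (rule Bochner_Integration.integral_cong) (auto simp: V1)
  also have "\<dots> = (LINT t|unit_lebesgue. (LINT s|unit_lebesgue. f s t))" by (rule P.Fubini_integral[OF int, symmetric])
  also have "\<dots> = (LINT t|unit_lebesgue. v t * (U 1 - U t))"
    by (rule Bochner_Integration.integral_cong) (auto simp: U1)
  also have "\<dots> = (LINT t|unit_lebesgue. v t * U 1 - v t * U t)" by (simp add: algebra_simps)
  also have "\<dots> = (LINT t|unit_lebesgue. v t * U 1) - (LINT t|unit_lebesgue. v t * U t)"
    by (rule Bochner_Integration.integral_diff) (intro integrable_mult_bounded_unit v cont continuous_intros)+
  also have "(LINT t|unit_lebesgue. v t * U 1) = V 1 * U 1"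
  proof -
    have "V 1 = (LINT t|unit_lebesgue. indicator {0..1} t *\<^sub>R v t)"
      unfolding V_def by (rule unit_set_integral) auto
    also have "\<dots> = (LINT t|unit_lebesgue. v t)" by (rule Bochner_Integration.integral_cong) auto
    finally show ?thesis by simp
  qed
  finally show ?thesis by simp
qed

lemma unit_integral_eq: "(LINT t:{0..1}|lebesgue. u t) = (LINT t|unit_lebesgue. u t)" for u :: "real \<Rightarrow> complex"
proof -
  have "(LINT t:{0..1}|lebesgue. u t) = (LINT t|unit_lebesgue. indicator {0..1} t *\<^sub>R u t)"
    by (rule unit_set_integral) auto
  also have "\<dots> = (LINT t|unit_lebesgue. u t)" by (rule Bochner_Integration.integral_cong) auto
  finally show ?thesis .
qed

lemma integration_by_parts:
  fixes y z u v :: "real \<Rightarrow> complex"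
  assumes u: "integrable unit_lebesgue u" and v: "integrable unit_lebesgue v"
    and y: "\<And>x. x \<in> {0..1} \<Longrightarrow> y x = y0 + (LINT t:{0..x}|lebesgue. u t)"
    and z: "\<And>x. x \<in> {0..1} \<Longrightarrow> z x = z0 + (LINT t:{0..x}|lebesgue. v t)"
  shows "(LINT x|unit_lebesgue. u x * z x) + (LINT x|unit_lebesgue. v x * y x) = y 1 * z 1 - y0 * z0"
proof -
  let ?U = "\<lambda>x. LINT t:{0..x}|lebesgue. u t" and ?V = "\<lambda>x. LINT t:{0..x}|lebesgue. v t"
  have cont: "continuous_on {0..1} ?U" "continuous_on {0..1} ?V"
    by (intro indefinite_integral_continuous_unit u v)+
  have "(LINT x|unit_lebesgue. u x * z x) = (LINT x|unit_lebesgue. z0 * u x + u x * ?V x)"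
    by (rule Bochner_Integration.integral_cong) (auto simp: z algebra_simps)
  also have "\<dots> = z0 * ?U 1 + (LINT x|unit_lebesgue. u x * ?V x)"
    unfolding unit_integral_eq[of u]
    by (subst Bochner_Integration.integral_add)
      (simp_all only: integrable_mult_right[OF u] integrable_mult_bounded_unit[OF u cont(2)] integral_mult_right_zero)
  finally have 1: "(LINT x|unit_lebesgue. u x * z x) = z0 * ?U 1 + (LINT x|unit_lebesgue. u x * ?V x)" .
  have "(LINT x|unit_lebesgue. v x * y x) = (LINT x|unit_lebesgue. y0 * v x + v x * ?U x)"
    by (rule Bochner_Integration.integral_cong) (auto simp: y algebra_simps)
  also have "\<dots> = y0 * ?V 1 + (LINT x|unit_lebesgue. v x * ?U x)"
    unfolding unit_integral_eq[of v]
    by (subst Bochner_Integration.integral_add)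
      (simp_all only: integrable_mult_right[OF v] integrable_mult_bounded_unit[OF v cont(1)] integral_mult_right_zero)
  finally have 2: "(LINT x|unit_lebesgue. v x * y x) = y0 * ?V 1 + (LINT x|unit_lebesgue. v x * ?U x)" .
  show ?thesis
    unfolding 1 2 using integration_by_parts_0[OF u v] y[of 1] z[of 1] by (simp add: algebra_simps)
qed

lemma L2_nth_integrable: "g \<in> L2 \<Longrightarrow> integrable unit_lebesgue (\<lambda>x. g x $ k)"
  by (rule integrable_bounded_linear[OF bounded_linear_vec_nth L2_integrable1])

lemma W12_continuous:
  fixes y :: "'n::finite vfun"
  assumes "W12_deriv y g"
  shows "continuous_on {0..1} y"
proof -
  have g: "g \<in> L2" and eq: "\<And>k x. x \<in> {0..1} \<Longrightarrow> y x $ k = y 0 $ k + (LINT t:{0..x}|lebesgue. g t $ k)"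
    using assms unfolding W12_deriv_iff by blast+
  have c: "continuous_on {0..1} (\<lambda>x. \<chi> k. y 0 $ k + (LINT t:{0..x}|lebesgue. g t $ k))"
    by (intro continuous_on_vec_lambda continuous_intros indefinite_integral_continuous_unit L2_nth_integrable g)
  have eq': "y x = (\<chi> k. y 0 $ k + (LINT t:{0..x}|lebesgue. g t $ k))" if "x \<in> {0..1}" for x
    by (simp only: vec_eq_iff vec_lambda_beta eq[OF that]) simp
  show ?thesis by (rule continuous_on_eq[OF c]) (rule eq'[symmetric])
qed

lemma set_integral_cnj: "(LINT t:A|M. cnj (f t)) = cnj (LINT t:A|M. f t)"
  by (simp add: set_lebesgue_integral_def flip: Bochner_Integration.integral_cnj)

lemma W12_integration_by_parts:
  fixes y z :: "'n::finite vfun"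
  assumes "W12_deriv y y'" "W12_deriv z z'"
  shows "(LINT x|unit_lebesgue. y' x $ k * cnj (z x $ k)) + (LINT x|unit_lebesgue. y x $ k * cnj (z' x $ k)) =
    y 1 $ k * cnj (z 1 $ k) - y 0 $ k * cnj (z 0 $ k)"
proof -
  have eq: "\<And>x. x \<in> {0..1} \<Longrightarrow> y x $ k = y 0 $ k + (LINT t:{0..x}|lebesgue. y' t $ k)"
    "\<And>x. x \<in> {0..1} \<Longrightarrow> z x $ k = z 0 $ k + (LINT t:{0..x}|lebesgue. z' t $ k)"
    and L: "y' \<in> L2" "z' \<in> L2"
    using assms unfolding W12_deriv_iff by blast+
  have "(LINT x|unit_lebesgue. y' x $ k * cnj (z x $ k)) + (LINT x|unit_lebesgue. cnj (z' x $ k) * y x $ k) =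
    y 1 $ k * cnj (z 1 $ k) - y 0 $ k * cnj (z 0 $ k)"
  proof (rule integration_by_parts)
    show "integrable unit_lebesgue (\<lambda>x. y' x $ k)" by (rule L2_nth_integrable[OF L(1)])
    show "integrable unit_lebesgue (\<lambda>x. cnj (z' x $ k))"
      using L2_nth_integrable[OF L(2)] by (rule integrable_bounded_linear[OF bounded_linear_cnj])
    show "cnj (z x $ k) = cnj (z 0 $ k) + (LINT t:{0..x}|lebesgue. cnj (z' t $ k))" if "x \<in> {0..1}" for x
      by (simp add: eq(2)[OF that] set_integral_cnj)
  qed (rule eq)
  then show ?thesis by (simp add: mult.commute)
qed

section \<open>Boundary value operators contained in the adjoint\<close>

lemma L2_inner_cong:
  assumes "f \<in> L2" "f' \<in> L2" "g \<in> L2" "g' \<in> L2" "ae_eq f f'" "ae_eq g g'"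
  shows "L2_inner f g = L2_inner f' g'"
  unfolding L2_inner_def
proof (rule integral_cong_AE)
  show "AE x in unit_lebesgue. (\<Sum>j\<in>UNIV. f x $ j * cnj (g x $ j)) = (\<Sum>j\<in>UNIV. f' x $ j * cnj (g' x $ j))"
    using assms(5,6) unfolding ae_eq_def by eventually_elim simp
qed (intro borel_measurable_sum borel_measurable_times measurable_cnj measurable_vec_nth L2_measurable assms)+

text \<open>After integration by parts only the boundary terms of Lagrange's identity remain, and
  \<open>bc\<close> says that the two sets of boundary conditions annihilate them. The numbers
  \<open>b1\<close> and \<open>b2\<close> are conjugated because the formal adjoint has the
  conjugate diagonal matrix.\<close>

lemma adjoint_superset:
  fixes C D C' D' :: "complex^2^2"
  assumes bc: "\<And>y0 y1 z0 z1. C *v y0 + D *v y1 = 0 \<Longrightarrow> C' *v z0 + D' *v z1 = 0 \<Longrightarrow>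
      inverse b1 * (y1$1 * cnj (z1$1) - y0$1 * cnj (z0$1)) + inverse b2 * (y1$2 * cnj (z1$2) - y0$2 * cnj (z0$2)) = 0"
  shows "bvp_op (cnj b1) (cnj b2) C' D' \<subseteq> op_adjoint (bvp_op b1 b2 C D)"
proof
  fix q assume "q \<in> bvp_op (cnj b1) (cnj b2) C' D'"
  then obtain g h z z' where q: "q = (g, h)" and gh: "g \<in> L2" "h \<in> L2" and z: "W12_deriv z z'" "C' *v z 0 + D' *v z 1 = 0"
    "ae_eq g z" "ae_eq h (\<lambda>x. (- \<i>) *s (diag2 (inverse (cnj b1)) (inverse (cnj b2)) *v z' x))"
    unfolding L_op_def by blast
  have "L2_inner Tf g = L2_inner f h" if fTf: "(f, Tf) \<in> bvp_op b1 b2 C D" for f Tf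
  proof -
    obtain y y' where fT: "f \<in> L2" "Tf \<in> L2" and y: "W12_deriv y y'" "C *v y 0 + D *v y 1 = 0"
      "ae_eq f y" "ae_eq Tf (\<lambda>x. (- \<i>) *s (diag2 (inverse b1) (inverse b2) *v y' x))"
      using fTf unfolding L_op_def by blast
    have L: "y \<in> L2" "z \<in> L2" "y' \<in> L2" "z' \<in> L2"
      using L2_continuous[OF W12_continuous[OF y(1)]] L2_continuous[OF W12_continuous[OF z(1)]] y(1) z(1)
      unfolding W12_deriv_def by blast+
    have DL: "(\<lambda>x. (- \<i>) *s (diag2 p q *v w x)) \<in> L2" if "w \<in> L2" for p q w
      by (rule L2_scale, rule L2_bounded_linear[OF matrix_vector_mul_bounded_linear that])
    let ?I = "\<lambda>f g k. LINT x|unit_lebesgue. f x $ k * cnj (g x $ k)"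
    have "L2_inner Tf g = L2_inner (\<lambda>x. (- \<i>) *s (diag2 (inverse b1) (inverse b2) *v y' x)) z"
      by (intro L2_inner_cong fT gh L DL y z)
    also have "\<dots> = - \<i> * inverse b1 * ?I y' z 1 - \<i> * inverse b2 * ?I y' z 2"
      by (subst L2_inner_sum[OF DL[OF L(3)] L(2)]) (simp add: sum_2 diag2_mult mult.assoc)
    finally have 1: "L2_inner Tf g = - \<i> * inverse b1 * ?I y' z 1 - \<i> * inverse b2 * ?I y' z 2" .
    have "L2_inner f h = L2_inner y (\<lambda>x. (- \<i>) *s (diag2 (inverse (cnj b1)) (inverse (cnj b2)) *v z' x))"
      by (intro L2_inner_cong fT gh L DL y z)
    also have "\<dots> = (LINT x|unit_lebesgue. (\<i> * inverse b1) * (y x $ 1 * cnj (z' x $ 1))) + (LINT x|unit_lebesgue. (\<i> * inverse b2) * (y x $ 2 * cnj (z' x $ 2)))"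
      by (subst L2_inner_sum[OF L(1) DL[OF L(4)]]) (simp add: sum_2 diag2_mult mult_ac del: Bochner_Integration.integral_mult_right_zero Bochner_Integration.integral_mult_left_zero)
    also have "\<dots> = \<i> * inverse b1 * ?I y z' 1 + \<i> * inverse b2 * ?I y z' 2" by simp
    finally have 2: "L2_inner f h = \<i> * inverse b1 * ?I y z' 1 + \<i> * inverse b2 * ?I y z' 2" .
    have "L2_inner Tf g - L2_inner f h = - \<i> * (inverse b1 * (?I y' z 1 + ?I y z' 1) + inverse b2 * (?I y' z 2 + ?I y z' 2))"
      unfolding 1 2 by (simp add: algebra_simps)
    also have "\<dots> = 0"
      unfolding W12_integration_by_parts[OF y(1) z(1)] bc[OF y(2) z(2)] by simp
    finally show ?thesis by simp
  qed
  then show "q \<in> op_adjoint (bvp_op b1 b2 C D)"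
    unfolding q op_adjoint_def using gh by blast
qed

lemma op_kernel_mono: "S \<subseteq> T \<Longrightarrow> op_kernel S \<subseteq> op_kernel T"
  unfolding op_kernel_def by blast

lemma op_shift_mono: "S \<subseteq> T \<Longrightarrow> op_shift S \<mu> \<subseteq> op_shift T \<mu>"
  unfolding op_shift_def by blast

lemma relpow_subset_mono: "S \<subseteq> T \<Longrightarrow> S ^^ n \<subseteq> T ^^ n" for S T :: "('a \<times> 'a) set"
  by (induction n) (auto intro: relcomp_mono[THEN subsetD])

lemma root_functions_mono:
  assumes "S \<subseteq> T"
  shows "root_functions S \<subseteq> root_functions T"
proof -
  have "root_subspace S \<mu> \<subseteq> root_subspace T \<mu>" for \<mu>
    unfolding root_subspace_def
    by (intro lin_span_mono UN_mono op_kernel_mono relpow_subset_mono op_shift_mono assms order_refl)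
  moreover have "op_eigenvalue S \<mu> \<Longrightarrow> op_eigenvalue T \<mu>" for \<mu>
    using op_kernel_mono[OF op_shift_mono[OF assms]] unfolding op_eigenvalue_def by blast
  ultimately show ?thesis unfolding root_functions_def by blast
qed

section \<open>Incompleteness\<close>

lemma set_integral_singleton: "(LINT t:{0..0}|lebesgue. u t) = 0" for u :: "real \<Rightarrow> complex"
  unfolding set_lebesgue_integral_def
proof (rule integral_eq_zero_AE)
  have "AE x in lebesgue. x \<notin> {0::real}" by (rule AE_not_in) (simp add: null_sets_completionI)
  then show "AE x in lebesgue. indicator {0..0} x *\<^sub>R u x = 0" by eventually_elim (simp add: indicator_def)
qed

lemma set_integral_cong_scale:
  fixes f g :: "real \<Rightarrow> complex"
  assumes ae: "AE t in unit_lebesgue. f t = c * g t" and x: "x \<in> {0..1}"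
    and m: "f \<in> borel_measurable unit_lebesgue" "g \<in> borel_measurable unit_lebesgue"
  shows "(LINT t:{0..x}|lebesgue. f t) = c * (LINT t:{0..x}|lebesgue. g t)"
proof -
  have ind: "(indicator {0..x} :: real \<Rightarrow> real) \<in> borel_measurable unit_lebesgue"
    using x by (intro borel_measurable_indicator) (auto simp: sets_restrict_space_iff)
  have "(LINT t|unit_lebesgue. indicator {0..x} t *\<^sub>R f t) = (LINT t|unit_lebesgue. c * (indicator {0..x} t *\<^sub>R g t))"
  proof (rule integral_cong_AE)
    show "AE t in unit_lebesgue. indicator {0..x} t *\<^sub>R f t = c * (indicator {0..x} t *\<^sub>R g t)"
      using ae by eventually_elim simp
  qed (intro borel_measurable_times borel_measurable_scaleR ind m borel_measurable_const)+
  also have "\<dots> = c * (LINT t|unit_lebesgue. indicator {0..x} t *\<^sub>R g t)" by (rule integral_mult_right_zero)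
  finally show ?thesis using x by (subst (1 2) unit_set_integral) auto
qed

text \<open>Continuity of \<open>y\<close> makes the integral equation the differential equation
  \<open>y' = c * y\<close>. With the integrating factor, \<open>exp (- c * x) * y x\<close> is
  constant, and it vanishes at \<open>e\<close>.\<close>

lemma volterra_zero:
  fixes y :: "real \<Rightarrow> complex"
  assumes cont: "continuous_on {0..1} y"
    and y: "\<And>x. x \<in> {0..1} \<Longrightarrow> y x = y0 + c * (LINT t:{0..x}|lebesgue. y t)"
    and e: "e \<in> {0..1}" "y e = 0" and x: "x \<in> {0..1}"
  shows "y x = 0"
proof -
  have y': "y x = y0 + c * integral {0..x} y" if "x \<in> {0..1}" for x
  proof -
    have "(LINT t:{0..x}|lebesgue. y t) = integral {0..x} y"
      by (intro set_lebesgue_integral_eq_integral unit_set_integrable continuous_imp_integrable_unit cont) (use that in auto)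
    then show ?thesis using y[OF that] by simp
  qed
  have dy: "(y has_vector_derivative c * y x) (at x within {0..1})" if x: "x \<in> {0..1}" for x
  proof -
    have "((\<lambda>x. y0 + c * integral {0..x} y) has_vector_derivative 0 + c * y x) (at x within {0..1})"
      by (intro has_vector_derivative_add has_vector_derivative_const has_vector_derivative_mult_right
          integral_has_vector_derivative cont x)
    then have "((\<lambda>x. y0 + c * integral {0..x} y) has_vector_derivative c * y x) (at x within {0..1})" by simp
    then show ?thesis by (rule has_vector_derivative_transform[OF x, rotated]) (rule y')
  qed
  define g where "g x = exp (- c * of_real x) * y x" for x :: real
  have "(g has_derivative (\<lambda>h. 0)) (at x within {0..1})" if x: "x \<in> {0..1}" for x
  proof -
    have "((\<lambda>z. exp (- c * z)) has_field_derivative - c * exp (- c * of_real x)) (at (of_real x))"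
      by (auto intro!: derivative_eq_intros)
    from has_vector_derivative_real_field[OF this]
    have "((\<lambda>x. exp (- c * of_real x)) has_vector_derivative - c * exp (- c * of_real x)) (at x within {0..1})"
      by (rule has_vector_derivative_at_within)
    from has_vector_derivative_mult[OF this dy[OF x]]
    have "(g has_vector_derivative 0) (at x within {0..1})"
      by (simp add: g_def[abs_def] algebra_simps)
    then show ?thesis by (simp add: has_vector_derivative_def)
  qed
  then obtain d where d: "\<forall>x\<in>{0..1}. g x = d"
    using has_derivative_zero_constant[of "{0..1::real}" g] by auto
  then have "d = 0" using e by (metis g_def mult_zero_right)
  then show ?thesis using d x by (auto simp: g_def)
qed

text \<open>The \<open>k\<close>-th component of an element of the domain is a Volterra integral that vanishes at an
  endpoint, so no root function has a nonzero \<open>k\<close>-th component.\<close>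

lemma volterra_component_incomplete:
  fixes T :: "'n::finite operator"
  assumes L2: "\<And>f h. (f, h) \<in> T \<Longrightarrow> f \<in> L2 \<and> h \<in> L2"
    and comp: "\<And>f h. (f, h) \<in> T \<Longrightarrow> \<exists>y. (AE x in unit_lebesgue. f x $ k = y x) \<and> y e = 0 \<and>
      (\<forall>x\<in>{0..1}. y x = y 0 + c * (LINT t:{0..x}|lebesgue. h t $ k))"
    and e: "e \<in> {0..1}"
  shows "\<not> complete_operator T"
proof
  let ?Z = "{f \<in> L2. AE x in unit_lebesgue. f x $ k = 0} :: 'n vfun set"
  \<comment> \<open>If \<open>(T - \<mu>) f\<close> has vanishing \<open>k\<close>-th component, the
    Volterra equation for \<open>f $ k\<close> becomes homogeneous; thus the property passes up
    every Jordan chain.\<close>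
  have step: "AE x in unit_lebesgue. f x $ k = 0" if fg: "(f, g) \<in> op_shift T \<mu>" and g: "AE x in unit_lebesgue. g x $ k = 0" for f g \<mu>
  proof -
    obtain h where h: "(f, h) \<in> T" "g = (\<lambda>x. h x - \<mu> *s f x)" using fg by (auto simp: op_shift_def)
    obtain y where y: "AE x in unit_lebesgue. f x $ k = y x" "y e = 0"
      "\<forall>x\<in>{0..1}. y x = y 0 + c * (LINT t:{0..x}|lebesgue. h t $ k)"
      using comp[OF h(1)] by blast
    have hi: "integrable unit_lebesgue (\<lambda>t. h t $ k)" using L2[OF h(1)] L2_nth_integrable by blast
    have "continuous_on {0..1} (\<lambda>x. y 0 + c * (LINT t:{0..x}|lebesgue. h t $ k))"
      by (intro continuous_intros indefinite_integral_continuous_unit hi)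
    then have cont: "continuous_on {0..1} y" by (rule continuous_on_eq) (rule bspec[OF y(3), symmetric])
    have hy: "AE x in unit_lebesgue. h x $ k = \<mu> * y x"
      using g y(1) by eventually_elim (simp add: h(2))
    have int: "(LINT t:{0..x}|lebesgue. h t $ k) = \<mu> * (LINT t:{0..x}|lebesgue. y t)" if "x \<in> {0..1}" for x
      by (rule set_integral_cong_scale[OF hy that]) (use hi continuous_imp_integrable_unit[OF cont] in auto)
    have y0: "y x = 0" if "x \<in> {0..1}" for x
    proof (rule volterra_zero[OF cont _ e y(2) that])
      show "y x = y 0 + (c * \<mu>) * (LINT t:{0..x}|lebesgue. y t)" if "x \<in> {0..1}" for x
        using bspec[OF y(3) that] int[OF that] by (simp add: mult.assoc)
    qed
    show ?thesis using y(1) AE_space by eventually_elim (simp add: y0)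
  qed
  have pow: "AE x in unit_lebesgue. f x $ k = 0" if "(f, g) \<in> op_shift T \<mu> ^^ n" "AE x in unit_lebesgue. g x $ k = 0" for f g \<mu> n
    using that
  proof (induction n arbitrary: f)
    case (Suc n)
    obtain f' where "(f, f') \<in> op_shift T \<mu>" "(f', g) \<in> op_shift T \<mu> ^^ n"
      using relpow_Suc_D2[OF Suc.prems(1)] by blast
    then show ?case using Suc.IH[of f'] Suc.prems(2) step by blast
  qed simp
  have kernel: "op_kernel (op_shift T \<mu> ^^ n) \<subseteq> ?Z" if n1: "n \<in> {1..}" for \<mu> n
  proof
    fix f assume "f \<in> op_kernel (op_shift T \<mu> ^^ n)"
    then obtain g where fg: "(f, g) \<in> op_shift T \<mu> ^^ n" "ae_eq g (\<lambda>x. 0)" by (auto simp: op_kernel_def)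
    have "AE x in unit_lebesgue. g x $ k = 0" using fg(2) unfolding ae_eq_def by eventually_elim simp
    then have "AE x in unit_lebesgue. f x $ k = 0" by (rule pow[OF fg(1)])
    \<comment> \<open>A positive exponent puts \<open>f\<close> into the domain of the shifted
      operator and hence into \<open>L2\<close>.\<close>
    moreover obtain m where "n = Suc m" using n1 by (cases n) auto
    then obtain f' where "(f, f') \<in> op_shift T \<mu>" using fg(1) relpow_Suc_D2 by metis
    then have "f \<in> L2" using L2 by (auto simp: op_shift_def)
    ultimately show "f \<in> ?Z" by simp
  qed
  have span: "lin_span S \<subseteq> ?Z" if "S \<subseteq> ?Z" for S
  proof
    fix u assume "u \<in> lin_span S"
    then obtain m :: nat and a f where u: "u = (\<lambda>x. \<Sum>j<m. a j *s f j x)" "\<forall>j<m. f j \<in> S"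
      unfolding lin_span_def by blast
    have fZ: "f j \<in> L2" "AE x in unit_lebesgue. f j x $ k = 0" if "j \<in> {..<m}" for j
      using u(2) that \<open>S \<subseteq> ?Z\<close> by auto
    have "u \<in> L2" unfolding u(1) by (intro L2_sum L2_scale fZ)
    moreover have "AE x in unit_lebesgue. \<forall>j\<in>{..<m}. f j x $ k = 0"
      using fZ(2) by (intro eventually_ball_finite) auto
    then have "AE x in unit_lebesgue. u x $ k = 0"
      by eventually_elim (simp add: u(1))
    ultimately show "u \<in> ?Z" by simp
  qed
  have "root_functions T \<subseteq> ?Z"
    unfolding root_functions_def root_subspace_def by (intro UN_least span kernel)
  then have Z: "lin_span (root_functions T) \<subseteq> ?Z" by (rule span)
  assume "complete_operator T"
  \<comment> \<open>The constant unit vector in direction \<open>k\<close> has distance at least 1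
    from all functions whose \<open>k\<close>-th component vanishes.\<close>
  define h :: "'n vfun" where "h = (\<lambda>x. axis k 1)"
  have h: "h \<in> L2" unfolding h_def by (rule L2_continuous) simp
  then have "h \<in> L2_closure (lin_span (root_functions T))" using \<open>complete_operator T\<close> by (simp add: complete_operator_def)
  then obtain u where u: "u \<in> lin_span (root_functions T)" "L2_norm (\<lambda>x. h x - u x) < 1"
    unfolding L2_closure_def using zero_less_one by blast
  have uZ: "u \<in> L2" "AE x in unit_lebesgue. u x $ k = 0" using u(1) Z by auto
  have "(LINT x|unit_lebesgue. (1::real)) \<le> (LINT x|unit_lebesgue. (norm (h x - u x))\<^sup>2)"
  proof (rule integral_mono_AE)
    show "AE x in unit_lebesgue. 1 \<le> (norm (h x - u x))\<^sup>2"
      using uZ(2)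
    proof eventually_elim
      case (elim x)
      have "norm ((h x - u x) $ k) \<le> norm (h x - u x)" by (rule Finite_Cartesian_Product.norm_nth_le)
      then have "1 \<le> norm (h x - u x)" using elim by (simp add: h_def axis_def)
      then show ?case by simp
    qed
  qed (intro integrable_const_unit L2_integrable L2_diff h uZ)+
  then have "1 \<le> (L2_norm (\<lambda>x. h x - u x))\<^sup>2" using measure_unit_lebesgue_UNIV by (simp add: L2_norm_power2)
  moreover have "(L2_norm (\<lambda>x. h x - u x))\<^sup>2 < 1" using u(2) L2_norm_nonneg[of "\<lambda>x. h x - u x"] by (simp add: abs_square_less_1)
  ultimately show False by simp
qed

lemma L_op_incomplete:
  fixes C D :: "complex^2^2"
  assumes b: "b1 \<noteq> 0" "b2 \<noteq> 0" and e: "e \<in> {0, 1::real}"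
    and bc: "\<And>y :: 2 vfun. C *v y 0 + D *v y 1 = 0 \<Longrightarrow> y e $ k = 0"
  shows "\<not> complete_operator (bvp_op b1 b2 C D)"
proof (rule volterra_component_incomplete)
  let ?b = "if k = 1 then b1 else b2"
  fix f h assume fh: "(f, h) \<in> bvp_op b1 b2 C D"
  then show "f \<in> L2 \<and> h \<in> L2" by (auto simp: L_op_def)
  obtain y y' where y: "W12_deriv y y'" "C *v y 0 + D *v y 1 = 0" "ae_eq f y"
    "ae_eq h (\<lambda>x. (- \<i>) *s (diag2 (inverse b1) (inverse b2) *v y' x))"
    using fh unfolding L_op_def by blast
  have hL: "h \<in> L2" using fh by (auto simp: L_op_def)
  have y'L: "y' \<in> L2" using y(1) unfolding W12_deriv_def by blast
  have ae: "AE x in unit_lebesgue. y' x $ k = (\<i> * ?b) * h x $ k"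
    using y(4) unfolding ae_eq_def
    by eventually_elim (use b exhaust_2[of k] in \<open>auto simp: diag2_mult field_simps\<close>)
  have I1: "(LINT t:{0..x}|lebesgue. y' t $ k) = \<i> * ?b * (LINT t:{0..x}|lebesgue. h t $ k)" if x: "x \<in> {0..1}" for x
    by (rule set_integral_cong_scale[OF ae x]) (intro measurable_vec_nth L2_measurable hL y'L)+
  have I2: "\<forall>x\<in>{0..1}. y x $ k = y 0 $ k + (LINT t:{0..x}|lebesgue. y' t $ k)"
    using y(1) unfolding W12_deriv_iff by blast
  have I3: "AE x in unit_lebesgue. f x $ k = y x $ k"
    using y(3) unfolding ae_eq_def by eventually_elim simp
  show "\<exists>y. (AE x in unit_lebesgue. f x $ k = y x) \<and> y e = 0 \<and>
      (\<forall>x\<in>{0..1}. y x = y 0 + \<i> * ?b * (LINT t:{0..x}|lebesgue. h t $ k))"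
  proof (rule exI[of _ "\<lambda>x. y x $ k"], intro conjI ballI I3 bc[OF y(2)])
    fix x :: real assume x: "x \<in> {0..1}"
    show "y x $ k = y 0 $ k + \<i> * ?b * (LINT t:{0..x}|lebesgue. h t $ k)"
      using bspec[OF I2 x] I1[OF x] by (simp only:)
  qed
qed (use e in auto)

text \<open>If the coefficient column of the boundary value \<open>y e $ k\<close> is 0, functions
  concentrated in component \<open>k\<close> that vanish at the other endpoint satisfy the boundary
  conditions. Testing with all of them shows that \<open>g $ k\<close> is a multiple of the
  primitive of \<open>h $ k\<close> that vanishes at \<open>e\<close>.\<close>

lemma adjoint_incomplete:
  fixes C D :: "complex^2^2"
  assumes b: "b1 \<noteq> 0" "b2 \<noteq> 0" and e: "e \<in> {0, 1::real}"
    and col: "\<And>i. (if e = 0 then C else D) $ i $ k = 0"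
  shows "\<not> complete_operator (op_adjoint (bvp_op b1 b2 C D))"
proof (rule volterra_component_incomplete)
  let ?b = "if k = 1 then b1 else b2"
  fix g h assume gh: "(g, h) \<in> op_adjoint (bvp_op b1 b2 C D)"
  then have gL: "g \<in> L2" and hL: "h \<in> L2" by (auto simp: op_adjoint_def)
  then show "g \<in> L2 \<and> h \<in> L2" by blast
  have hi: "integrable unit_lebesgue (\<lambda>t. h t $ k)" by (rule L2_nth_integrable[OF hL])
  define H where "H x = (LINT t:{0..x}|lebesgue. h t $ k)" for x
  define W where "W x = H x - H e" for x
  have H0: "H 0 = 0" unfolding H_def by (rule set_integral_singleton)
  have contW: "continuous_on {0..1} W"
    unfolding W_def H_def by (intro continuous_intros indefinite_integral_continuous_unit hi)
  define q where "q x = (\<i> / cnj ?b) * g x $ k + W x" for x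
  have qL: "(\<lambda>x. q x *s axis k 1 :: complex ^ 2) \<in> L2"
  proof -
    have "bounded_linear (\<lambda>v. (c * v $ k) *s axis k 1 :: complex ^ 2)" for c
    proof (rule bounded_linear_intro)
      show "norm ((c * v $ k) *s axis k 1 :: complex ^ 2) \<le> norm v * norm c" for v :: "complex ^ 2"
        unfolding norm_smult_axis norm_mult
        by (subst mult.commute) (intro mult_right_mono Finite_Cartesian_Product.norm_nth_le norm_ge_zero)
    qed (simp_all add: vec_eq_iff algebra_simps)
    from L2_add[OF L2_bounded_linear[OF this gL] axis_L2[OF contW, of k]] show ?thesis
      by (simp only: q_def vec.scale_left_distrib)
  qed
  \<comment> \<open>Testing with derivative \<open>u\<close> gives that \<open>u\<close> is
    orthogonal to \<open>q\<close>; the choice \<open>u = q\<close> forces \<open>q = 0\<close>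
    almost everywhere.\<close>
  define u where "u = q"
  have ui: "integrable unit_lebesgue u"
    using L2_nth_integrable[OF qL, of k] by (simp add: u_def axis_def)
  \<comment> \<open>The primitive of \<open>u\<close> that vanishes at \<open>1 - e\<close>, the
    endpoint whose coefficients are unrestricted.\<close>
  define F where "F x = (LINT t:{0..x}|lebesgue. u t) - (if e = 0 then (LINT t:{0..1}|lebesgue. u t) else 0)" for x
  define y where "y x = F x *s (axis k 1 :: complex ^ 2)" for x
  have Fx: "F x = F 0 + (LINT t:{0..x}|lebesgue. u t)" for x unfolding F_def set_integral_singleton by simp
  have Fe: "F (1 - e) = 0" using e set_integral_singleton[of u] by (auto simp: F_def)
  have contF: "continuous_on {0..1} F"
    unfolding F_def by (intro continuous_intros indefinite_integral_continuous_unit ui)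
  have yW: "W12_deriv y (\<lambda>x. u x *s axis k 1)"
    unfolding W12_deriv_iff
  proof (intro conjI allI ballI)
    show "(\<lambda>x. u x *s axis k 1 :: complex ^ 2) \<in> L2" using qL by (simp add: u_def)
    fix j and x :: real assume "x \<in> {0..1}"
    show "y x $ j = y 0 $ j + (LINT t:{0..x}|lebesgue. (u t *s axis k 1) $ j)"
      by (subst (1) y_def, subst Fx) (simp add: y_def axis_def set_lebesgue_integral_def algebra_simps)
  qed
  have "(y, \<lambda>x. (- \<i> / ?b * u x) *s axis k 1) \<in> bvp_op b1 b2 C D"
  proof (rule L_opI[OF _ _ yW])
    show "y \<in> L2" unfolding y_def by (rule axis_L2[OF contF])
    show "(\<lambda>x. (- \<i> / ?b * u x) *s axis k 1 :: complex ^ 2) \<in> L2"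
      using L2_scale[OF qL, of "- \<i> / ?b"] by (simp add: u_def)
    have kill: "(A *v (c *s axis k 1)) = 0" if "\<And>i. A $ i $ k = 0" for A :: "complex^2^2" and c
      using that exhaust_2[of k] by (auto simp: vec_eq_iff matrix_vector_mult_def sum_2 axis_def)
    show "C *v y 0 + D *v y 1 = 0"
      using e
    proof (elim insertE emptyE)
      assume "e = 0"
      then show ?thesis using kill[of C] col Fe by (simp add: y_def)
    next
      assume "e = 1"
      then show ?thesis using kill[of D] col Fe by (simp add: y_def)
    qed
    show "(- \<i>) *s (diag2 (inverse b1) (inverse b2) *v (u x *s axis k 1)) = (- \<i> / ?b * u x) *s axis k 1" for x
      using exhaust_2[of k] by (auto simp: vec_eq_iff forall_2 diag2_mult axis_def divide_inverse)
  qed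
  then have adj: "L2_inner (\<lambda>x. (- \<i> / ?b * u x) *s axis k 1) g = L2_inner y h"
    using gh unfolding op_adjoint_def by blast
  have axis_inner: "L2_inner (\<lambda>x. c x *s axis k 1) v = (LINT x|unit_lebesgue. c x * cnj (v x $ k))" for c and v :: "2 vfun"
    unfolding L2_inner_def using exhaust_2[of k] by (auto simp: sum_2 axis_def)
  have parts: "(LINT x|unit_lebesgue. u x * cnj (W x)) + (LINT x|unit_lebesgue. cnj (h x $ k) * F x) = F 1 * cnj (W 1) - F 0 * cnj (W 0)"
  proof (rule integration_by_parts[OF ui _ Fx])
    show "integrable unit_lebesgue (\<lambda>x. cnj (h x $ k))"
      using hi by (rule integrable_bounded_linear[OF bounded_linear_cnj])
    show "cnj (W x) = cnj (W 0) + (LINT t:{0..x}|lebesgue. cnj (h t $ k))" for x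
      by (simp add: W_def H_def[of x] set_integral_cnj H0)
  qed
  \<comment> \<open>At each endpoint one of the two primitives vanishes: \<open>W\<close> at
    \<open>e\<close>, \<open>F\<close> at \<open>1 - e\<close>.\<close>
  have zero: "F 1 * cnj (W 1) - F 0 * cnj (W 0) = 0"
    using e Fe by (auto simp: W_def)
  have "(LINT x|unit_lebesgue. u x * cnj (q x)) = 0"
  proof -
    have i1: "integrable unit_lebesgue (\<lambda>x. (- \<i> / ?b * u x) * cnj (g x $ k))"
      using L2_inner_integrable[OF L2_scale[OF qL, of "- \<i> / ?b"] gL, of k] by (simp add: u_def axis_def)
    have contcW: "continuous_on {0..1} (\<lambda>x. cnj (W x))" by (intro continuous_intros contW)
    have "(LINT x|unit_lebesgue. u x * cnj (q x)) = (LINT x|unit_lebesgue. (- \<i> / ?b * u x) * cnj (g x $ k) + u x * cnj (W x))"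
      by (rule Bochner_Integration.integral_cong) (auto simp: q_def algebra_simps)
    also have "\<dots> = (LINT x|unit_lebesgue. (- \<i> / ?b * u x) * cnj (g x $ k)) + (LINT x|unit_lebesgue. u x * cnj (W x))"
      by (rule Bochner_Integration.integral_add[OF i1 integrable_mult_bounded_unit[OF ui contcW]])
    also have "(LINT x|unit_lebesgue. (- \<i> / ?b * u x) * cnj (g x $ k)) = (LINT x|unit_lebesgue. F x * cnj (h x $ k))"
      using adj unfolding axis_inner y_def .
    finally show ?thesis using parts zero by (simp add: mult.commute add.commute)
  qed
  then have "L2_inner (\<lambda>x. q x *s axis k 1 :: complex ^ 2) (\<lambda>x. q x *s axis k 1) = 0"
    unfolding axis_inner by (simp add: u_def axis_def)
  then have "(L2_norm (\<lambda>x. q x *s axis k 1 :: complex ^ 2))\<^sup>2 = 0" unfolding L2_inner_self by simp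
  then have "AE x in unit_lebesgue. (norm (q x *s axis k 1 :: complex ^ 2))\<^sup>2 = 0"
    unfolding L2_norm_power2 by (subst (asm) integral_nonneg_eq_0_iff_AE[OF L2_integrable[OF qL]]) auto
  then have A1: "AE x in unit_lebesgue. g x $ k = (\<i> * cnj ?b) * W x"
  proof eventually_elim
    case (elim x)
    then have "q x = 0" by (simp add: norm_smult_axis)
    then have "(\<i> / cnj ?b) * g x $ k = - W x" unfolding q_def by (rule eq_neg_iff_add_eq_0[THEN iffD2])
    moreover have "(- \<i> * cnj ?b) * ((\<i> / cnj ?b) * g x $ k) = g x $ k" using b by simp
    ultimately have "(- \<i> * cnj ?b) * (- W x) = g x $ k" by (simp only:)
    then show ?case by simp
  qed
  have A2: "W e = 0" by (simp add: W_def)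
  have A3: "W x = W 0 + (LINT t:{0..x}|lebesgue. h t $ k)" for x by (simp add: W_def H_def[of x] H0)
  show "\<exists>y. (AE x in unit_lebesgue. g x $ k = y x) \<and> y e = 0 \<and>
      (\<forall>x\<in>{0..1}. y x = y 0 + (\<i> * cnj ?b) * (LINT t:{0..x}|lebesgue. h t $ k))"
    by (rule exI[of _ "\<lambda>x. (\<i> * cnj ?b) * W x"], intro conjI ballI A1) (simp add: A2, subst A3, rule distrib_left)
qed (use e in auto)

section \<open>Weak regularity and minors\<close>

text \<open>In the notation of the overview, the disjuncts are the pairs
  \<open>J\<^sub>1\<^sub>2, J\<^sub>3\<^sub>4\<close> and
  \<open>J\<^sub>1\<^sub>4, J\<^sub>3\<^sub>2\<close>.\<close>

definition opposite_minors :: "complex^2^2 \<Rightarrow> complex^2^2 \<Rightarrow> bool" where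
  "opposite_minors C D \<longleftrightarrow>
     (C$1$1 * C$2$2 - C$1$2 * C$2$1 \<noteq> 0 \<and> D$1$1 * D$2$2 - D$1$2 * D$2$1 \<noteq> 0) \<or>
     (C$1$1 * D$2$2 - D$1$2 * C$2$1 \<noteq> 0 \<and> D$1$1 * C$2$2 - C$1$2 * D$2$1 \<noteq> 0)"

text \<open>In the coordinates \<open>Re (b1 * p)\<close> and \<open>Re (b2 * p)\<close>, two
  independent directions are placed in one quadrant of the pair and the negative of a third of their
  sum in the opposite one.\<close>

lemma opposite_minors_rays:
  assumes ind: "Im (cnj b1 * b2) \<noteq> 0" and opp: "opposite_minors C D"
  obtains p1 p2 p3 where
    "\<And>p. p \<in> {p1, p2, p3} \<Longrightarrow> Re (b1 * p) \<noteq> 0 \<and> Re (b2 * p) \<noteq> 0 \<and> dom_coeff b1 b2 C D p \<noteq> 0"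
    "Im (cnj p1 * p2) \<noteq> 0" "p1 + p2 + 3 * p3 = 0"
proof -
  \<comment> \<open>The sign selects the pair of opposite quadrants, equal or opposite signs of the
    two coordinates. The directions are then \<open>(-1, -2 * \<sigma>)\<close>,
    \<open>(-2, - \<sigma>)\<close> and \<open>(1, \<sigma>)\<close>.\<close>
  define \<sigma> :: real where "\<sigma> = (if C$1$1 * C$2$2 - C$1$2 * C$2$1 \<noteq> 0 \<and> D$1$1 * D$2$2 - D$1$2 * D$2$1 \<noteq> 0 then 1 else -1)"
  obtain p1 where p1: "Re (b1 * p1) = -1" "Re (b2 * p1) = -2 * \<sigma>" by (rule Re_coordinates[OF ind])
  obtain p2 where p2: "Re (b1 * p2) = -2" "Re (b2 * p2) = -1 * \<sigma>" by (rule Re_coordinates[OF ind])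
  define p3 where "p3 = - (p1 + p2) / 3"
  have "b * p3 = of_real (- 1 / 3) * (b * p1) + of_real (- 1 / 3) * (b * p2)" for b
    by (simp add: p3_def field_simps)
  then have "Re (b * p3) = (- 1 / 3) * Re (b * p1) + (- 1 / 3) * Re (b * p2)" for b
    by (metis Re_complex_of_real Im_complex_of_real plus_complex.sel(1) times_complex.sel(1) mult_zero_left diff_zero)
  then have p3: "Re (b1 * p3) = 1" "Re (b2 * p3) = \<sigma>" using p1 p2 by simp_all
  have "Re (b1 * p1) * Re (b2 * p2) - Re (b1 * p2) * Re (b2 * p1) = - (Im (cnj b1 * b2) * Im (cnj p1 * p2))"
    by (simp add: algebra_simps)
  then have "Im (cnj p1 * p2) \<noteq> 0" using p1 p2 by (auto simp: \<sigma>_def split: if_splits)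
  moreover have "p1 + p2 + 3 * p3 = 0" by (simp add: p3_def complex_eq_iff field_simps)
  moreover have "Re (b1 * p) \<noteq> 0 \<and> Re (b2 * p) \<noteq> 0 \<and> dom_coeff b1 b2 C D p \<noteq> 0" if "p \<in> {p1, p2, p3}" for p
    using that p1 p2 p3 opp
    unfolding dom_coeff_def Let_def opposite_minors_def \<sigma>_def by (auto simp del: times_complex.sel split: if_splits)
  ultimately show thesis using that by blast
qed

lemma opposite_minors_complete:
  assumes b: "b1 \<noteq> 0" "b2 \<noteq> 0" and ind: "Im (cnj b1 * b2) \<noteq> 0" and opp: "opposite_minors C D"
    and T: "root_functions (bvp_op b1 b2 C D) \<subseteq> root_functions T"
  shows "complete_operator T"
proof -
  obtain p1 p2 p3 where p: "\<And>p. p \<in> {p1, p2, p3} \<Longrightarrow> Re (b1 * p) \<noteq> 0 \<and> Re (b2 * p) \<noteq> 0 \<and> dom_coeff b1 b2 C D p \<noteq> 0"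
    "Im (cnj p1 * p2) \<noteq> 0" "p1 + p2 + 3 * p3 = 0"
    using opposite_minors_rays[OF ind opp] by metis
  have "b1 \<noteq> b2" "b1 + b2 \<noteq> 0"
    using ind by (auto simp: add_eq_0_iff)
  then show ?thesis
    by (intro bvp_complete[where ?\<alpha>1.0 = 1 and ?\<alpha>2.0 = 1 and ?\<alpha>3.0 = 3, OF b _ _ p(1) p(2) _ _ _ _ T])
      (use p(3) in simp_all)
qed

text \<open>Cramer's rule expresses \<open>J * p1\<close> and \<open>J * p2\<close> by
  \<open>q1\<close> and \<open>q2\<close>. The bilinear form, multiplied by \<open>J\<close>,
  becomes linear in \<open>q1\<close> and \<open>q2\<close>, and its two coefficients are the
  left-hand sides of \<open>v\<close>.\<close>

lemma Lagrange_identity_zero: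
  fixes p1 p2 q1 q2 :: complex
  assumes "P11 * p1 + P12 * p2 + (Q11 * q1 + Q12 * q2) = 0" "P21 * p1 + P22 * p2 + (Q21 * q1 + Q22 * q2) = 0"
    and J: "J = P11 * P22 - P12 * P21" "J \<noteq> 0"
    and v: "g1 * (P22 * Q11 - P12 * Q21) * v1 + g2 * (P11 * Q21 - P21 * Q11) * v2 + J * g1 * w1 = 0"
      "g1 * (P22 * Q12 - P12 * Q22) * v1 + g2 * (P11 * Q22 - P21 * Q12) * v2 + J * g2 * w2 = 0"
  shows "g1 * (q1 * w1 - p1 * v1) + g2 * (q2 * w2 - p2 * v2) = 0"
proof -
  have Jp: "J * p1 = - ((P22 * Q11 - P12 * Q21) * q1 + (P22 * Q12 - P12 * Q22) * q2)"
    "J * p2 = - ((P11 * Q21 - P21 * Q11) * q1 + (P11 * Q22 - P21 * Q12) * q2)"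
    unfolding J using assms(1,2) by algebra+
  have "J * (g1 * (q1 * w1 - p1 * v1) + g2 * (q2 * w2 - p2 * v2)) =
      q1 * (J * g1 * w1) + q2 * (J * g2 * w2) - g1 * (J * p1) * v1 - g2 * (J * p2) * v2"
    by (simp add: algebra_simps)
  also have "\<dots> = q1 * (g1 * (P22 * Q11 - P12 * Q21) * v1 + g2 * (P11 * Q21 - P21 * Q11) * v2 + J * g1 * w1) +
      q2 * (g1 * (P22 * Q12 - P12 * Q22) * v1 + g2 * (P11 * Q22 - P21 * Q12) * v2 + J * g2 * w2)"
    unfolding Jp by (simp add: algebra_simps)
  finally show ?thesis unfolding v using J(2) by simp
qed

text \<open>The rows of \<open>(C', D')\<close> arise by solving the boundary conditions for a pair of boundary values
  whose coefficient minor is nonzero and comparing coefficients in Lagrange's identity.\<close>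

lemma opposite_minors_adjoint:
  fixes C D :: "complex^2^2"
  assumes b: "b1 \<noteq> 0" "b2 \<noteq> 0" and opp: "opposite_minors C D"
  obtains C' D' where "opposite_minors C' D'"
    "bvp_op (cnj b1) (cnj b2) C' D' \<subseteq> op_adjoint (bvp_op b1 b2 C D)"
proof -
  let ?\<beta>1 = "inverse b1" and ?\<beta>2 = "inverse b2"
  consider (12) "C$1$1 * C$2$2 - C$1$2 * C$2$1 \<noteq> 0" "D$1$1 * D$2$2 - D$1$2 * D$2$1 \<noteq> 0" |
     (14) "C$1$1 * D$2$2 - D$1$2 * C$2$1 \<noteq> 0" "D$1$1 * C$2$2 - C$1$2 * D$2$1 \<noteq> 0"
    using opp unfolding opposite_minors_def by blast
  then show thesis
  proof cases
    case 12
    define J where "J = C$1$1 * C$2$2 - C$1$2 * C$2$1"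
    define N11 N12 N21 N22 where "N11 = C$2$2 * D$1$1 - C$1$2 * D$2$1" "N12 = C$2$2 * D$1$2 - C$1$2 * D$2$2"
      "N21 = C$1$1 * D$2$1 - C$2$1 * D$1$1" "N22 = C$1$1 * D$2$2 - C$2$1 * D$1$2"
    define K where "K = D$1$1 * D$2$2 - D$1$2 * D$2$1"
    \<comment> \<open>The entries \<open>N11\<close> to \<open>N22\<close> form the adjugate of
      \<open>C\<close> times \<open>D\<close>; so the minors of the new conditions that matter are,
      up to nonzero factors and conjugation, \<open>J * K\<close> and \<open>J * J\<close>.\<close>
    have detN: "N11 * N22 - N12 * N21 = J * K"
      by (simp add: N11_N12_N21_N22_def J_def K_def algebra_simps)
    have JK: "J \<noteq> 0" "K \<noteq> 0" using 12 by (simp_all add: J_def K_def)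
    define C' :: "complex^2^2" where "C' = vector [vector [cnj (?\<beta>1 * N11), cnj (?\<beta>2 * N21)], vector [cnj (?\<beta>1 * N12), cnj (?\<beta>2 * N22)]]"
    define D' where "D' = diag2 (cnj (J * ?\<beta>1)) (cnj (J * ?\<beta>2))"
    have "C'$1$1 * C'$2$2 - C'$1$2 * C'$2$1 = cnj (?\<beta>1 * ?\<beta>2 * (N11 * N22 - N12 * N21))"
      by (simp add: C'_def algebra_simps)
    moreover have "D'$1$1 * D'$2$2 - D'$1$2 * D'$2$1 = cnj (J * J * ?\<beta>1 * ?\<beta>2)"
      by (simp add: D'_def diag2_def)
    moreover have "cnj (?\<beta>1 * ?\<beta>2 * (J * K)) \<noteq> 0" "cnj (J * J * ?\<beta>1 * ?\<beta>2) \<noteq> 0" using JK b by simp_all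
    ultimately have "opposite_minors C' D'" unfolding detN opposite_minors_def by argo
    moreover have "bvp_op (cnj b1) (cnj b2) C' D' \<subseteq> op_adjoint (bvp_op b1 b2 C D)"
    proof (rule adjoint_superset)
      fix y0 y1 z0 z1 :: "complex^2"
      assume "C *v y0 + D *v y1 = 0" "C' *v z0 + D' *v z1 = 0"
      then have y: "C$1$1 * y0$1 + C$1$2 * y0$2 + (D$1$1 * y1$1 + D$1$2 * y1$2) = 0"
          "C$2$1 * y0$1 + C$2$2 * y0$2 + (D$2$1 * y1$1 + D$2$2 * y1$2) = 0"
        and z: "cnj (?\<beta>1 * N11) * z0$1 + cnj (?\<beta>2 * N21) * z0$2 + cnj (J * ?\<beta>1) * z1$1 = 0"
          "cnj (?\<beta>1 * N12) * z0$1 + cnj (?\<beta>2 * N22) * z0$2 + cnj (J * ?\<beta>2) * z1$2 = 0"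
        by (simp_all add: vec_eq_iff forall_2 matrix_vector_mult_def sum_2 C'_def D'_def diag2_def add.assoc)
      have z': "?\<beta>1 * N11 * cnj (z0$1) + ?\<beta>2 * N21 * cnj (z0$2) + J * ?\<beta>1 * cnj (z1$1) = 0"
          "?\<beta>1 * N12 * cnj (z0$1) + ?\<beta>2 * N22 * cnj (z0$2) + J * ?\<beta>2 * cnj (z1$2) = 0"
        using arg_cong[OF z(1), of cnj] arg_cong[OF z(2), of cnj] by (simp_all add: mult_ac)
      show "?\<beta>1 * (y1$1 * cnj (z1$1) - y0$1 * cnj (z0$1)) + ?\<beta>2 * (y1$2 * cnj (z1$2) - y0$2 * cnj (z0$2)) = 0"
        by (rule Lagrange_identity_zero[OF y J_def JK(1) z'[unfolded N11_N12_N21_N22_def]])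
    qed
    ultimately show thesis by (rule that)
  next
    case 14
    define J where "J = C$1$1 * D$2$2 - D$1$2 * C$2$1"
    define N11 N12 N21 N22 where "N11 = D$2$2 * D$1$1 - D$1$2 * D$2$1" "N12 = D$2$2 * C$1$2 - D$1$2 * C$2$2"
      "N21 = C$1$1 * D$2$1 - C$2$1 * D$1$1" "N22 = C$1$1 * C$2$2 - C$2$1 * C$1$2"
    define K where "K = D$1$1 * C$2$2 - C$1$2 * D$2$1"
    have detN: "N11 * N22 - N12 * N21 = J * K"
      by (simp add: N11_N12_N21_N22_def J_def K_def algebra_simps)
    have JK: "J \<noteq> 0" "K \<noteq> 0" using 14 by (simp_all add: J_def K_def)
    define C' :: "complex^2^2" where "C' = vector [vector [cnj (?\<beta>1 * N11), 0], vector [cnj (?\<beta>1 * N12), cnj (- J * ?\<beta>2)]]"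
    define D' :: "complex^2^2" where "D' = vector [vector [cnj (J * ?\<beta>1), cnj (- ?\<beta>2 * N21)], vector [0, cnj (- ?\<beta>2 * N22)]]"
    have "C'$1$1 * D'$2$2 - D'$1$2 * C'$2$1 = - cnj (?\<beta>1 * ?\<beta>2 * (N11 * N22 - N12 * N21))"
      by (simp add: C'_def D'_def algebra_simps)
    moreover have "D'$1$1 * C'$2$2 - C'$1$2 * D'$2$1 = - cnj (J * J * ?\<beta>1 * ?\<beta>2)"
      by (simp add: C'_def D'_def algebra_simps)
    moreover have "- cnj (?\<beta>1 * ?\<beta>2 * (J * K)) \<noteq> 0" "- cnj (J * J * ?\<beta>1 * ?\<beta>2) \<noteq> 0" using JK b by simp_all
    ultimately have "opposite_minors C' D'" unfolding detN opposite_minors_def by argo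
    moreover have "bvp_op (cnj b1) (cnj b2) C' D' \<subseteq> op_adjoint (bvp_op b1 b2 C D)"
    proof (rule adjoint_superset)
      fix y0 y1 z0 z1 :: "complex^2"
      assume "C *v y0 + D *v y1 = 0" "C' *v z0 + D' *v z1 = 0"
      then have y: "C$1$1 * y0$1 + C$1$2 * y0$2 + (D$1$1 * y1$1 + D$1$2 * y1$2) = 0"
          "C$2$1 * y0$1 + C$2$2 * y0$2 + (D$2$1 * y1$1 + D$2$2 * y1$2) = 0"
        and z: "cnj (?\<beta>1 * N11) * z0$1 + (cnj (J * ?\<beta>1) * z1$1 + cnj (- ?\<beta>2 * N21) * z1$2) = 0"
          "cnj (?\<beta>1 * N12) * z0$1 + cnj (- J * ?\<beta>2) * z0$2 + cnj (- ?\<beta>2 * N22) * z1$2 = 0"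
        by (simp_all add: vec_eq_iff forall_2 matrix_vector_mult_def sum_2 C'_def D'_def algebra_simps)
      then have y': "C$1$1 * y0$1 + D$1$2 * y1$2 + (D$1$1 * y1$1 + C$1$2 * y0$2) = 0"
          "C$2$1 * y0$1 + D$2$2 * y1$2 + (D$2$1 * y1$1 + C$2$2 * y0$2) = 0"
        by (simp_all add: algebra_simps)
      have z': "?\<beta>1 * N11 * cnj (z0$1) + - ?\<beta>2 * N21 * cnj (z1$2) + J * ?\<beta>1 * cnj (z1$1) = 0"
          "?\<beta>1 * N12 * cnj (z0$1) + - ?\<beta>2 * N22 * cnj (z1$2) + J * - ?\<beta>2 * cnj (z0$2) = 0"
        using arg_cong[OF z(1), of cnj] arg_cong[OF z(2), of cnj] by (simp_all add: algebra_simps)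
      \<comment> \<open>Here the conditions are solved for \<open>y0$1\<close> and
        \<open>y1$2\<close>. In the second component the endpoints trade places, which reverses the
        sign of its weight.\<close>
      have "?\<beta>1 * (y1$1 * cnj (z1$1) - y0$1 * cnj (z0$1)) + - ?\<beta>2 * (y0$2 * cnj (z0$2) - y1$2 * cnj (z1$2)) = 0"
        by (rule Lagrange_identity_zero[OF y' J_def JK(1) z'[unfolded N11_N12_N21_N22_def]])
      then show "?\<beta>1 * (y1$1 * cnj (z1$1) - y0$1 * cnj (z0$1)) + ?\<beta>2 * (y1$2 * cnj (z1$2) - y0$2 * cnj (z0$2)) = 0"
        by (simp add: algebra_simps)
    qed
    ultimately show thesis by (rule that)
  qed
qed

section \<open>Boundary conditions without a pair of opposite nonzero minors\<close>

lemma rank_2_rows_independent: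
  fixes a :: "'a::field^'n^2"
  assumes rank: "rank a = 2" and dep: "\<And>j. p * a$1$j + q * a$2$j = 0"
  shows "p = 0 \<and> q = 0"
proof (rule ccontr)
  assume neg: "\<not> (p = 0 \<and> q = 0)"
  have "rows a = range (($) a)" by (auto simp: rows_def row_def)
  then have rows: "rows a = {a$1, a$2}" unfolding UNIV_2 by simp
  have "\<exists>v. rows a \<subseteq> vec.span {v}"
  proof (cases "p = 0")
    case False
    have "a$1 = (- (q / p)) *s a$2"
    proof (simp add: vec_eq_iff, rule allI)
      fix j
      have "p * a$1$j = - (q * a$2$j)" using dep[of j] by (simp add: eq_neg_iff_add_eq_0)
      then show "a$1$j = - (q * a$2$j / p)" using False by (simp add: field_simps)
    qed
    then have "a$1 \<in> vec.span {a$2}" by (metis vec.span_base vec.span_scale insertI1)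
    then show ?thesis unfolding rows using vec.span_base[of "a$2" "{a$2}"] by blast
  next
    case True
    then have "a$2 = 0" using neg dep by (auto simp: vec_eq_iff)
    then have "a$2 \<in> vec.span {a$1}" by (simp add: vec.span_zero)
    then show ?thesis unfolding rows using vec.span_base[of "a$1" "{a$1}"] by blast
  qed
  then obtain v where "rows a \<subseteq> vec.span {v}" by blast
  then have "vec.dim (rows a) \<le> card {v}" by (rule vec.dim_le_card) simp
  then show False using rank by (simp add: row_rank_def_gen)
qed

text \<open>Eliminating \<open>x $ m\<close> from the two equations leaves an equation whose
  coefficients are the minors with column \<open>m\<close>. Only the one at \<open>l\<close> can be
  nonzero, and the rank prevents it from vanishing as well.\<close>

lemma minors_pivot_zero:
  fixes a :: "complex^4^2"
  assumes rank: "rank a = 2" and idx: "UNIV = {m, i, j, l}" and m: "\<not> (a$1$m = 0 \<and> a$2$m = 0)"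
    and minors: "a$1$m * a$2$i = a$2$m * a$1$i" "a$1$m * a$2$j = a$2$m * a$1$j" and x: "a *v x = 0"
  shows "x $ l = 0"
proof -
  define d where "d n = - a$2$m * a$1$n + a$1$m * a$2$n" for n
  have d0: "d n = 0" if "n \<noteq> l" for n
  proof -
    have "n \<in> {m, i, j, l}" using idx UNIV_I by metis
    then show ?thesis using that minors by (auto simp: d_def mult.commute)
  qed
  have "d l \<noteq> 0"
  proof
    assume "d l = 0"
    then have "d n = 0" for n using d0 by metis
    then show False using rank_2_rows_independent[OF rank, of "- a$2$m" "a$1$m"] m by (auto simp: d_def)
  qed
  have "d l * x $ l = (\<Sum>n\<in>UNIV. d n * x $ n)"
    using sum.mono_neutral_right[of UNIV "{l}" "\<lambda>n. d n * x $ n"] d0 by simp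
  also have "\<dots> = - a$2$m * (a *v x) $ 1 + a$1$m * (a *v x) $ 2"
    by (simp add: d_def matrix_vector_mult_def sum_distrib_left left_diff_distrib sum_subtractf sum_negf mult.assoc)
  finally show ?thesis using x \<open>d l \<noteq> 0\<close> by simp
qed

lemma block_nth:
  "left_block a $ i $ 1 = a $ i $ 1" "left_block a $ i $ 2 = a $ i $ 2"
  "right_block a $ i $ 1 = a $ i $ 3" "right_block a $ i $ 2 = a $ i $ 4"
  using exhaust_2[of i] by (auto simp: left_block_def right_block_def)

text \<open>One minor of each opposite pair vanishes, and these two share a column \<open>m\<close>.
  If column \<open>m\<close> is nonzero, \<open>minors_pivot_zero\<close> kills the value of the
  same component at the other endpoint; otherwise that column itself provides the second
  alternative.\<close>

lemma not_opposite_minors_cases: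
  fixes a :: "complex^4^2"
  assumes rank: "rank a = 2" and opp: "\<not> opposite_minors (left_block a) (right_block a)"
  shows "\<exists>k. \<exists>e\<in>{0, 1::real}.
    (\<forall>y :: 2 vfun. left_block a *v y 0 + right_block a *v y 1 = 0 \<longrightarrow> y e $ k = 0) \<or>
    (\<forall>i. (if e = 0 then left_block a else right_block a) $ i $ k = 0)"
proof -
  define x :: "2 vfun \<Rightarrow> complex^4" where
    "x y = (\<chi> n. if n = 1 then y 0 $ 1 else if n = 2 then y 0 $ 2 else if n = 3 then y 1 $ 1 else y 1 $ 2)" for y
  have x: "a *v x y = 0" if "left_block a *v y 0 + right_block a *v y 1 = 0" for y
    using that by (simp add: vec_eq_iff matrix_vector_mult_def sum_2 sum_4 block_nth x_def add.assoc)
  have x_nth: "x y $ 1 = y 0 $ 1" "x y $ 2 = y 0 $ 2" "x y $ 3 = y 1 $ 1" "x y $ 4 = y 1 $ 2" for y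
    by (simp_all add: x_def)
  note pivot = minors_pivot_zero[OF rank _ _ _ _ x]
  have U: "UNIV = {1, 2, 4, 3::4}" "UNIV = {2, 1, 3, 4::4}" "UNIV = {4, 3, 1, 2::4}" "UNIV = {3, 4, 2, 1::4}"
    using exhaust_4 by auto
  consider "a$1$1 * a$2$2 = a$2$1 * a$1$2" "a$1$1 * a$2$4 = a$2$1 * a$1$4"
    | "a$1$2 * a$2$1 = a$2$2 * a$1$1" "a$1$2 * a$2$3 = a$2$2 * a$1$3"
    | "a$1$4 * a$2$3 = a$2$4 * a$1$3" "a$1$4 * a$2$1 = a$2$4 * a$1$1"
    | "a$1$3 * a$2$4 = a$2$3 * a$1$4" "a$1$3 * a$2$2 = a$2$3 * a$1$2"
    using opp unfolding opposite_minors_def block_nth by (fastforce simp: algebra_simps)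
  then show ?thesis
  proof cases
    case 1
    then show ?thesis
      using pivot[OF U(1) _ 1] by (intro exI[of _ 1]) (auto simp: forall_2 block_nth x_nth)
  next
    case 2
    then show ?thesis
      using pivot[OF U(2) _ 2] by (intro exI[of _ 2]) (auto simp: forall_2 block_nth x_nth)
  next
    case 3
    then show ?thesis
      using pivot[OF U(3) _ 3] by (intro exI[of _ 2]) (auto simp: forall_2 block_nth x_nth)
  next
    case 4
    then show ?thesis
      using pivot[OF U(4) _ 4] by (intro exI[of _ 1]) (auto simp: forall_2 block_nth x_nth)
  qed
qed

section \<open>Weak regularity in terms of minors\<close>

lemma det_T_mat:
  "det (T_mat (map_matrix (\<lambda>b. z * b) (diag2 p q)) C D) =
    (let X = (if Re (z * p) > 0 then C else D); Y = (if Re (z * q) > 0 then C else D)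
     in X$1$1 * Y$2$2 - Y$1$2 * X$2$1)"
  by (simp add: det_2 T_mat_def map_matrix_def diag2_def Let_def)

lemma invertible_Re_diag2:
  "invertible (map_matrix (\<lambda>b. Re (z * b)) (diag2 p q)) \<longleftrightarrow> Re (z * p) \<noteq> 0 \<and> Re (z * q) \<noteq> 0"
  by (simp add: invertible_det_nz det_2 map_matrix_def diag2_def)

lemma zero_notin_hull_halfplane:
  assumes "\<And>z. z \<in> S \<Longrightarrow> Re (z * c) > 0"
  shows "0 \<notin> convex hull S"
proof -
  have "Re (z * c) = cnj c \<bullet> z" for z by (simp add: inner_complex_def)
  then have "S \<subseteq> {z. cnj c \<bullet> z > 0}" using assms by auto
  then have "convex hull S \<subseteq> {z. cnj c \<bullet> z > 0}" by (rule hull_minimal) (rule convex_halfspace_gt)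
  then show ?thesis by auto
qed

lemma weakly_regular_iff_opposite_minors:
  assumes b: "b1 \<noteq> 0" "b2 \<noteq> 0" and ind: "Im (cnj b1 * b2) \<noteq> 0"
  shows "weakly_regular (diag2 (inverse b1) (inverse b2)) C D \<longleftrightarrow> opposite_minors C D"
proof
  assume "weakly_regular (diag2 (inverse b1) (inverse b2)) C D"
  then obtain z1 z2 z3 where hull: "0 \<in> interior (convex hull {z1, z2, z3})"
    and z: "\<And>z. z \<in> {z1, z2, z3} \<Longrightarrow> Re (z * inverse b1) \<noteq> 0 \<and> Re (z * inverse b2) \<noteq> 0 \<and>
      (let X = (if Re (z * inverse b1) > 0 then C else D); Y = (if Re (z * inverse b2) > 0 then C else D)
     in X$1$1 * Y$2$2 - Y$1$2 * X$2$1) \<noteq> 0"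
    unfolding weakly_regular_def invertible_Re_diag2 det_T_mat by blast
  have 0: "0 \<in> convex hull {z1, z2, z3}" using hull interior_subset by blast
  show "opposite_minors C D"
  proof (rule ccontr)
    assume "\<not> opposite_minors C D"
    \<comment> \<open>Without opposite nonzero minors, no two of the three points lie in opposite
      quadrants, so all three share the sign of one coordinate and lie in an open half plane with 0
      on its boundary.\<close>
    then consider "\<And>z. z \<in> {z1, z2, z3} \<Longrightarrow> Re (z * inverse b1) < 0" | "\<And>z. z \<in> {z1, z2, z3} \<Longrightarrow> Re (z * inverse b2) < 0"
      | "\<And>z. z \<in> {z1, z2, z3} \<Longrightarrow> Re (z * inverse b1) > 0" | "\<And>z. z \<in> {z1, z2, z3} \<Longrightarrow> Re (z * inverse b2) > 0"
      using z unfolding opposite_minors_def Let_def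
      by (smt (verit, ccfv_threshold))
    then show False
    proof cases
      case 1
      then show False using zero_notin_hull_halfplane[of "{z1, z2, z3}" "- inverse b1"] 0 by (simp del: times_complex.sel)
    next
      case 2
      then show False using zero_notin_hull_halfplane[of "{z1, z2, z3}" "- inverse b2"] 0 by (simp del: times_complex.sel)
    next
      case 3
      then show False using zero_notin_hull_halfplane[of "{z1, z2, z3}" "inverse b1"] 0 by blast
    next
      case 4
      then show False using zero_notin_hull_halfplane[of "{z1, z2, z3}" "inverse b2"] 0 by blast
    qed
  qed
next
  assume "opposite_minors C D"
  then obtain p1 p2 p3 where p: "\<And>p. p \<in> {p1, p2, p3} \<Longrightarrow> Re (b1 * p) \<noteq> 0 \<and> Re (b2 * p) \<noteq> 0 \<and> dom_coeff b1 b2 C D p \<noteq> 0"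
    "Im (cnj p1 * p2) \<noteq> 0" "p1 + p2 + 3 * p3 = 0"
    using opposite_minors_rays[OF ind] by metis
  \<comment> \<open>\<open>T_mat\<close> takes the column of \<open>C\<close> where
    \<open>Re (z / b) > 0\<close>, \<open>dom_coeff\<close> where \<open>Re (b * p) < 0\<close>.
    Since \<open>z / b = - cnj (b * p) / (norm b)\<^sup>2\<close> for this \<open>z\<close>, the two
    choices agree.\<close>
  let ?z = "\<lambda>p. - cnj p"
  have Re_z: "Re (?z p * inverse b) = - Re (b * p) / (norm b)\<^sup>2" for p b
    by (simp add: Re_divide cmod_power2 algebra_simps flip: divide_inverse) (metis minus_diff_eq minus_divide_left)
  have sgn: "Re (?z p * inverse b) > 0 \<longleftrightarrow> Re (b * p) < 0" "Re (?z p * inverse b) \<noteq> 0 \<longleftrightarrow> Re (b * p) \<noteq> 0" if "b \<noteq> 0" for p b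
    unfolding Re_z using that by (auto simp: divide_less_0_iff zero_less_divide_iff simp del: times_complex.sel)
  have p3: "p3 = - (p1 + p2) / 3"
    using p(3) by (simp add: field_simps eq_neg_iff_add_eq_0)
  have nc: "\<not> collinear {?z p1, ?z p2, ?z p3}"
  proof
    assume "collinear {?z p1, ?z p2, ?z p3}"
    then obtain u s t where "?z p1 - ?z p2 = s *\<^sub>R u" "?z p1 - ?z p3 = t *\<^sub>R u"
      unfolding collinear_def by blast
    then have "p1 - p2 = of_real (- s) * cnj u" "4 * p1 + p2 = of_real (- 3 * t) * cnj u"
      unfolding p3 by (auto simp: complex_eq_iff field_simps)
    then have "p1 = of_real ((- s - 3 * t) / 5) * cnj u" "p2 = of_real ((4 * s - 3 * t) / 5) * cnj u"
      by (auto simp: complex_eq_iff field_simps)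
    moreover have "Im (cnj (of_real r * v) * (of_real r' * v)) = 0" for r r' v by (simp add: algebra_simps)
    ultimately have "Im (cnj p1 * p2) = 0" by metis
    with p(2) show False by blast
  qed
  \<comment> \<open>The relation \<open>p1 + p2 + 3 * p3 = 0\<close>, normalized to strictly
    positive barycentric coordinates; for a nondegenerate triangle these characterize the interior
    points.\<close>
  have sum: "(1/5) *\<^sub>R ?z p1 + (1/5) *\<^sub>R ?z p2 + (3/5) *\<^sub>R ?z p3 = 0"
    unfolding p3 by (simp add: complex_eq_iff field_simps)
  have "\<exists>x y z. 0 < x \<and> 0 < y \<and> 0 < z \<and> x + y + z = 1 \<and> x *\<^sub>R ?z p1 + y *\<^sub>R ?z p2 + z *\<^sub>R ?z p3 = 0"
    by (rule exI[of _ "1/5"], rule exI[of _ "1/5"], rule exI[of _ "3/5"], intro conjI sum) simp_all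
  then have hull: "0 \<in> interior (convex hull {?z p1, ?z p2, ?z p3})"
    by (subst interior_convex_hull_3_minimal[OF nc]) auto
  have reg: "invertible (map_matrix (\<lambda>b. Re (?z p * b)) (diag2 (inverse b1) (inverse b2))) \<and>
      det (T_mat (map_matrix (\<lambda>b. ?z p * b) (diag2 (inverse b1) (inverse b2))) C D) \<noteq> 0" if "p \<in> {p1, p2, p3}" for p
    using p(1)[OF that] by (simp only: invertible_Re_diag2 det_T_mat sgn[OF b(1)] sgn[OF b(2)] dom_coeff_def simp_thms)
  show "weakly_regular (diag2 (inverse b1) (inverse b2)) C D"
    unfolding weakly_regular_def
  proof (intro exI conjI ballI)
    show "0 \<in> interior (convex hull {?z p1, ?z p2, ?z p3})" by (rule hull)
    fix z assume "z \<in> {?z p1, ?z p2, ?z p3}"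
    then obtain p where "p \<in> {p1, p2, p3}" "z = ?z p" by blast
    then show "invertible (map_matrix (\<lambda>b. Re (z * b)) (diag2 (inverse b1) (inverse b2)))"
      "det (T_mat (map_matrix (\<lambda>b. z * b) (diag2 (inverse b1) (inverse b2))) C D) \<noteq> 0"
      using reg by blast+
  qed
qed

theorem corollary6p3:
  fixes b1 b2 :: complex and a :: "complex^4^2" and B C D :: "complex^2^2"
  assumes "b1 \<noteq> 0" and "b2 \<noteq> 0" and "b1 * inverse b2 \<notin> \<real>"
    and "rank a = 2"
  defines "B \<equiv> diag2 (inverse b1) (inverse b2)"
    and "C \<equiv> left_block a" and "D \<equiv> right_block a"
  shows "weakly_regular B C D \<longleftrightarrow>
           complete_operator (L_op B C D) \<and> complete_operator (op_adjoint (L_op B C D))"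
proof -
  have ind: "Im (cnj b1 * b2) \<noteq> 0"
  proof
    assume "Im (cnj b1 * b2) = 0"
    then have "Im (b1 * inverse b2) = 0" by (simp add: Im_divide algebra_simps flip: divide_inverse)
    then show False using assms(3) by (simp add: complex_is_Real_iff)
  qed
  have "complete_operator (L_op B C D) \<and> complete_operator (op_adjoint (L_op B C D))" if opp: "opposite_minors C D"
  proof
    show "complete_operator (L_op B C D)"
      unfolding B_def by (rule opposite_minors_complete[OF assms(1,2) ind opp order_refl])
    obtain C' D' where adj: "opposite_minors C' D'"
      "bvp_op (cnj b1) (cnj b2) C' D' \<subseteq> op_adjoint (bvp_op b1 b2 C D)"
      using opposite_minors_adjoint[OF assms(1,2) opp] by metis
    have "Im (cnj (cnj b1) * cnj b2) \<noteq> 0" using ind by (simp add: algebra_simps)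
    then show "complete_operator (op_adjoint (L_op B C D))"
      unfolding B_def using assms(1,2)
      by (intro opposite_minors_complete[OF _ _ _ adj(1) root_functions_mono[OF adj(2)]]) auto
  qed
  moreover have "\<not> (complete_operator (L_op B C D) \<and> complete_operator (op_adjoint (L_op B C D)))" if opp: "\<not> opposite_minors C D"
  proof -
    obtain k and e :: real where e: "e \<in> {0, 1}"
      and cases: "(\<forall>y :: 2 vfun. C *v y 0 + D *v y 1 = 0 \<longrightarrow> y e $ k = 0) \<or> (\<forall>i. (if e = 0 then C else D) $ i $ k = 0)"
      using not_opposite_minors_cases[OF assms(4)] opp unfolding C_def D_def by metis
    then show ?thesis
      using L_op_incomplete[OF assms(1,2) e, of C D k] adjoint_incomplete[OF assms(1,2) e, of C D k]
      unfolding B_def by blast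
  qed
  ultimately show ?thesis
    using weakly_regular_iff_opposite_minors[OF assms(1,2) ind] unfolding B_def by blast
qed

end
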